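(* Let $r\ge2$, let $a_1,\dots,a_r$ be pairwise distinct positive real numbers, let $\alpha\ge0$, and let $(\mathbf n^{(N)})_{N\in\mathbb N}$ be a path-like sequence of multi-indices in $\mathbb N^r$ with limiting proportions $q_1,\dots,q_r\in(0,1)$ (see context). Let $\nu_N$ be the zero probability distribution of the rescaled multiple Laguerre polynomial (of the second kind) $L_N^{(N\alpha;\,Na_1,\dots,Na_r)}(x)$. Then the weak limit $\nu$ of $\nu_N$ as $N\to\infty$, namely $\nu=\mu_{\mathrm{MP}(\frac1{1+\alpha})}\boxtimes\big(\sum_{j=1}^r q_j\delta_{1/a_j}\big)$, has a Cauchy–Stieltjes transform $G(z)=\int\frac{\nu(\mathrm dx)}{z-x}$ which satisfies the algebraic equation $$P\big(z,G(z)\big)=0,\qquad z\in\mathbb C\setminus\mathrm{supp}(\nu),$$ where $$P(z,w)=w\prod_{i=1}^r\Big(z-\frac{zw}{a_i}+\frac{\alpha}{a_i}\Big)-\sum_{i=1}^r q_i\prod_{j=1,\,j\ne i}^r\Big(z-\frac{zw}{a_j}+\frac{\alpha}{a_j}\Big).$$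
   Context: $\mathbb N=\{0,1,2,\dots\}$. Path-like sequence: multi-indices $\mathbf n^{(N)}=(n_1^{(N)},\dots,n_r^{(N)})\in\mathbb N^r$, $N\in\mathbb N$, such that (a) $\sum_{i=1}^r n_i^{(N)}=N$ for every $N$; (b) $n_i^{(N+1)}\ge n_i^{(N)}$ for every $N$ and $1\le i\le r$; (c) there is $R\in\mathbb N$ such that $n_i^{(N+R)}\ge n_i^{(N)}+1$ for every $N$ and $1\le i\le r$; (d) there are $q_1,\dots,q_r\in(0,1)$ with $\lim_{N\to\infty}n_i^{(N)}/N=q_i$ for $1\le i\le r$. Multiple Laguerre polynomial of the second kind: for $\beta\ge0$ and pairwise distinct positive $b_1,\dots,b_r$, $L_N^{(\beta;\,b_1,\dots,b_r)}$ is the unique monic polynomial of degree $N$ such that for every $1\le j\le r$, with $w_j(x)=e^{(1-b_j)x}$, $$\int_0^{\infty}x^kL_N^{(\beta;\,b_1,\dots,b_r)}(x)\,w_j(x)\,x^{\beta}e^{-x}\,\mathrm dx=0,\qquad 0\le k\le n_j^{(N)}-1$$ (for these weights existence and uniqueness hold for every multi-index). The zero probability distribution of a polynomial of degree $N$ with complex zeros $z_1,\dots,z_N$ (with multiplicity) is $\frac1N\sum_{i=1}^N\delta_{z_i}$. Marchenko–Pastur distribution of parameter $\rho>0$ (rescaled): $$\mu_{\mathrm{MP}(\rho)}(\mathrm dx)=\max\Big(1-\frac1\rho,0\Big)\delta_0+\frac1{2\pi x}\sqrt{(\rho_+-x)(x-\rho_-)}\,\mathbf 1_{[\rho_-,\rho_+]}(x)\,\mathrm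 dx,\qquad \rho_\pm=(1\pm\sqrt\rho)^2/\rho.$$ Free multiplicative convolution: for a compactly supported probability measure $\lambda\ne\delta_0$ on $[0,+\infty)$, let $\chi_\lambda$ be the inverse for composition of formal series of $\sum_{k\ge1}\big(\int x^k\lambda(\mathrm dx)\big)z^k$, and $S_\lambda(z)=\frac{1+z}{z}\chi_\lambda(z)$. For two such measures $\lambda,\eta$, $\lambda\boxtimes\eta$ is the unique compactly supported probability measure on $[0,+\infty)$, different from $\delta_0$, with $S_{\lambda\boxtimes\eta}=S_\lambda S_\eta$.
   Formalization: In P(z,w) the term α/a_i is taken with a minus sign, z − zw/a_i − α/a_i: with the printed plus sign the equation fails for every α>0, as it would force ν to have mean (1−α)Σq_i/a_i instead of (1+α)Σq_i/a_i. *)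

theory Defs
  imports
    "HOL-Probability.Probability"
    "HOL-Computational_Algebra.Computational_Algebra"
begin

(* A multi-index in N^r is a function "nat => nat", of which only the values on {1..r} matter;
   n N i stands for the i-th component of the N-th multi-index. *)

definition path_like :: "nat \<Rightarrow> (nat \<Rightarrow> nat \<Rightarrow> nat) \<Rightarrow> (nat \<Rightarrow> real) \<Rightarrow> bool" where
  "path_like r n q \<longleftrightarrow>
     (\<forall>N. (\<Sum>i\<in>{1..r}. n N i) = N) \<and>
     (\<forall>N. \<forall>i\<in>{1..r}. n (N + 1) i \<ge> n N i) \<and>
     (\<exists>R. \<forall>N. \<forall>i\<in>{1..r}. n (N + R) i \<ge> n N i + 1) \<and>
     (\<forall>i\<in>{1..r}. q i \<in> {0<..<1} \<and> (\<lambda>N. real (n N i) / real N) \<longlonglongrightarrow> q i)"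


(* All the integrals below converge absolutely when \<beta> \<ge> 0 and b j > 0, so the convention that a
   divergent integral is 0 plays no role there. *)

definition is_multiple_laguerre2 ::
    "nat \<Rightarrow> real \<Rightarrow> (nat \<Rightarrow> real) \<Rightarrow> (nat \<Rightarrow> nat) \<Rightarrow> real poly \<Rightarrow> bool" where
  "is_multiple_laguerre2 r \<beta> b m p \<longleftrightarrow>
     lead_coeff p = 1 \<and> degree p = (\<Sum>j\<in>{1..r}. m j) \<and>
     (\<forall>j\<in>{1..r}. \<forall>k<m j.
        (LINT x:{0..}|lborel.
           x ^ k * poly p x * exp ((1 - b j) * x) * x powr \<beta> * exp (- x)) = 0)"

definition multiple_laguerre2 ::
    "nat \<Rightarrow> real \<Rightarrow> (nat \<Rightarrow> real) \<Rightarrow> (nat \<Rightarrow> nat) \<Rightarrow> real poly" where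
  "multiple_laguerre2 r \<beta> b m = (THE p. is_multiple_laguerre2 r \<beta> b m p)"


(* The push-forward turns the discrete sigma-algebra of the pmf into the Borel one.
   Junk value for polynomials without zeros. *)

definition zero_distribution :: "real poly \<Rightarrow> complex measure" where
  "zero_distribution p =
     distr (measure_pmf (pmf_of_multiset (proots (map_poly complex_of_real p)))) borel (\<lambda>z. z)"

definition weakly_converges_to ::
    "(nat \<Rightarrow> 'a::topological_space measure) \<Rightarrow> 'a measure \<Rightarrow> bool" where
  "weakly_converges_to M M' \<longleftrightarrow>
     (\<forall>f::'a \<Rightarrow> real. continuous_on UNIV f \<and> bounded (range f) \<longrightarrow>
        (\<lambda>N. integral\<^sup>L (M N) f) \<longlonglongrightarrow> integral\<^sup>L M' f)"

definition measure_support :: "'a::topological_space measure \<Rightarrow> 'a set" where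
  "measure_support \<mu> = {x. \<forall>U. open U \<and> x \<in> U \<longrightarrow> emeasure \<mu> U > 0}"

definition cauchy_stieltjes :: "real measure \<Rightarrow> complex \<Rightarrow> complex" where
  "cauchy_stieltjes \<mu> z = (LINT x|\<mu>. 1 / (z - complex_of_real x))"


definition marchenko_pastur :: "real \<Rightarrow> real measure" where
  "marchenko_pastur \<rho> =
     (let lo = (1 - sqrt \<rho>)\<^sup>2 / \<rho>; hi = (1 + sqrt \<rho>)\<^sup>2 / \<rho> in
      measure_of UNIV (sets borel) (\<lambda>A.
        ennreal (max (1 - 1 / \<rho>) 0) * emeasure (return borel 0) A +
        (\<integral>\<^sup>+ x \<in> A. ennreal (1 / (2 * pi * x) * sqrt ((hi - x) * (x - lo)) *
                               indicator {lo..hi} x) \<partial>lborel)))"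

(* The measure sum over j in {1..r} of q j times the unit mass at x j. *)

definition discrete_measure :: "nat \<Rightarrow> (nat \<Rightarrow> real) \<Rightarrow> (nat \<Rightarrow> real) \<Rightarrow> real measure" where
  "discrete_measure r q x = distr (point_measure {1..r} (\<lambda>j. ennreal (q j))) borel x"


definition compact_prob_nonneg :: "real measure \<Rightarrow> bool" where
  "compact_prob_nonneg \<mu> \<longleftrightarrow>
     prob_space \<mu> \<and> sets \<mu> = sets borel \<and>
     compact (measure_support \<mu>) \<and> measure_support \<mu> \<subseteq> {0..} \<and>
     \<mu> \<noteq> return borel 0"

definition moment_series :: "real measure \<Rightarrow> real fps" where
  "moment_series \<mu> = Abs_fps (\<lambda>k. if k = 0 then 0 else (LINT x|\<mu>. x ^ k))"

(* fps_inv is the inverse for composition. It has no constant term, so the division by fps_X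
   is exact. *)

definition S_transform :: "real measure \<Rightarrow> real fps" where
  "S_transform \<mu> = ((1 + fps_X) * fps_inv (moment_series \<mu>)) / fps_X"

definition free_mult_conv :: "real measure \<Rightarrow> real measure \<Rightarrow> real measure"
    (infixl "\<boxtimes>" 70) where
  "\<mu> \<boxtimes> \<eta> = (THE \<nu>. compact_prob_nonneg \<nu> \<and>
                 S_transform \<nu> = S_transform \<mu> * S_transform \<eta>)"


(* The term \<alpha> / a i enters with a minus sign. With a plus sign, as this polynomial is sometimes
   printed, the relation P(z, G(z)) = 0 fails for every \<alpha> > 0: expanding it at z = infinity
   gives the mean (1 - \<alpha>) * (SUM i. q i / a i) for the measure, instead of the mean
   (1 + \<alpha>) * (SUM i. q i / a i) of marchenko_pastur (1 / (1 + \<alpha>)) \<boxtimes> discrete_measure r q (1 / a). *)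

definition laguerre_curve ::
    "nat \<Rightarrow> (nat \<Rightarrow> real) \<Rightarrow> (nat \<Rightarrow> real) \<Rightarrow> real \<Rightarrow> complex \<Rightarrow> complex \<Rightarrow> complex" where
  "laguerre_curve r a q \<alpha> z w =
     w * (\<Prod>i\<in>{1..r}. z - z * w / of_real (a i) - of_real (\<alpha> / a i)) -
     (\<Sum>i\<in>{1..r}. of_real (q i) *
        (\<Prod>j\<in>{1..r} - {i}. z - z * w / of_real (a j) - of_real (\<alpha> / a j)))"

end

theory Submission
  imports Defs "HOL-Complex_Analysis.Complex_Analysis"
begin

text \<open>
  Put \<lambda> = 1 + \<alpha> and u_i = 1 / a_i.  The polynomial of degree N is explicit: multiplying the k-th
  coefficient from the top of the product of the (x - u_i / N)^(n_i) by the falling factorial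
  s (s - 1) ... (s - k + 1) with s = N \<lambda> gives the multiple Laguerre polynomial
  (\<open>multiple_laguerre2_eq\<close>).  Indeed, Gamma integrals turn the orthogonality relations into the
  vanishing of the first n_i derivatives, starting with the zeroth, of an auxiliary polynomial of
  degree N at each u_i / N, so they say that this polynomial is divisible by the product.

  Equivalently, x^\<beta> p(x) arises from x^s by applying the operators 1 - (u_i / N) d/dx, n_i times
  each.  One such operator preserves having only nonnegative zeros, because the logarithmic
  derivative of x^\<gamma> p(x) has imaginary part of fixed sign in the upper half plane and is negative on
  the negative axis.  A barrier argument on the same logarithmic derivative moves the upper bound of
  the zeros by only O(1 / N) per step.  Hence all zeros stay in one compact interval
  (\<open>laguerre_transform_roots\<close>).

  The moment series M_N of the zeros is read off from the reversed polynomial P as -t P' / (N P).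
  Removing one factor u_i / N and lowering s by one gives polynomials P_i, and the quotients
  Q_i = P_i / P satisfy together with M_N a closed system of formal power series equations in which
  every coefficient is determined by earlier ones (\<open>laguerre_moment_system\<close>).  The system is a
  perturbation of order 1 / N of a limiting one, so all moments converge, and the limit M satisfies
  M(t) = sum_i q_i Y_i / (1 - Y_i) with Y_i = u_i t (\<lambda> + M(t)) (\<open>laguerre_system_converges\<close>).
  Compactness upgrades this to weak convergence.

  The limiting equation says M = E o (t (\<lambda> + M)) for the moment series E of the discrete measure.  The
  moment series A of the Marchenko-Pastur law satisfies A = t (\<lambda> + A) (1 + A), and inverting both
  equations yields S_M = S_A S_E.  So the limit is the free multiplicative convolution, whose
  existence is thereby established as well (\<open>limit_is_free_mult_conv\<close>).  Finally, with z = 1 / t and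
  z G(z) = 1 + M(t) the limiting equation is that of the curve near infinity, and analytic continuation
  carries it to the whole complement of the support (\<open>laguerre_curve_vanishes\<close>).
\<close>


section \<open>The Laguerre transform of a polynomial\<close>

definition falling :: "real \<Rightarrow> nat \<Rightarrow> real" where
  "falling s k = (\<Prod>i<k. s - real i)"

lemma falling_0 [simp]: "falling s 0 = 1"
  by (simp add: falling_def)

lemma falling_Suc: "falling s (Suc k) = falling s k * (s - real k)"
  by (simp add: falling_def)

lemma falling_Suc_shift: "falling s (Suc k) = s * falling (s - 1) k"
  unfolding falling_def prod.lessThan_Suc_shift by (simp add: algebra_simps)

lemma coeff_weighted_monoms:
  fixes p :: "real poly"
  shows "coeff (\<Sum>m\<le>degree p. monom (w m * coeff p m) m) k = w k * coeff p k"
proof -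
  have "coeff (\<Sum>m\<le>degree p. monom (w m * coeff p m) m) k =
          (\<Sum>m\<le>degree p. if k = m then w m * coeff p m else 0)"
    unfolding coeff_sum by (intro sum.cong) auto
  also have "\<dots> = w k * coeff p k"
    by (simp add: sum.delta' coeff_eq_0)
  finally show ?thesis .
qed

text \<open>
  If A is a product of N factors x - c, then x^(s - N) times the transform is obtained from x^s by
  applying the operators 1 - c d/dx, one for each factor.
\<close>

definition laguerre_transform :: "real \<Rightarrow> real poly \<Rightarrow> real poly" where
  "laguerre_transform s A =
     (\<Sum>m\<le>degree A. monom (falling s (degree A - m) * coeff A m) m)"

lemma coeff_laguerre_transform:
  "coeff (laguerre_transform s A) m = falling s (degree A - m) * coeff A m"
  unfolding laguerre_transform_def by (rule coeff_weighted_monoms)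

lemma degree_laguerre_transform [simp]: "degree (laguerre_transform s A) = degree A"
proof (cases "A = 0")
  case False
  thus ?thesis
    by (intro antisym degree_le le_degree) (auto simp: coeff_laguerre_transform coeff_eq_0)
qed (simp add: laguerre_transform_def)

lemma lead_coeff_laguerre_transform [simp]:
  "lead_coeff (laguerre_transform s A) = lead_coeff A"
  by (simp add: coeff_laguerre_transform)

text \<open>
  One more operator 1 - c d/dx, seen on polynomials: it sends x^\<gamma> p(x), where \<gamma> = s - deg A, to
  x^(\<gamma> - 1) q(x) with q = x p - c (\<gamma> p + x p').
\<close>

lemma laguerre_transform_linear_factor:
  assumes "A \<noteq> 0"
  shows "laguerre_transform s ([:- c, 1:] * A) =
           pCons 0 (laguerre_transform s A) -
           smult c (smult (s - real (degree A)) (laguerre_transform s A) +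
                    pCons 0 (pderiv (laguerre_transform s A)))"
proof (rule poly_eqI)
  fix m
  have deg: "degree ([:- c, 1:] * A) = Suc (degree A)"
    using assms by (subst degree_mult_eq) auto
  have eq: "falling s (Suc (degree A) - m) * coeff A m =
          (s - real (degree A) + real m) * falling s (degree A - m) * coeff A m"
  proof (cases "m \<le> degree A")
    case True
    thus ?thesis by (simp add: Suc_diff_le falling_Suc of_nat_diff algebra_simps)
  qed (simp add: coeff_eq_0)
  show "coeff (laguerre_transform s ([:- c, 1:] * A)) m =
        coeff (pCons 0 (laguerre_transform s A) -
           smult c (smult (s - real (degree A)) (laguerre_transform s A) +
                    pCons 0 (pderiv (laguerre_transform s A)))) m"
    unfolding coeff_laguerre_transform deg using arg_cong[OF eq, of "(*) c"]
    by (cases m) (auto simp: coeff_laguerre_transform coeff_pderiv algebra_simps)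
qed


section \<open>Zeros of the Laguerre transform\<close>

lemma pderiv_linear_factor:
  fixes p :: "'a :: idom poly"
  shows "pderiv ([:- y, 1:] * p) = p + [:- y, 1:] * pderiv p"
  unfolding pderiv_mult by (simp add: pderiv_pCons)

lemma poly_pderiv_linear_factors:
  fixes R :: "'a :: field multiset"
  assumes "x \<notin># R"
  shows "poly (pderiv (\<Prod>y\<in>#R. [:- y, 1:])) x =
           poly (\<Prod>y\<in>#R. [:- y, 1:]) x * (\<Sum>y\<in>#R. 1 / (x - y))"
  using assms
proof (induction R)
  case (add y R)
  hence "x - y \<noteq> 0" by auto
  thus ?case using add
    by (simp add: pderiv_linear_factor field_simps del: mult_pCons_left)
qed auto

lemma poly_pderiv2_linear_factors:
  fixes R :: "'a :: field multiset"
  assumes "x \<notin># R"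
  shows "poly (pderiv (pderiv (\<Prod>y\<in>#R. [:- y, 1:]))) x =
           poly (\<Prod>y\<in>#R. [:- y, 1:]) x *
             ((\<Sum>y\<in>#R. 1 / (x - y)) ^ 2 - (\<Sum>y\<in>#R. 1 / (x - y) ^ 2))"
  using assms
proof (induction R)
  case (add y R)
  let ?p = "\<Prod>y\<in>#R. [:- y, 1:]"
  have 1: "x - y \<noteq> 0" "x \<notin># R" using add.prems by auto
  have 2: "pderiv (pderiv (\<Prod>y\<in>#add_mset y R. [:- y, 1:])) =
            2 * pderiv ?p + [:- y, 1:] * pderiv (pderiv ?p)"
    by (simp add: pderiv_linear_factor pderiv_add del: mult_pCons_left)
  define \<sigma> \<rho> where "\<sigma> = (\<Sum>y\<in>#R. 1 / (x - y))" and "\<rho> = (\<Sum>y\<in>#R. 1 / (x - y) ^ 2)"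
  have "2 * (P * \<sigma>) + (x - y) * (P * (\<sigma> ^ 2 - \<rho>)) =
          (x - y) * P * ((1 / (x - y) + \<sigma>) ^ 2 - (1 / (x - y) ^ 2 + \<rho>))" for P
    using 1(1) by (simp add: divide_simps power2_eq_square) (simp add: algebra_simps)
  note eq = this[of "poly ?p x"]
  have "poly (2 * pderiv ?p + [:- y, 1:] * pderiv (pderiv ?p)) x =
          2 * (poly ?p x * \<sigma>) + (x - y) * (poly ?p x * (\<sigma> ^ 2 - \<rho>))"
    using add.IH[OF 1(2)] poly_pderiv_linear_factors[OF 1(2)]
    by (simp add: \<sigma>_def \<rho>_def left_diff_distrib)
  also note eq
  finally show ?case
    unfolding 2 by (simp add: \<sigma>_def \<rho>_def left_diff_distrib)
qed auto

lemma poly_map_poly_of_real: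
  "poly (map_poly complex_of_real p) (of_real t) = of_real (poly p t)"
  by (induction p) (simp_all add: map_poly_pCons)

lemma map_poly_linear_factors:
  "map_poly complex_of_real (\<Prod>y\<in>#R. [:- y, 1:]) = (\<Prod>y\<in>#R. [:- complex_of_real y, 1:])"
proof (induction R)
  case (add y R)
  have "map_poly complex_of_real ([:- y, 1:] * p) =
          map_poly complex_of_real [:- y, 1:] * map_poly complex_of_real p" for p
  proof (rule poly_eqI)
    fix m show "coeff (map_poly complex_of_real ([:- y, 1:] * p)) m =
          coeff (map_poly complex_of_real [:- y, 1:] * map_poly complex_of_real p) m"
      by (cases m) (simp_all add: coeff_map_poly map_poly_pCons)
  qed
  thus ?case using add by (simp add: map_poly_pCons del: mult_pCons_left)
qed simp

lemma real_factorization_of_complex_roots: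
  fixes p :: "real poly"
  assumes "lead_coeff p = 1"
    and roots: "\<And>z. poly (map_poly complex_of_real p) z = 0 \<Longrightarrow> z \<in> complex_of_real ` S"
  obtains R where "p = (\<Prod>y\<in>#R. [:- y, 1:])" "set_mset R \<subseteq> S"
proof -
  define P where "P = map_poly complex_of_real p"
  have deg: "degree P = degree p" by (simp add: P_def degree_map_poly)
  have "lead_coeff P = 1" using assms(1) by (simp add: P_def degree_map_poly coeff_map_poly)
  then obtain A where A: "P = (\<Prod>x\<in>#A. [:- x, 1:])"
    using complex_poly_decompose_multiset[of P] by (metis smult_1_left)
  define R where "R = image_mset Re A"
  have real: "z \<in> complex_of_real ` S" if "z \<in># A" for z
  proof -
    have "poly P z = 0" unfolding A poly_prod_mset using that
      by (auto simp: prod_mset_zero_iff image_iff)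
    thus ?thesis using roots by (simp add: P_def)
  qed
  have "image_mset (\<lambda>y. [:- complex_of_real y, 1:]) R = image_mset (\<lambda>x. [:- x, 1:]) A"
    unfolding R_def multiset.map_comp comp_def
    by (rule image_mset_cong) (use real in force)
  hence "P = map_poly complex_of_real (\<Prod>y\<in>#R. [:- y, 1:])"
    unfolding map_poly_linear_factors A by simp
  hence "coeff p i = coeff (\<Prod>y\<in>#R. [:- y, 1:]) i" for i
    unfolding P_def poly_eq_iff by (simp add: coeff_map_poly)
  hence "p = (\<Prod>y\<in>#R. [:- y, 1:])" by (simp add: poly_eq_iff)
  moreover have "set_mset R \<subseteq> S" using real by (force simp: R_def)
  ultimately show ?thesis using that by blast
qed

text \<open>
  Away from the old zeros, the new zeros are the points where the logarithmic derivative of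
  x^\<gamma> p(x), namely \<gamma> / z + sum 1 / (z - y), takes the value 1 / c.
\<close>

lemma poly_laguerre_step:
  fixes R :: "'a :: field multiset"
  assumes "z \<noteq> 0" "z \<notin># R"
  defines "p \<equiv> (\<Prod>y\<in>#R. [:- y, 1:])"
  shows "poly (pCons 0 p - smult c (smult \<gamma> p + pCons 0 (pderiv p))) z =
           z * poly p z * (1 - c * (\<gamma> / z + (\<Sum>y\<in>#R. 1 / (z - y))))"
proof -
  have "poly (pderiv p) z = poly p z * (\<Sum>y\<in>#R. 1 / (z - y))"
    unfolding p_def by (rule poly_pderiv_linear_factors) fact
  thus ?thesis using assms(1) by (simp add: field_simps)
qed

lemma poly_linear_factors_eq_0_iff:
  fixes R :: "'a :: field multiset"
  shows "poly (\<Prod>y\<in>#R. [:- y, 1:]) x = 0 \<longleftrightarrow> x \<in># R"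
  by (auto simp: poly_prod_mset prod_mset_zero_iff)

lemma Im_potential_sign:
  fixes \<gamma> :: real and R :: "real multiset" and z :: complex
  assumes "\<gamma> > 0" "Im z \<noteq> 0"
  shows "Im (of_real \<gamma> / z + (\<Sum>y\<in>#R. 1 / (z - of_real y))) \<noteq> 0"
proof -
  have pole: "Im (1 / (z - of_real y)) * Im z < 0" for y
  proof -
    have "Im (1 / (z - of_real y)) * Im z = - ((Im z)\<^sup>2 / ((Re z - y)\<^sup>2 + (Im z)\<^sup>2))"
      by (simp add: Im_divide power2_eq_square)
    moreover have "(Re z - y)\<^sup>2 + (Im z)\<^sup>2 > 0" using assms(2) by (simp add: add_nonneg_pos)
    ultimately show ?thesis using assms(2) by simp
  qed
  have "Im (\<Sum>y\<in>#R. 1 / (z - of_real y)) * Im z \<le> 0"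
  proof (induction R)
    case (add y R)
    thus ?case using pole[of y] by (simp add: algebra_simps)
  qed simp
  moreover have "Im (of_real \<gamma> / z) * Im z < 0"
  proof -
    have "Im (of_real \<gamma> / z) * Im z = \<gamma> * (Im (1 / (z - of_real 0)) * Im z)"
      by (simp add: Im_divide)
    thus ?thesis using pole[of 0] assms(1) by (metis mult_pos_neg)
  qed
  ultimately have "Im (of_real \<gamma> / z + (\<Sum>y\<in>#R. 1 / (z - of_real y))) * Im z < 0"
    by (simp add: algebra_simps)
  thus ?thesis by auto
qed

text \<open>The graph of 1 / u lies above its tangent at u + d.\<close>

lemma inverse_convex_bound:
  fixes u d :: real
  assumes "u > 0" "d \<ge> 0"
  shows "1 / (u + d) + d / (u + d)\<^sup>2 \<le> 1 / u"
proof -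
  have "1 / u - (1 / (u + d) + d / (u + d)\<^sup>2) = d\<^sup>2 / (u * (u + d)\<^sup>2)"
    using assms by (simp add: divide_simps add_nonneg_eq_0_iff power2_eq_square) algebra
  also have "\<dots> \<ge> 0" using assms by simp
  finally show ?thesis by simp
qed

text \<open>
  The barrier argument.  Write \<phi> for the logarithmic derivative of x^\<gamma> p(x) and suppose \<phi> \<le> \<theta> at a
  point x to the right of all zeros.  As c \<theta> \<le> 1 / 2, the equation c \<phi> = 1 has no solution beyond x,
  off the real axis, or on the negative axis.  The logarithmic derivative after the step is
  \<phi> + c (- \<phi>') / (1 - c \<phi>), and the factor c / (1 - c \<phi>) is at most 1 / \<theta>.  So at x + 1 / \<theta> it is at
  most the value at x of the tangent to \<phi> at x + 1 / \<theta>, hence by convexity at most \<phi>(x).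
\<close>

lemma laguerre_step_roots:
  fixes R :: "real multiset" and c \<gamma> \<theta> x :: real
  defines "p \<equiv> (\<Prod>y\<in>#R. [:- y, 1:])"
  defines "q \<equiv> pCons 0 p - smult c (smult \<gamma> p + pCons 0 (pderiv p))"
  assumes "lead_coeff q = 1" "\<theta> > 0" "\<gamma> > 0" "x > 0" "c > 0" "2 * \<theta> * c \<le> 1"
    and R: "\<And>y. y \<in># R \<Longrightarrow> 0 \<le> y \<and> y < x"
    and barrier: "\<gamma> / x + (\<Sum>y\<in>#R. 1 / (x - y)) \<le> \<theta>"
  shows "\<exists>R'. q = (\<Prod>y\<in>#R'. [:- y, 1:]) \<and> (\<forall>y\<in>#R'. 0 \<le> y \<and> y < x) \<and>
           (\<gamma> - 1) / (x + 1 / \<theta>) + (\<Sum>y\<in>#R'. 1 / (x + 1 / \<theta> - y)) \<le> \<theta>"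
proof -
  define \<phi> where "\<phi> = (\<lambda>t. \<gamma> / t + (\<Sum>y\<in>#R. 1 / (t - y)))"
  have q_factor: "poly q t = t * poly p t * (1 - c * \<phi> t)" if "t \<noteq> 0" "t \<notin># R" for t
    using poly_laguerre_step[OF that, of c \<gamma>] by (simp add: q_def p_def \<phi>_def)
  have \<phi>_mono: "\<phi> t \<le> \<theta>" if "x \<le> t" for t
  proof -
    have "(\<Sum>y\<in>#R. 1 / (t - y)) \<le> (\<Sum>y\<in>#R. 1 / (x - y))"
      using R that by (intro sum_mset_mono) (auto intro!: frac_le)
    moreover have "\<gamma> / t \<le> \<gamma> / x"
      using that assms by (intro frac_le) auto
    ultimately show ?thesis using barrier by (simp add: \<phi>_def)
  qed
  have half: "c * \<phi> t \<le> 1 / 2" if "x \<le> t" for t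
  proof -
    have "c * \<phi> t \<le> c * \<theta>" using \<phi>_mono[OF that] \<open>c > 0\<close> by simp
    also have "c * \<theta> \<le> 1 / 2" using \<open>2 * \<theta> * c \<le> 1\<close> by (simp add: mult_ac)
    finally show ?thesis .
  qed
  have p_nz: "poly p t \<noteq> 0" if "t \<notin># R" for t
    using that by (simp add: p_def poly_linear_factors_eq_0_iff)
  have real_roots: "t \<in> {0..<x}" if "poly q t = 0" for t
  proof (rule ccontr)
    assume t: "t \<notin> {0..<x}"
    hence "t \<noteq> 0" "t \<notin># R" using R assms by auto
    hence "c * \<phi> t = 1" using q_factor that p_nz by auto
    moreover have "c * \<phi> t \<le> 1 / 2"
    proof (cases "x \<le> t")
      case False
      hence "t < 0" using t by auto
      have "(\<Sum>y\<in>#R. 1 / (t - y)) \<le> (\<Sum>y\<in>#R. 0)"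
        using R \<open>t < 0\<close> by (intro sum_mset_mono) (force simp: divide_le_0_iff)
      moreover have "\<gamma> / t < 0" using \<open>t < 0\<close> assms by (simp add: divide_less_0_iff)
      ultimately have "\<phi> t < 0" by (simp add: \<phi>_def)
      hence "c * \<phi> t < 0" using assms by (simp add: mult_pos_neg)
      thus ?thesis by simp
    qed (use half in auto)
    ultimately show False by simp
  qed
  define pc where "pc = (\<Prod>y\<in>#image_mset complex_of_real R. [:- y, 1:])"
  have pc: "map_poly complex_of_real p = pc"
    unfolding p_def pc_def map_poly_linear_factors by (simp add: multiset.map_comp comp_def)
  have qc: "map_poly complex_of_real q =
              pCons 0 pc - smult (of_real c) (smult (of_real \<gamma>) pc + pCons 0 (pderiv pc))"
  proof (rule poly_eqI)
    fix m show "coeff (map_poly complex_of_real q) m = coeff (pCons 0 pc -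
      smult (of_real c) (smult (of_real \<gamma>) pc + pCons 0 (pderiv pc))) m"
      unfolding pc[symmetric] q_def by (cases m) (simp_all add: coeff_map_poly coeff_pderiv)
  qed
  have roots: "z \<in> complex_of_real ` {0..<x}" if z: "poly (map_poly complex_of_real q) z = 0" for z
  proof (cases "Im z = 0")
    case True
    then obtain t where t: "z = of_real t" by (metis complex_is_Real_iff Reals_cases)
    have "complex_of_real (poly q t) = 0"
      using z unfolding t poly_map_poly_of_real .
    hence "poly q t = 0" by simp
    thus ?thesis using real_roots t by blast
  next
    case False
    have nz: "z \<noteq> 0" "z \<notin># image_mset complex_of_real R" using False by auto
    have "poly pc z \<noteq> 0" using nz unfolding pc_def poly_linear_factors_eq_0_iff by blast
    with z have "1 - of_real c * (of_real \<gamma> / z + (\<Sum>y\<in>#R. 1 / (z - of_real y))) = 0"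
      unfolding qc pc_def poly_laguerre_step[OF nz]
      using nz by (simp add: multiset.map_comp comp_def)
    hence "Im (1 - of_real c * (of_real \<gamma> / z + (\<Sum>y\<in>#R. 1 / (z - of_real y)))) = 0" by simp
    hence "c * Im (of_real \<gamma> / z + (\<Sum>y\<in>#R. 1 / (z - of_real y))) = 0"
      by (simp only: minus_complex.sel one_complex.sel Im_complex_of_real times_complex.sel
            Re_complex_of_real)
    thus ?thesis using Im_potential_sign[OF \<open>\<gamma> > 0\<close> False, of R] assms by simp
  qed
  obtain R' where R': "q = (\<Prod>y\<in>#R'. [:- y, 1:])" "set_mset R' \<subseteq> {0..<x}"
    using real_factorization_of_complex_roots[OF assms(3) roots] by blast

  \<comment> \<open>The bound on the logarithmic derivative at the shifted point; \<psi> is minus the derivative of \<phi>.\<close>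
  define X where "X = x + 1 / \<theta>"
  have X: "X > 0" "x < X" using assms by (auto simp: X_def add_pos_pos)
  have XR: "X \<notin># R" "X \<notin># R'" using X R R'(2) by fastforce+
  define \<sigma> \<rho> where "\<sigma> = (\<Sum>y\<in>#R. 1 / (X - y))" and "\<rho> = (\<Sum>y\<in>#R. 1 / (X - y)\<^sup>2)"
  define \<psi> where "\<psi> = \<gamma> / X\<^sup>2 + \<rho>"
  have p1: "poly (pderiv p) X = poly p X * \<sigma>"
    and p2: "poly (pderiv (pderiv p)) X = poly p X * (\<sigma>\<^sup>2 - \<rho>)"
    unfolding p_def \<sigma>_def \<rho>_def using XR
    by (auto intro!: poly_pderiv_linear_factors poly_pderiv2_linear_factors)
  have nz: "1 - c * \<phi> X > 0" using half[of X] X by simp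
  have \<phi>X: "\<phi> X = \<gamma> / X + \<sigma>" by (simp add: \<phi>_def \<sigma>_def)
  have "poly (pderiv q) X = poly p X + X * (poly p X * \<sigma>) -
          c * (\<gamma> * (poly p X * \<sigma>) + poly p X * \<sigma> + X * (poly p X * (\<sigma>\<^sup>2 - \<rho>)))"
    by (simp add: q_def pderiv_diff pderiv_smult pderiv_add pderiv_pCons p1 p2)
  also have "\<dots> = poly p X * ((1 + X * \<sigma>) * (1 - c * \<phi> X) + X * c * \<psi>)"
    using X unfolding \<phi>X \<psi>_def by (simp add: field_simps power2_eq_square)
  also have "\<dots> = poly q X * (1 / X + \<sigma> + c * \<psi> / (1 - c * \<phi> X))"
  proof -
    have "P * ((1 + X * \<sigma>) * k + X * c * \<psi>) = (X * P * k) * (1 / X + \<sigma> + c * \<psi> / k)"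
      if "k > 0" for P k
      using X that by (simp add: field_simps)
    from this[OF nz] show ?thesis using q_factor[of X] X XR by simp
  qed
  finally have "poly q X * (\<Sum>y\<in>#R'. 1 / (X - y)) =
      poly q X * (1 / X + \<sigma> + c * \<psi> / (1 - c * \<phi> X))"
    using poly_pderiv_linear_factors[OF XR(2)] R'(1) by simp
  moreover have "poly q X \<noteq> 0" unfolding R'(1) poly_linear_factors_eq_0_iff using XR by simp
  ultimately have "(\<gamma> - 1) / X + (\<Sum>y\<in>#R'. 1 / (X - y)) = \<phi> X + c * \<psi> / (1 - c * \<phi> X)"
    by (simp add: \<phi>X diff_divide_distrib)
  also have "\<dots> \<le> \<phi> X + (1 / \<theta>) * \<psi>"
  proof -
    have "\<rho> \<ge> 0" unfolding \<rho>_def by (induction R) auto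
    hence "\<psi> \<ge> 0" using assms X by (simp add: \<psi>_def)
    have "c * \<theta> \<le> 1 - c * \<phi> X"
    proof -
      have "c * \<phi> X \<le> c * \<theta>" using \<phi>_mono[of X] X assms by simp
      thus ?thesis using assms(8) by (simp add: mult_ac)
    qed
    hence "c / (1 - c * \<phi> X) \<le> 1 / \<theta>" using nz assms by (simp add: field_simps)
    from mult_right_mono[OF this \<open>\<psi> \<ge> 0\<close>] show ?thesis by simp
  qed
  also have "\<dots> = (\<gamma> / X + (1 / \<theta>) * (\<gamma> / X\<^sup>2)) + (\<Sum>y\<in>#R. 1 / (X - y) + (1 / \<theta>) / (X - y)\<^sup>2)"
  proof -
    have "(1 / \<theta>) * \<rho> = (\<Sum>y\<in>#R. (1 / \<theta>) / (X - y)\<^sup>2)"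
      unfolding \<rho>_def sum_mset_distrib_left by (rule arg_cong[of _ _ sum_mset]) (auto intro!: image_mset_cong)
    thus ?thesis unfolding \<phi>X \<psi>_def \<sigma>_def by (simp add: sum_mset.distrib distrib_left)
  qed
  also have "\<dots> \<le> \<gamma> / x + (\<Sum>y\<in>#R. 1 / (x - y))"
  proof (rule add_mono)
    have "\<gamma> * (1 / (x + 1 / \<theta>) + (1 / \<theta>) / (x + 1 / \<theta>)\<^sup>2) \<le> \<gamma> * (1 / x)"
      using assms by (intro mult_left_mono inverse_convex_bound) auto
    thus "\<gamma> / X + (1 / \<theta>) * (\<gamma> / X\<^sup>2) \<le> \<gamma> / x" by (simp add: X_def field_simps)
    show "(\<Sum>y\<in>#R. 1 / (X - y) + (1 / \<theta>) / (X - y)\<^sup>2) \<le> (\<Sum>y\<in>#R. 1 / (x - y))"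
    proof (rule sum_mset_mono)
      fix y assume "y \<in># R"
      hence "1 / (x - y + 1 / \<theta>) + (1 / \<theta>) / (x - y + 1 / \<theta>)\<^sup>2 \<le> 1 / (x - y)"
        using R assms by (intro inverse_convex_bound) auto
      thus "1 / (X - y) + (1 / \<theta>) / (X - y)\<^sup>2 \<le> 1 / (x - y)"
        by (simp add: X_def algebra_simps)
    qed
  qed
  also note barrier
  finally show ?thesis using R' by (fastforce simp: X_def)
qed

lemma linear_factors_monic:
  "degree (\<Prod>y\<in>#R. [:- y, 1:] :: 'a :: idom poly) = size R \<and>
   lead_coeff (\<Prod>y\<in>#R. [:- y, 1:] :: 'a poly) = 1"
proof (induction R)
  case (add y R)
  hence "(\<Prod>y\<in>#R. [:- y, 1:]) \<noteq> (0 :: 'a poly)" by auto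
  hence "degree ([:- y, 1:] * (\<Prod>y\<in>#R. [:- y, 1:])) = Suc (size R)"
    using add by (subst degree_mult_eq) auto
  moreover have "lead_coeff ([:- y, 1:] * (\<Prod>y\<in>#R. [:- y, 1:])) = 1"
    using add unfolding lead_coeff_mult by auto
  ultimately show ?case by simp
qed simp

text \<open>
  Start from x^s, whose logarithmic derivative equals \<theta> at s / \<theta>, and take one step per element
  of C, each moving the barrier by 1 / \<theta>.  The exponent s - size C of x stays positive before every
  step, which is what the step needs.
\<close>

theorem laguerre_transform_roots:
  fixes C :: "real multiset" and s \<theta> :: real
  assumes "\<theta> > 0" "s > 0" "real (size C) \<le> s"
    and "\<And>c. c \<in># C \<Longrightarrow> 0 < c \<and> 2 * \<theta> * c \<le> 1"
  defines "x \<equiv> (s + real (size C)) / \<theta>"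
  shows "\<exists>R. laguerre_transform s (\<Prod>c\<in>#C. [:- c, 1:]) = (\<Prod>y\<in>#R. [:- y, 1:]) \<and>
           (\<forall>y\<in>#R. 0 \<le> y \<and> y < x) \<and>
           (s - real (size C)) / x + (\<Sum>y\<in>#R. 1 / (x - y)) \<le> \<theta>"
  using assms(3,4) unfolding x_def
proof (induction C)
  case empty
  have "laguerre_transform s 1 = 1" by (simp add: laguerre_transform_def)
  thus ?case using assms(1,2) by (intro exI[of _ "{#}"]) auto
next
  case (add c C)
  define x where "x = (s + real (size C)) / \<theta>"
  define \<gamma> where "\<gamma> = s - real (size C)"
  let ?A = "\<Prod>c\<in>#C. [:- c, 1:]"
  from add.prems have prems: "real (size C) \<le> s" "\<gamma> > 0" "0 < c" "2 * \<theta> * c \<le> 1"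
    "\<And>c. c \<in># C \<Longrightarrow> 0 < c \<and> 2 * \<theta> * c \<le> 1"
    by (auto simp: \<gamma>_def)
  obtain R where R: "laguerre_transform s ?A = (\<Prod>y\<in>#R. [:- y, 1:])"
    "\<forall>y\<in>#R. 0 \<le> y \<and> y < x" "\<gamma> / x + (\<Sum>y\<in>#R. 1 / (x - y)) \<le> \<theta>"
    using add.IH[OF prems(1,5)] unfolding x_def \<gamma>_def by blast
  let ?p = "\<Prod>y\<in>#R. [:- y, 1:]"
  have nz: "?A \<noteq> 0" using linear_factors_monic[of C] by auto
  have q: "laguerre_transform s (\<Prod>c\<in>#add_mset c C. [:- c, 1:]) =
             pCons 0 ?p - smult c (smult \<gamma> ?p + pCons 0 (pderiv ?p))"
    using laguerre_transform_linear_factor[OF nz, of s c] linear_factors_monic[of C]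
    by (simp add: R(1) \<gamma>_def del: mult_pCons_left)
  have "x > 0" using assms by (simp add: x_def add_pos_nonneg)
  have lc: "lead_coeff (pCons 0 ?p - smult c (smult \<gamma> ?p + pCons 0 (pderiv ?p))) = 1"
    unfolding q[symmetric] lead_coeff_laguerre_transform using linear_factors_monic by blast
  have x': "x + 1 / \<theta> = (s + real (size (add_mset c C))) / \<theta>"
    "\<gamma> - 1 = s - real (size (add_mset c C))"
    by (simp_all add: x_def \<gamma>_def add_divide_distrib)
  have "x < x + 1 / \<theta>" using assms(1) by simp
  with laguerre_step_roots[OF lc assms(1) prems(2) \<open>x > 0\<close> prems(3,4) _ R(3)] R(2)
  show ?case unfolding q x' by (meson order.strict_trans)
qed


section \<open>Reversed polynomials as formal power series\<close>

text \<open>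
  The Laguerre transform in the variable t = 1 / x, where the degree no longer enters.  Its
  commutation rules come from splitting the first or the last factor off a falling factorial.
\<close>

definition falling_fps :: "real \<Rightarrow> real fps \<Rightarrow> real fps" where
  "falling_fps s F = Abs_fps (\<lambda>k. falling s k * F $ k)"

lemma falling_fps_nth [simp]: "falling_fps s F $ k = falling s k * F $ k"
  by (simp add: falling_fps_def)

lemma falling_fps_diff: "falling_fps s (F - G) = falling_fps s F - falling_fps s G"
  by (rule fps_ext) (simp add: right_diff_distrib)

lemma falling_fps_const_mult: "falling_fps s (fps_const c * F) = fps_const c * falling_fps s F"
  by (rule fps_ext) simp

lemma falling_fps_sum: "falling_fps s (\<Sum>i\<in>I. F i) = (\<Sum>i\<in>I. falling_fps s (F i))"
  by (rule fps_ext) (simp add: fps_sum_nth sum_distrib_left)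

lemma falling_fps_uminus: "falling_fps s (- F) = - falling_fps s F"
  by (rule fps_ext) simp

lemma fps_deriv_falling_fps:
  "fps_deriv (falling_fps s F) = fps_const s * falling_fps (s - 1) (fps_deriv F)"
  by (rule fps_ext) (simp add: falling_Suc_shift mult_ac)

lemma falling_fps_X_mult:
  "falling_fps s (fps_X * F) = fps_const s * fps_X * falling_fps (s - 1) F"
proof (rule fps_ext)
  fix k
  show "falling_fps s (fps_X * F) $ k = (fps_const s * fps_X * falling_fps (s - 1) F) $ k"
    by (cases k) (simp_all add: falling_Suc_shift mult.assoc)
qed

lemma fps_X_mult_deriv_nth: "(fps_X * fps_deriv F) $ k = of_nat k * (F $ k :: real)"
  by (cases k) simp_all

lemma falling_fps_lower:
  "fps_const s * falling_fps s F - fps_X * fps_deriv (falling_fps s F) =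
     fps_const s * falling_fps (s - 1) F"
proof (rule fps_ext)
  fix k
  have "(s - real k) * falling s k = s * falling (s - 1) k"
    using falling_Suc[of s k] falling_Suc_shift[of s k] by (simp add: mult_ac)
  thus "(fps_const s * falling_fps s F - fps_X * fps_deriv (falling_fps s F)) $ k =
          (fps_const s * falling_fps (s - 1) F) $ k"
    by (simp add: fps_X_mult_deriv_nth left_diff_distrib)
       (metis (no_types, opaque_lifting) left_diff_distrib mult.assoc)
qed

lemma fps_reflect_laguerre_transform:
  "fps_of_poly (reflect_poly (laguerre_transform s A)) =
     falling_fps s (fps_of_poly (reflect_poly A))"
  by (rule fps_ext) (auto simp: coeff_reflect_poly coeff_laguerre_transform)

lemma fps_reflect_linear_factor:
  "fps_of_poly (reflect_poly [:- y, 1:]) = (1 - fps_const y * fps_X :: real fps)"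
proof -
  have "reflect_poly [:- y, 1:] = [:1, - y:]"
    by (simp add: reflect_poly_pCons' monom_Suc monom_0)
  thus ?thesis by (simp add: fps_of_poly_linear' flip: fps_const_neg)
qed

lemma fps_reflect_linear_factors:
  "fps_of_poly (reflect_poly (\<Prod>y\<in>#R. [:- y, 1:])) = (\<Prod>y\<in>#R. 1 - fps_const y * fps_X :: real fps)"
proof (induction R)
  case (add y R)
  thus ?case
    by (simp add: reflect_poly_mult fps_of_poly_mult fps_reflect_linear_factor del: mult_pCons_left)
qed simp

definition power_sum_fps :: "real multiset \<Rightarrow> real fps" where
  "power_sum_fps R = Abs_fps (\<lambda>k. if k = 0 then 0 else \<Sum>y\<in>#R. y ^ k)"

lemma geometric_fps: "(1 - fps_const u * fps_X) * Abs_fps (\<lambda>k. if k = 0 then 0 else u ^ k) = fps_const (u :: real) * fps_X"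
proof (rule fps_ext)
  fix k show "((1 - fps_const u * fps_X) * Abs_fps (\<lambda>k. if k = 0 then 0 else u ^ k)) $ k =
    (fps_const u * fps_X) $ k"
    by (cases k) (auto simp: left_diff_distrib mult.assoc)
qed

text \<open>
  Newton's identities between power sums and elementary symmetric polynomials: -t times the
  logarithmic derivative of the product of the 1 - y t.
\<close>

lemma newton_identity:
  "- fps_X * fps_deriv (\<Prod>y\<in>#R. 1 - fps_const y * fps_X) =
     (\<Prod>y\<in>#R. 1 - fps_const y * fps_X) * power_sum_fps R"
proof (induction R)
  case empty
  show ?case by (simp add: power_sum_fps_def fps_eq_iff)
next
  case (add y R)
  let ?P = "\<Prod>y\<in>#R. 1 - fps_const y * fps_X" and ?g = "Abs_fps (\<lambda>k. if k = 0 then 0 else y ^ k)"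
  have "power_sum_fps (add_mset y R) = ?g + power_sum_fps R"
    by (rule fps_ext) (simp add: power_sum_fps_def)
  hence "(\<Prod>y\<in>#add_mset y R. 1 - fps_const y * fps_X) * power_sum_fps (add_mset y R) =
           ((1 - fps_const y * fps_X) * ?g) * ?P + (1 - fps_const y * fps_X) * (?P * power_sum_fps R)"
    by (simp add: algebra_simps)
  also have "\<dots> = fps_const y * fps_X * ?P + (1 - fps_const y * fps_X) * (- fps_X * fps_deriv ?P)"
    unfolding geometric_fps add.IH ..
  also have "\<dots> = - fps_X * fps_deriv (\<Prod>y\<in>#add_mset y R. 1 - fps_const y * fps_X)"
    by (simp add: algebra_simps)
  finally show ?case ..
qed

lemma fps_deriv_prod:
  fixes f :: "'i \<Rightarrow> 'a :: comm_ring_1 fps"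
  assumes "finite I"
  shows "fps_deriv (\<Prod>i\<in>I. f i) = (\<Sum>i\<in>I. fps_deriv (f i) * (\<Prod>j\<in>I - {i}. f j))"
  using assms
proof (induction I rule: finite_induct)
  case (insert a I)
  have "(\<Sum>i\<in>I. fps_deriv (f i) * (\<Prod>j\<in>insert a I - {i}. f j)) =
          (\<Sum>i\<in>I. f a * (fps_deriv (f i) * (\<Prod>j\<in>I - {i}. f j)))"
  proof (rule sum.cong)
    fix i assume "i \<in> I"
    hence "insert a I - {i} = insert a (I - {i})" using insert.hyps by auto
    thus "fps_deriv (f i) * (\<Prod>j\<in>insert a I - {i}. f j) =
            f a * (fps_deriv (f i) * (\<Prod>j\<in>I - {i}. f j))"
      using insert.hyps by (simp add: mult_ac)
  qed simp
  moreover have "insert a I - {a} = I" using insert.hyps by auto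
  ultimately show ?case using insert by (simp add: sum_distrib_left algebra_simps)
qed simp

text \<open>
  The reversed form of the product of the (x - c_i)^(n_i).  Keeping the multiplicities as a
  function makes "remove one factor of index i" a function update.
\<close>

definition linear_power_fps :: "'i set \<Rightarrow> ('i \<Rightarrow> real) \<Rightarrow> ('i \<Rightarrow> nat) \<Rightarrow> real fps" where
  "linear_power_fps I c n = (\<Prod>i\<in>I. (1 - fps_const (c i) * fps_X) ^ n i)"

lemma linear_power_fps_upd:
  assumes "finite I" "i \<in> I"
  shows "linear_power_fps I c (n(i := k)) =
           (1 - fps_const (c i) * fps_X) ^ k * (\<Prod>j\<in>I - {i}. (1 - fps_const (c j) * fps_X) ^ n j)"
  unfolding linear_power_fps_def using assms by (subst prod.remove[of _ i]) auto

lemma linear_power_fps_split: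
  assumes "finite I" "i \<in> I" "n i > 0"
  shows "linear_power_fps I c n = (1 - fps_const (c i) * fps_X) * linear_power_fps I c (n(i := n i - 1))"
proof -
  have "linear_power_fps I c n = linear_power_fps I c (n(i := Suc (n i - 1)))"
    using assms by simp
  thus ?thesis unfolding linear_power_fps_upd[OF assms(1,2)] by (simp add: mult.assoc)
qed

lemma fps_deriv_linear_power_fps:
  assumes "finite I"
  shows "fps_deriv (linear_power_fps I c n) =
           - (\<Sum>i\<in>I. fps_const (real (n i) * c i) * linear_power_fps I c (n(i := n i - 1)))"
  unfolding linear_power_fps_def[of I c n] fps_deriv_prod[OF assms] sum_negf[symmetric]
proof (rule sum.cong)
  fix i assume "i \<in> I"
  have "fps_deriv ((1 - fps_const (c i) * fps_X) ^ n i) =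
          - (fps_const (real (n i) * c i) * (1 - fps_const (c i) * fps_X) ^ (n i - 1))"
    by (subst fps_deriv_power) (simp add: fps_of_nat mult_ac flip: fps_const_mult fps_const_neg)
  thus "fps_deriv ((1 - fps_const (c i) * fps_X) ^ n i) *
          (\<Prod>j\<in>I - {i}. (1 - fps_const (c j) * fps_X) ^ n j) =
        - (fps_const (real (n i) * c i) * linear_power_fps I c (n(i := n i - 1)))"
    unfolding linear_power_fps_upd[OF assms \<open>i \<in> I\<close>] by (simp add: mult_ac)
qed simp


section \<open>Convergence of the moments\<close>

text \<open>
  Let P_i be the series for multiplicities n_i lowered by one and s lowered by one, and
  Q_i = P_i / P.  The first equation is the derivative rule for P, where differentiating the product
  of linear factors produces one summand per index.  For the second, s P - t P' can be computed in two
  ways: it is N P (\<lambda> + M) by the definition of M, and it is s times the transform with s - 1 of the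
  full product, from which a factor of index i is split off.  The derivative of Q_i appears because the
  logarithmic derivatives of P_i and P differ by that of Q_i.
\<close>

lemma laguerre_moment_system:
  fixes u :: "'i \<Rightarrow> real" and lam :: real and n :: "'i \<Rightarrow> nat" and N :: nat
  assumes "finite I" "N > 0" "\<And>i. i \<in> I \<Longrightarrow> n i > 0"
  defines "P \<equiv> falling_fps (real N * lam) (linear_power_fps I (\<lambda>i. u i / real N) n)"
  assumes M: "- fps_X * fps_deriv P = P * (fps_const (real N) * M)"
  obtains Q where
    "M = fps_const lam * fps_X * (\<Sum>i\<in>I. fps_const (real (n i) / real N * u i) * Q i)"
    "\<And>i. i \<in> I \<Longrightarrow> fps_const lam + M =
       fps_const lam * (Q i - fps_const (u i) * fps_X *
         ((fps_const (lam - 1 / real N) + M) * Q i - fps_const (1 / real N) * (fps_X * fps_deriv (Q i))))"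
proof -
  define s where "s = real N * lam"
  define c where "c = (\<lambda>i. u i / real N)"
  define B where "B = linear_power_fps I c"
  define B' where "B' = (\<lambda>i. B (n(i := n i - 1)))"
  define P' where "P' = (\<lambda>i. falling_fps (s - 1) (B' i))"
  define Q where "Q = (\<lambda>i. P' i * inverse P)"
  have N: "real N \<noteq> 0" and N': "fps_const (real N) \<noteq> 0" using assms by simp_all
  have P_def': "P = falling_fps s (B n)" by (simp add: P_def s_def B_def c_def)
  have "linear_power_fps I c n $ 0 = 1"
    unfolding linear_power_fps_def using assms(1)
    by (induction I rule: finite_induct) (simp_all add: fps_nth_power_0)
  hence "P $ 0 = 1" by (simp add: P_def' B_def)
  hence P0: "P \<noteq> 0" and PQ: "P' i = P * Q i" for i
    by (auto simp: Q_def mult.left_commute[of P] inverse_mult_eq_1')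
  have "P * (fps_const (real N) * M) = - fps_X * fps_deriv P" using M by simp
  also have "fps_deriv P = - (fps_const s * (\<Sum>i\<in>I. fps_const (real (n i) * c i) * P' i))"
    unfolding P_def' fps_deriv_falling_fps B_def fps_deriv_linear_power_fps[OF assms(1)]
      falling_fps_uminus falling_fps_sum falling_fps_const_mult
    by (simp add: P'_def B'_def B_def)
  also have "- fps_X * - (fps_const s * (\<Sum>i\<in>I. fps_const (real (n i) * c i) * P' i)) =
     P * (fps_const (real N) * (fps_const lam * fps_X *
          (\<Sum>i\<in>I. fps_const (real (n i) / real N * u i) * Q i)))"
  proof -
    have "(\<Sum>i\<in>I. fps_const (real (n i) * c i) * P' i) =
            P * (\<Sum>i\<in>I. fps_const (real (n i) / real N * u i) * Q i)"
      unfolding sum_distrib_left PQ c_def by (intro sum.cong) (simp_all add: mult_ac)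
    moreover have "fps_const s = fps_const (real N) * fps_const lam" by (simp add: s_def)
    ultimately show ?thesis by (simp only: minus_mult_minus mult_ac)
  qed
  finally have "fps_const (real N) * M = fps_const (real N) * (fps_const lam * fps_X *
          (\<Sum>i\<in>I. fps_const (real (n i) / real N * u i) * Q i))"
    by (rule iffD1[OF mult_left_cancel[OF P0]])
  hence eq1: "M = fps_const lam * fps_X * (\<Sum>i\<in>I. fps_const (real (n i) / real N * u i) * Q i)"
    by (rule iffD1[OF mult_left_cancel[OF N']])

  have eq2: "fps_const lam + M =
       fps_const lam * (Q i - fps_const (u i) * fps_X *
         ((fps_const (lam - 1 / real N) + M) * Q i - fps_const (1 / real N) * (fps_X * fps_deriv (Q i))))"
    if i: "i \<in> I" for i
  proof -
    have "P * (fps_const s + fps_const (real N) * M) = fps_const s * P + - fps_X * fps_deriv P"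
      unfolding M by (simp only: distrib_left mult.commute[of P "fps_const s"])
    also have "\<dots> = fps_const s * P - fps_X * fps_deriv P" by simp
    also have "fps_const s * P - fps_X * fps_deriv P = fps_const s * falling_fps (s - 1) (B n)"
      unfolding P_def' by (rule falling_fps_lower)
    also have "B n = B' i - fps_const (c i) * (fps_X * B' i)"
      unfolding B_def B'_def using linear_power_fps_split[OF assms(1) i, of n c] assms(3)[OF i]
      by (simp add: algebra_simps)
    also have "falling_fps (s - 1) \<dots> = P' i - fps_const (c i) *
        (fps_X * (fps_const (s - 1) * P' i - fps_X * fps_deriv (P' i)))"
      unfolding falling_fps_diff falling_fps_const_mult falling_fps_X_mult P'_def falling_fps_lower
      by (simp add: mult_ac)
    also have "fps_const (s - 1) * P' i - fps_X * fps_deriv (P' i) =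
        P * ((fps_const (s - 1) + fps_const (real N) * M) * Q i - fps_X * fps_deriv (Q i))"
    proof -
      have "fps_X * fps_deriv (P' i) = P * (fps_X * fps_deriv (Q i)) - Q i * (- fps_X * fps_deriv P)"
        by (simp add: PQ algebra_simps)
      also have "\<dots> = P * (fps_X * fps_deriv (Q i)) - Q i * (P * (fps_const (real N) * M))"
        unfolding M ..
      finally show ?thesis by (simp add: PQ algebra_simps)
    qed
    also have "(fps_const (s - 1) + fps_const (real N) * M) * Q i - fps_X * fps_deriv (Q i) =
       fps_const (real N) * ((fps_const (lam - 1 / real N) + M) * Q i -
          fps_const (1 / real N) * (fps_X * fps_deriv (Q i)))"
    proof -
      have "fps_const (s - 1) = fps_const (real N) * fps_const (lam - 1 / real N)"
        "fps_const (real N) * fps_const (1 / real N) = 1"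
        using N by (simp_all add: s_def field_simps)
      thus ?thesis by (simp add: algebra_simps)
    qed
    finally have "P * (fps_const s + fps_const (real N) * M) = P * (fps_const s *
        (Q i - fps_const (c i) * (fps_X * (fps_const (real N) *
         ((fps_const (lam - 1 / real N) + M) * Q i - fps_const (1 / real N) * (fps_X * fps_deriv (Q i)))))))"
      by (simp only: PQ ring_distribs mult_ac)
    hence "fps_const s + fps_const (real N) * M = fps_const s *
        (Q i - fps_const (c i) * (fps_X * (fps_const (real N) *
         ((fps_const (lam - 1 / real N) + M) * Q i - fps_const (1 / real N) * (fps_X * fps_deriv (Q i))))))"
      by (rule iffD1[OF mult_left_cancel[OF P0]])
    moreover have "fps_const s = fps_const (real N) * fps_const lam"
      and "fps_const (u i) = fps_const (c i) * fps_const (real N)"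
      using N by (simp_all add: s_def c_def)
    ultimately have "fps_const (real N) * (fps_const lam + M) = fps_const (real N) *
       (fps_const lam * (Q i - fps_const (u i) * fps_X *
         ((fps_const (lam - 1 / real N) + M) * Q i - fps_const (1 / real N) * (fps_X * fps_deriv (Q i)))))"
      by (simp only: distrib_left mult.assoc mult.left_commute)
    thus ?thesis by (rule iffD1[OF mult_left_cancel[OF N']])
  qed
  show ?thesis using that[of Q] eq1 eq2 by blast
qed

text \<open>
  Convergence of every coefficient in the usual topology of the reals; the metric that the type of
  formal power series carries is the t-adic one, for which the coefficients would have to be eventually
  constant.
\<close>

definition coeffwise_tendsto :: "(nat \<Rightarrow> real fps) \<Rightarrow> real fps \<Rightarrow> bool" where
  "coeffwise_tendsto F L \<longleftrightarrow> (\<forall>k. (\<lambda>N. F N $ k) \<longlonglongrightarrow> L $ k)"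

lemma coeffwise_tendsto_add:
  "coeffwise_tendsto F K \<Longrightarrow> coeffwise_tendsto G L \<Longrightarrow> coeffwise_tendsto (\<lambda>N. F N + G N) (K + L)"
  unfolding coeffwise_tendsto_def by (auto intro!: tendsto_intros)

lemma coeffwise_tendsto_diff:
  "coeffwise_tendsto F K \<Longrightarrow> coeffwise_tendsto G L \<Longrightarrow> coeffwise_tendsto (\<lambda>N. F N - G N) (K - L)"
  unfolding coeffwise_tendsto_def by (auto intro!: tendsto_intros)

lemma coeffwise_tendsto_mult:
  "coeffwise_tendsto F K \<Longrightarrow> coeffwise_tendsto G L \<Longrightarrow> coeffwise_tendsto (\<lambda>N. F N * G N) (K * L)"
  unfolding coeffwise_tendsto_def fps_mult_nth by (auto intro!: tendsto_intros)

lemma coeffwise_tendsto_sum: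
  "(\<And>i. i \<in> I \<Longrightarrow> coeffwise_tendsto (F i) (L i)) \<Longrightarrow>
     coeffwise_tendsto (\<lambda>N. \<Sum>i\<in>I. F i N) (\<Sum>i\<in>I. L i)"
  unfolding coeffwise_tendsto_def fps_sum_nth by (auto intro!: tendsto_intros)

lemma coeffwise_tendsto_const: "c \<longlonglongrightarrow> l \<Longrightarrow> coeffwise_tendsto (\<lambda>N. fps_const (c N)) (fps_const l)"
  unfolding coeffwise_tendsto_def by auto

lemma coeffwise_tendsto_self: "coeffwise_tendsto (\<lambda>N. F) F"
  unfolding coeffwise_tendsto_def by auto

lemma coeffwise_tendsto_deriv:
  "coeffwise_tendsto F L \<Longrightarrow> coeffwise_tendsto (\<lambda>N. fps_deriv (F N)) (fps_deriv L)"
  unfolding coeffwise_tendsto_def by (auto intro!: tendsto_intros)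

lemma coeffwise_tendsto_unique:
  "coeffwise_tendsto F K \<Longrightarrow> coeffwise_tendsto F L \<Longrightarrow> K = L"
  unfolding coeffwise_tendsto_def fps_eq_iff using LIMSEQ_unique by blast

lemmas coeffwise_tendsto_intros =
  coeffwise_tendsto_add coeffwise_tendsto_diff coeffwise_tendsto_mult coeffwise_tendsto_sum
  coeffwise_tendsto_const coeffwise_tendsto_self coeffwise_tendsto_deriv

text \<open>
  The factors t make the system triangular: the coefficient of index k + 1 of M is a polynomial in the
  coefficients of the Q_i of index at most k, and that of Q_i involves in addition the coefficient of
  index k + 1 of M.  So all coefficients converge by induction, and the limits solve the system with
  d = 0.  There Q_i can be eliminated.
\<close>

lemma laguerre_system_converges:
  fixes M :: "nat \<Rightarrow> real fps" and Q :: "'i \<Rightarrow> nat \<Rightarrow> real fps" and p :: "'i \<Rightarrow> nat \<Rightarrow> real"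
    and d :: "nat \<Rightarrow> real"
  assumes "lam > 0" and p: "\<And>i. i \<in> I \<Longrightarrow> p i \<longlonglongrightarrow> q i" and d: "d \<longlonglongrightarrow> 0"
    and M: "\<And>N. M N = fps_const lam * fps_X * (\<Sum>i\<in>I. fps_const (p i N * u i) * Q i N)"
    and Q: "\<And>N i. i \<in> I \<Longrightarrow> fps_const lam + M N =
       fps_const lam * (Q i N - fps_const (u i) * fps_X *
         ((fps_const (lam - d N) + M N) * Q i N - fps_const (d N) * (fps_X * fps_deriv (Q i N))))"
  shows "\<exists>L. coeffwise_tendsto M L \<and> L = (\<Sum>i\<in>I. fps_const (q i) *
           (fps_const (u i) * fps_X * (fps_const lam + L) *
              inverse (1 - fps_const (u i) * fps_X * (fps_const lam + L))))"
proof -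
  have M0: "M N $ 0 = 0" for N by (subst M) simp
  have M_Suc: "M N $ Suc k = lam * (\<Sum>i\<in>I. p i N * u i * Q i N $ k)" for N k
    by (subst M) (simp add: fps_sum_nth mult.assoc)
  have Q_nth: "Q i N $ k = (fps_const lam + M N) $ k / lam + (fps_const (u i) * (fps_X *
         ((fps_const (lam - d N) + M N) * Q i N - fps_const (d N) * (fps_X * fps_deriv (Q i N))))) $ k"
    if "i \<in> I" for i N k
  proof -
    have "(fps_const lam + M N) $ k = lam * (Q i N $ k - (fps_const (u i) * (fps_X *
         ((fps_const (lam - d N) + M N) * Q i N - fps_const (d N) * (fps_X * fps_deriv (Q i N))))) $ k)"
      by (subst Q[OF that]) (simp add: mult.assoc)
    thus ?thesis using assms(1) by (simp add: field_simps)
  qed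
  have Q_0: "Q i N $ 0 = 1" if "i \<in> I" for i N
    using Q_nth[OF that, of N 0] M0 assms(1) by simp
  have Q_Suc: "Q i N $ Suc k = M N $ Suc k / lam + u i *
         ((lam - d N) * Q i N $ k + (\<Sum>j=0..k. M N $ j * Q i N $ (k - j)) - d N * (real k * Q i N $ k))"
    if "i \<in> I" for i N k
    using Q_nth[OF that, of N "Suc k"]
    by (cases k) (simp_all add: distrib_right fps_mult_nth[of "M N" "Q i N"])
  have conv: "convergent (\<lambda>N. M N $ k) \<and> (\<forall>i\<in>I. convergent (\<lambda>N. Q i N $ k))" for k
  proof (induction k rule: less_induct)
    case (less k)
    show ?case
    proof (cases k)
      case 0
      thus ?thesis by (simp add: M0 Q_0 convergent_const)
    next
      case (Suc j)
      have IH: "convergent (\<lambda>N. M N $ l)" "i \<in> I \<Longrightarrow> convergent (\<lambda>N. Q i N $ l)" if "l \<le> j" for l i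
        using less.IH[of l] that Suc by auto
      have pd: "i \<in> I \<Longrightarrow> convergent (p i)" "convergent d" for i
        using p d by (auto intro: convergentI)
      have MS: "convergent (\<lambda>N. M N $ Suc j)"
        unfolding M_Suc using IH pd
        by (auto intro!: convergent_mult convergent_sum convergent_const)
      have "convergent (\<lambda>N. Q i N $ Suc j)" if "i \<in> I" for i
        unfolding Q_Suc[OF that] divide_inverse using IH pd that MS
        by (auto intro!: convergent_mult convergent_sum convergent_const convergent_add convergent_diff)
      thus ?thesis using MS Suc by blast
    qed
  qed
  define L where "L = Abs_fps (\<lambda>k. lim (\<lambda>N. M N $ k))"
  define K where "K = (\<lambda>i. Abs_fps (\<lambda>k. lim (\<lambda>N. Q i N $ k)))"
  have limM: "coeffwise_tendsto M L" and limQ: "i \<in> I \<Longrightarrow> coeffwise_tendsto (Q i) (K i)" for i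
    using conv by (auto simp: coeffwise_tendsto_def L_def K_def convergent_LIMSEQ_iff)
  have L_eq: "L = fps_const lam * fps_X * (\<Sum>i\<in>I. fps_const (q i * u i) * K i)"
  proof (rule coeffwise_tendsto_unique[OF limM])
    have "coeffwise_tendsto (\<lambda>N. fps_const lam * fps_X * (\<Sum>i\<in>I. fps_const (p i N * u i) * Q i N))
      (fps_const lam * fps_X * (\<Sum>i\<in>I. fps_const (q i * u i) * K i))"
      using p limQ by (intro coeffwise_tendsto_intros tendsto_intros) auto
    thus "coeffwise_tendsto M (fps_const lam * fps_X * (\<Sum>i\<in>I. fps_const (q i * u i) * K i))"
      by (simp flip: M)
  qed
  have K_eq: "fps_const lam * K i = (fps_const lam + L) *
      inverse (1 - fps_const (u i) * fps_X * (fps_const lam + L))" if i: "i \<in> I" for i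
  proof -
    define Z where "Z = fps_const (u i) * fps_X * (fps_const lam + L)"
    have "coeffwise_tendsto (\<lambda>N. fps_const lam + M N) (fps_const lam * (K i - fps_const (u i) * fps_X *
         ((fps_const (lam - 0) + L) * K i - fps_const 0 * (fps_X * fps_deriv (K i)))))"
      unfolding Q[OF i] using d limQ[OF i] limM
      by (intro coeffwise_tendsto_intros tendsto_intros) auto
    moreover have "coeffwise_tendsto (\<lambda>N. fps_const lam + M N) (fps_const lam + L)"
      using limM by (intro coeffwise_tendsto_intros)
    ultimately have "fps_const lam + L = fps_const lam * (K i - fps_const (u i) * fps_X *
         ((fps_const (lam - 0) + L) * K i - fps_const 0 * (fps_X * fps_deriv (K i))))"
      by (metis coeffwise_tendsto_unique)
    also have "\<dots> = fps_const lam * K i * (1 - Z)"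
      by (simp add: Z_def algebra_simps)
    finally have "fps_const lam + L = fps_const lam * K i * (1 - Z)" .
    moreover have "(1 - Z) * inverse (1 - Z) = 1"
      by (rule inverse_mult_eq_1') (simp add: Z_def)
    ultimately have "(fps_const lam + L) * inverse (1 - Z) = fps_const lam * K i"
      by (simp add: mult.assoc)
    thus ?thesis by (simp add: Z_def)
  qed
  have "L = (\<Sum>i\<in>I. fps_const (q i) * (fps_const (u i) * fps_X * (fps_const lam * K i)))"
    by (subst L_eq) (simp add: sum_distrib_left mult_ac flip: fps_const_mult)
  also have "\<dots> = (\<Sum>i\<in>I. fps_const (q i) *
           (fps_const (u i) * fps_X * (fps_const lam + L) *
              inverse (1 - fps_const (u i) * fps_X * (fps_const lam + L))))"
    by (intro sum.cong refl) (simp only: K_eq mult.assoc)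
  finally show ?thesis using limM by blast
qed


section \<open>The explicit form of the multiple Laguerre polynomials\<close>

lemma has_bochner_integral_Gamma:
  fixes b t :: real
  assumes "b > 0" "t > 0"
  shows "has_bochner_integral lborel (\<lambda>x. indicator {0..} x * (x powr (t - 1) * exp (- (b * x)))) (Gamma t / b powr t)"
proof -
  have "has_bochner_integral lborel (\<lambda>x. indicator {0..} x * x powr (t - 1) / exp x) (Gamma t)"
    using Gamma_conv_nn_integral_real[OF assms(2)] assms(2)
    by (intro has_bochner_integral_nn_integral) (auto simp: Gamma_real_pos intro!: AE_I2 less_imp_le)
  hence "has_bochner_integral lborel
      (\<lambda>x. indicator {0..} (0 + b * x) * (0 + b * x) powr (t - 1) / exp (0 + b * x)) (Gamma t /\<^sub>R \<bar>b\<bar>)"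
    using assms(1) by (subst (asm) lborel_has_bochner_integral_real_affine_iff[of b _ _ 0]) auto
  hence "has_bochner_integral lborel (\<lambda>x. (1 / b powr (t - 1)) *
      (indicator {0..} (0 + b * x) * (0 + b * x) powr (t - 1) / exp (0 + b * x)))
      ((1 / b powr (t - 1)) * (Gamma t /\<^sub>R \<bar>b\<bar>))"
    by (rule has_bochner_integral_mult_right)
  also have "(\<lambda>x. (1 / b powr (t - 1)) *
      (indicator {0..} (0 + b * x) * (0 + b * x) powr (t - 1) / exp (0 + b * x))) =
      (\<lambda>x. indicator {0..} x * (x powr (t - 1) * exp (- (b * x))))"
    using assms(1) by (auto simp: fun_eq_iff indicator_def zero_le_mult_iff powr_mult exp_minus field_simps)
  also have "(1 / b powr (t - 1)) * (Gamma t /\<^sub>R \<bar>b\<bar>) = Gamma t / b powr t"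
    using assms(1) by (simp add: powr_diff divide_simps)
  finally show ?thesis .
qed

text \<open>
  The operator (\<gamma> + \<theta>) (\<gamma> + 1 + \<theta>) ... (\<gamma> + k - 1 + \<theta>) with \<theta> = x d/dx, which multiplies the
  coefficient of index m by a rising factorial.  It appears because a weight x^k shifts the argument
  of a Gamma value by k.
\<close>

definition rising_transform :: "real \<Rightarrow> nat \<Rightarrow> real poly \<Rightarrow> real poly" where
  "rising_transform \<gamma> k A = (\<Sum>m\<le>degree A. monom (pochhammer (\<gamma> + real m) k * coeff A m) m)"

lemma coeff_rising_transform:
  "coeff (rising_transform \<gamma> k A) m = pochhammer (\<gamma> + real m) k * coeff A m"
  unfolding rising_transform_def by (rule coeff_weighted_monoms)

lemma rising_transform_0 [simp]: "rising_transform \<gamma> 0 A = A"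
  by (rule poly_eqI) (simp add: coeff_rising_transform)

lemma rising_transform_Suc:
  "rising_transform \<gamma> (Suc k) A = rising_transform (\<gamma> + 1) k (smult \<gamma> A + pCons 0 (pderiv A))"
proof (rule poly_eqI)
  fix m
  have "coeff (smult \<gamma> A + pCons 0 (pderiv A)) m = (\<gamma> + real m) * coeff A m"
    by (cases m) (simp_all add: coeff_pderiv algebra_simps)
  thus "coeff (rising_transform \<gamma> (Suc k) A) m =
          coeff (rising_transform (\<gamma> + 1) k (smult \<gamma> A + pCons 0 (pderiv A))) m"
    unfolding coeff_rising_transform pochhammer_rec by (simp add: add_ac)
qed

text \<open>
  At a point u \<noteq> 0 the operator \<gamma> + x d/dx lowers the order of a zero by exactly one, since the term
  x A' has strictly smaller order there than A.
\<close>

lemma linear_power_dvd_euler_operator_iff: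
  fixes A :: "real poly"
  assumes "u \<noteq> 0" "poly A u = 0"
  shows "[:- u, 1:] ^ Suc n dvd A \<longleftrightarrow> [:- u, 1:] ^ n dvd smult \<gamma> A + pCons 0 (pderiv A)"
proof (cases "A = 0")
  case False
  define l where "l = [:- u, 1:]"
  have X: "pCons 0 (pderiv A) = [:0, 1:] * pderiv A" by simp
  have ord': "order u A = Suc (order u (pderiv A))"
    by (rule order_pderiv) fact+
  have "pderiv A \<noteq> 0"
  proof
    assume "pderiv A = 0"
    hence "degree A = 0" by (simp add: pderiv_eq_0_iff)
    then obtain c where "A = [:c:]" by (metis degree_eq_zeroE)
    thus False using assms False by simp
  qed
  have "order u ([:0, 1:] * pderiv A) = order u (pderiv A)"
    using \<open>pderiv A \<noteq> 0\<close> assms(1) by (subst order_mult) (auto simp: order_0I)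
  hence dvdX: "l ^ k dvd pCons 0 (pderiv A) \<longleftrightarrow> k < order u A" for k
    unfolding X l_def using \<open>pderiv A \<noteq> 0\<close> ord' by (subst order_divides) auto
  have dvdA: "l ^ k dvd smult \<gamma> A" if "k \<le> order u A" for k
    using that by (intro dvd_smult) (simp add: l_def order_divides del: power_Suc mult_pCons_left)
  show ?thesis unfolding l_def[symmetric]
  proof
    assume "l ^ Suc n dvd A"
    hence "Suc n \<le> order u A" using False by (simp add: l_def order_divides del: power_Suc mult_pCons_left)
    thus "l ^ n dvd smult \<gamma> A + pCons 0 (pderiv A)"
      using dvdX[of n] dvdA[of n] by (auto intro!: dvd_add)
  next
    assume *: "l ^ n dvd smult \<gamma> A + pCons 0 (pderiv A)"
    show "l ^ Suc n dvd A"
    proof (rule ccontr)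
      assume "\<not> l ^ Suc n dvd A"
      hence "order u A \<le> n" using False by (simp add: l_def order_divides del: power_Suc mult_pCons_left)
      hence "l ^ order u A dvd smult \<gamma> A + pCons 0 (pderiv A)"
        using * by (meson le_imp_power_dvd dvd_trans)
      moreover have "l ^ order u A dvd smult \<gamma> A" by (rule dvdA) simp
      ultimately have "l ^ order u A dvd pCons 0 (pderiv A)"
        by (simp add: dvd_add_right_iff)
      thus False using dvdX by simp
    qed
  qed
qed simp

lemma rising_transform_vanishes_iff:
  assumes "u \<noteq> 0"
  shows "(\<forall>k<n. poly (rising_transform \<gamma> k A) u = 0) \<longleftrightarrow> [:- u, 1:] ^ n dvd A"
proof (induction n arbitrary: \<gamma> A)
  case (Suc n)
  have "(\<forall>k<Suc n. poly (rising_transform \<gamma> k A) u = 0) \<longleftrightarrow> poly A u = 0 \<and>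
          (\<forall>k<n. poly (rising_transform (\<gamma> + 1) k (smult \<gamma> A + pCons 0 (pderiv A))) u = 0)"
    unfolding All_less_Suc2 rising_transform_Suc by simp
  also have "\<dots> \<longleftrightarrow> poly A u = 0 \<and> [:- u, 1:] ^ n dvd smult \<gamma> A + pCons 0 (pderiv A)"
    unfolding Suc.IH ..
  also have "\<dots> \<longleftrightarrow> poly A u = 0 \<and> [:- u, 1:] ^ Suc n dvd A"
    using linear_power_dvd_euler_operator_iff[OF assms] by blast
  also have "\<dots> \<longleftrightarrow> [:- u, 1:] ^ Suc n dvd A"
    by (metis dvd_trans dvd_triv_left poly_eq_0_iff_dvd power_Suc)
  finally show ?case .
qed simp

text \<open>
  Up to a power of its argument and the substitution of 1 / b for b, this is the Laplace transform of
  x^\<beta> p(x) at b.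
\<close>

definition gamma_poly :: "real \<Rightarrow> real poly \<Rightarrow> real poly" where
  "gamma_poly \<beta> p = (\<Sum>m\<le>degree p. monom (Gamma (\<beta> + real m + 1) * coeff p m) m)"

lemma coeff_gamma_poly: "coeff (gamma_poly \<beta> p) m = Gamma (\<beta> + real m + 1) * coeff p m"
  unfolding gamma_poly_def by (rule coeff_weighted_monoms)

lemma laguerre_moment_eq:
  assumes "b > 0" "\<beta> \<ge> 0"
  shows "(LINT x:{0..}|lborel. x ^ k * poly p x * exp ((1 - b) * x) * x powr \<beta> * exp (- x)) =
           poly (rising_transform (\<beta> + 1) k (gamma_poly \<beta> p)) (1 / b) / b powr (\<beta> + real k + 1)"
proof -
  have "has_bochner_integral lborel (\<lambda>x. \<Sum>m\<le>degree p. coeff p m *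
      (indicator {0..} x * (x powr (\<beta> + m + k + 1 - 1) * exp (- (b * x)))))
      (\<Sum>m\<le>degree p. coeff p m * (Gamma (\<beta> + m + k + 1) / b powr (\<beta> + m + k + 1)))"
    using assms
    by (intro has_bochner_integral_sum has_bochner_integral_mult_right has_bochner_integral_Gamma) auto
  also have "(\<lambda>x. \<Sum>m\<le>degree p. coeff p m *
      (indicator {0..} x * (x powr (\<beta> + m + k + 1 - 1) * exp (- (b * x))))) =
      (\<lambda>x. indicator {0..} x *\<^sub>R (x ^ k * poly p x * exp ((1 - b) * x) * x powr \<beta> * exp (- x)))"
  proof
    fix x :: real
    show "(\<Sum>m\<le>degree p. coeff p m *
      (indicator {0..} x * (x powr (\<beta> + m + k + 1 - 1) * exp (- (b * x))))) =
      indicator {0..} x *\<^sub>R (x ^ k * poly p x * exp ((1 - b) * x) * x powr \<beta> * exp (- x))"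
    \<comment> \<open>At 0 both sides vanish, because \<open>0 powr \<beta> = 0\<close> for every exponent.\<close>
    proof (cases "x > 0")
      case True
      have "exp (- (b * x)) = exp ((1 - b) * x) * exp (- x)"
        by (simp add: algebra_simps flip: exp_add)
      thus ?thesis using True
        by (simp add: poly_altdef sum_distrib_left sum_distrib_right powr_add powr_realpow mult_ac)
    qed (cases "x = 0"; simp)
  qed
  also have "(\<Sum>m\<le>degree p. coeff p m * (Gamma (\<beta> + m + k + 1) / b powr (\<beta> + m + k + 1))) =
      (\<Sum>m\<le>degree p. (pochhammer (\<beta> + 1 + real m) k * (Gamma (\<beta> + real m + 1) * coeff p m)) * (1 / b) ^ m)
         / b powr (\<beta> + real k + 1)"
    unfolding sum_divide_distrib
  proof (rule sum.cong)
    fix m :: nat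
    have "\<beta> + m + 1 \<notin> \<int>\<^sub>\<le>\<^sub>0"
      using assms(2) by (auto elim!: nonpos_Ints_cases)
    moreover have "Gamma (\<beta> + m + 1) > 0" using assms(2) by (intro Gamma_real_pos) simp
    ultimately have "Gamma (\<beta> + m + k + 1) = pochhammer (\<beta> + m + 1) k * Gamma (\<beta> + m + 1)"
      by (simp add: pochhammer_Gamma add_ac)
    moreover have "b powr (\<beta> + m + k + 1) = b powr (\<beta> + k + 1) * b ^ m"
      using assms(1) by (simp add: powr_add powr_realpow)
    ultimately show "coeff p m * (Gamma (\<beta> + m + k + 1) / b powr (\<beta> + m + k + 1)) =
       (pochhammer (\<beta> + 1 + real m) k * (Gamma (\<beta> + real m + 1) * coeff p m)) * (1 / b) ^ m
         / b powr (\<beta> + real k + 1)"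
      by (simp add: power_divide add_ac mult_ac)
  qed simp
  also have "(\<Sum>m\<le>degree p. (pochhammer (\<beta> + 1 + real m) k * (Gamma (\<beta> + real m + 1) * coeff p m)) * (1 / b) ^ m)
     = poly (rising_transform (\<beta> + 1) k (gamma_poly \<beta> p)) (1 / b)"
  proof -
    have "degree (rising_transform (\<beta> + 1) k (gamma_poly \<beta> p)) \<le> degree p"
      by (intro degree_le) (simp add: coeff_rising_transform coeff_gamma_poly coeff_eq_0)
    hence "poly (rising_transform (\<beta> + 1) k (gamma_poly \<beta> p)) (1 / b) =
        (\<Sum>m\<le>degree p. coeff (rising_transform (\<beta> + 1) k (gamma_poly \<beta> p)) m * (1 / b) ^ m)"
      unfolding poly_altdef by (intro sum.mono_neutral_left) (auto simp: coeff_eq_0)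
    thus ?thesis by (simp add: coeff_rising_transform coeff_gamma_poly)
  qed
  finally show ?thesis
    unfolding set_lebesgue_integral_def by (rule has_bochner_integral_integral_eq)
qed

lemma Gamma_falling:
  assumes "real k < s + 1"
  shows "Gamma (s + 1) = falling s k * Gamma (s - real k + 1)"
  using assms
proof (induction k)
  case (Suc k)
  have "Gamma (s - real k + 1) = (s - real k) * Gamma (s - real k)"
    using Suc.prems by (intro Gamma_plus1) (auto elim!: nonpos_Ints_cases)
  thus ?case using Suc by (simp add: falling_Suc)
qed simp

lemma prod_linear_powers_dvd:
  fixes A :: "'a :: field poly"
  assumes "finite I" "inj_on c I" "\<And>i. i \<in> I \<Longrightarrow> [:- c i, 1:] ^ m i dvd A"
  shows "(\<Prod>i\<in>I. [:- c i, 1:] ^ m i) dvd A"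
proof (cases "A = 0")
  case False
  show ?thesis
    using assms
  proof (induction I rule: finite_induct)
    case (insert i I)
    let ?P = "\<Prod>j\<in>I. [:- c j, 1:] ^ m j"
    have "?P dvd A" using insert by (auto simp: inj_on_def)
    then obtain B where B: "A = ?P * B" by (elim dvdE)
    have "poly ?P (c i) \<noteq> 0"
      using insert.hyps insert.prems by (auto simp: poly_prod inj_on_def)
    hence "order (c i) A = order (c i) B"
      using False unfolding B by (subst order_mult) (auto simp: order_0I)
    hence "[:- c i, 1:] ^ m i dvd B"
      using insert.prems(2)[of i] False B by (auto simp: order_divides)
    hence "?P * [:- c i, 1:] ^ m i dvd A" unfolding B by (rule mult_dvd_mono[OF dvd_refl])
    thus ?case using insert.hyps by (simp add: mult.commute)
  qed simp
qed simp

lemma linear_powers_monic: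
  fixes c :: "'i \<Rightarrow> real"
  assumes "finite I"
  shows "degree (\<Prod>i\<in>I. [:- c i, 1:] ^ m i) = (\<Sum>i\<in>I. m i) \<and>
         lead_coeff (\<Prod>i\<in>I. [:- c i, 1:] ^ m i) = 1"
proof
  show "degree (\<Prod>i\<in>I. [:- c i, 1:] ^ m i) = (\<Sum>i\<in>I. m i)"
    by (subst degree_prod_eq_sum_degree) (auto simp: degree_linear_power)
  show "lead_coeff (\<Prod>i\<in>I. [:- c i, 1:] ^ m i) = 1"
    unfolding lead_coeff_prod lead_coeff_power by simp
qed

text \<open>
  By the preceding lemmas, p is orthogonal as required if and only if the product D of the
  (x - 1 / b_j)^(m_j) divides the Gamma-weighted polynomial of p.  Both have degree N, so for monic p
  they agree up to the factor Gamma (\<beta> + N + 1).  This gives existence and uniqueness at once.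
\<close>

theorem multiple_laguerre2_eq:
  assumes "\<beta> \<ge> 0" "\<And>j. j \<in> {1..r} \<Longrightarrow> b j > 0" "inj_on b {1..r}"
  shows "multiple_laguerre2 r \<beta> b m =
           laguerre_transform (\<beta> + real (\<Sum>j\<in>{1..r}. m j)) (\<Prod>j\<in>{1..r}. [:- (1 / b j), 1:] ^ m j)"
proof -
  define N where "N = (\<Sum>j\<in>{1..r}. m j)"
  define D where "D = (\<Prod>j\<in>{1..r}. [:- (1 / b j), 1:] ^ m j)"
  have D: "degree D = N" "lead_coeff D = 1"
    unfolding D_def N_def
    by (rule conjunct1[OF linear_powers_monic] conjunct2[OF linear_powers_monic]; simp)+
  have Gpos: "Gamma (\<beta> + real k + 1) > 0" for k using assms(1) by (intro Gamma_real_pos) simp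
  have inj: "inj_on (\<lambda>j. 1 / b j) {1..r}"
  proof (rule inj_onI)
    fix i j assume ij: "i \<in> {1..r}" "j \<in> {1..r}" and "1 / b i = 1 / b j"
    hence "b i = b j" by simp
    thus "i = j" using inj_onD[OF assms(3)] ij by blast
  qed
  have orth: "(\<forall>j\<in>{1..r}. \<forall>k<m j.
        (LINT x:{0..}|lborel. x ^ k * poly p x * exp ((1 - b j) * x) * x powr \<beta> * exp (- x)) = 0)
      \<longleftrightarrow> D dvd gamma_poly \<beta> p" for p
  proof -
    have "(\<forall>j\<in>{1..r}. \<forall>k<m j.
        (LINT x:{0..}|lborel. x ^ k * poly p x * exp ((1 - b j) * x) * x powr \<beta> * exp (- x)) = 0)
      \<longleftrightarrow> (\<forall>j\<in>{1..r}. \<forall>k<m j. poly (rising_transform (\<beta> + 1) k (gamma_poly \<beta> p)) (1 / b j) = 0)"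
    proof (intro ball_cong refl all_cong)
      fix j k assume "j \<in> {1..r}"
      hence "b j > 0" using assms(2) by blast
      thus "((LINT x:{0..}|lborel. x ^ k * poly p x * exp ((1 - b j) * x) * x powr \<beta> * exp (- x)) = 0) \<longleftrightarrow>
        poly (rising_transform (\<beta> + 1) k (gamma_poly \<beta> p)) (1 / b j) = 0"
        using assms(1) by (subst laguerre_moment_eq) auto
    qed
    also have "\<dots> \<longleftrightarrow> (\<forall>j\<in>{1..r}. [:- (1 / b j), 1:] ^ m j dvd gamma_poly \<beta> p)"
    proof (intro ball_cong refl)
      fix j assume "j \<in> {1..r}"
      hence "1 / b j \<noteq> 0" using assms(2) by fastforce
      thus "(\<forall>k<m j. poly (rising_transform (\<beta> + 1) k (gamma_poly \<beta> p)) (1 / b j) = 0) \<longleftrightarrow>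
        [:- (1 / b j), 1:] ^ m j dvd gamma_poly \<beta> p"
        by (rule rising_transform_vanishes_iff)
    qed
    also have "\<dots> \<longleftrightarrow> D dvd gamma_poly \<beta> p"
    proof
      assume "D dvd gamma_poly \<beta> p"
      thus "\<forall>j\<in>{1..r}. [:- (1 / b j), 1:] ^ m j dvd gamma_poly \<beta> p"
        unfolding D_def by (meson dvd_prodI dvd_trans finite_atLeastAtMost)
    next
      assume "\<forall>j\<in>{1..r}. [:- (1 / b j), 1:] ^ m j dvd gamma_poly \<beta> p"
      thus "D dvd gamma_poly \<beta> p"
        unfolding D_def by (intro prod_linear_powers_dvd inj) blast+
    qed
    finally show ?thesis .
  qed
  have gamma_lt: "gamma_poly \<beta> (laguerre_transform (\<beta> + real N) D) = smult (Gamma (\<beta> + real N + 1)) D"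
  proof (rule poly_eqI)
    fix k
    show "coeff (gamma_poly \<beta> (laguerre_transform (\<beta> + real N) D)) k =
            coeff (smult (Gamma (\<beta> + real N + 1)) D) k"
    proof (cases "k \<le> N")
      case True
      have "Gamma (\<beta> + real N + 1) = falling (\<beta> + real N) (N - k) * Gamma (\<beta> + real k + 1)"
        using Gamma_falling[of "N - k" "\<beta> + real N"] True assms(1) by (simp add: of_nat_diff)
      thus ?thesis by (simp add: coeff_gamma_poly coeff_laguerre_transform D mult_ac)
    qed (simp add: coeff_gamma_poly coeff_laguerre_transform coeff_eq_0 D)
  qed
  have inj_gamma: "p = q" if "gamma_poly \<beta> p = gamma_poly \<beta> q" for p q
  proof (rule poly_eqI)
    fix k
    from that have "Gamma (\<beta> + real k + 1) * coeff p k = Gamma (\<beta> + real k + 1) * coeff q k"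
      by (metis coeff_gamma_poly)
    thus "coeff p k = coeff q k" using Gpos[of k] by simp
  qed
  have "is_multiple_laguerre2 r \<beta> b m p \<longleftrightarrow> p = laguerre_transform (\<beta> + real N) D" for p
  proof
    assume p: "p = laguerre_transform (\<beta> + real N) D"
    have "lead_coeff p = 1" unfolding p lead_coeff_laguerre_transform by (rule D)
    moreover have "degree p = N" by (simp add: p D)
    moreover have "D dvd gamma_poly \<beta> p" unfolding p gamma_lt by (rule dvd_smult) simp
    ultimately show "is_multiple_laguerre2 r \<beta> b m p"
      unfolding is_multiple_laguerre2_def orth N_def[symmetric] by (intro conjI)
  next
    assume "is_multiple_laguerre2 r \<beta> b m p"
    hence *: "lead_coeff p = 1 \<and> degree p = N \<and> D dvd gamma_poly \<beta> p"
      unfolding is_multiple_laguerre2_def orth N_def[symmetric] .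
    note p = conjunct1[OF *] conjunct1[OF conjunct2[OF *]] conjunct2[OF conjunct2[OF *]]
    obtain K where K: "gamma_poly \<beta> p = D * K" using p(3) by (elim dvdE)
    have "coeff (gamma_poly \<beta> p) N = Gamma (\<beta> + real N + 1)"
      using p by (simp add: coeff_gamma_poly)
    hence nz: "gamma_poly \<beta> p \<noteq> 0" using Gpos[of N] by auto
    have "degree (gamma_poly \<beta> p) \<le> N"
      using p by (intro degree_le) (simp add: coeff_gamma_poly coeff_eq_0)
    moreover have "degree (gamma_poly \<beta> p) = N + degree K"
      using nz unfolding K by (subst degree_mult_eq) (auto simp: D)
    ultimately have "degree K = 0" by simp
    then obtain c where "K = [:c:]" by (rule degree_eq_zeroE)
    hence "gamma_poly \<beta> p = smult c D" using K by simp
    moreover from this have "c = Gamma (\<beta> + real N + 1)"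
      using \<open>coeff (gamma_poly \<beta> p) N = _\<close> D by simp
    ultimately have "gamma_poly \<beta> p = gamma_poly \<beta> (laguerre_transform (\<beta> + real N) D)"
      by (simp add: gamma_lt)
    thus "p = laguerre_transform (\<beta> + real N) D" by (rule inj_gamma)
  qed
  hence "multiple_laguerre2 r \<beta> b m = laguerre_transform (\<beta> + real N) D"
    unfolding multiple_laguerre2_def by (intro the_equality) blast+
  thus ?thesis by (simp only: N_def D_def)
qed


section \<open>Moments and weak convergence on a compact interval\<close>

lemma (in real_distribution) integrable_bounded_support:
  assumes "AE x in M. x \<in> {a..b}" and cont: "continuous_on UNIV (f :: real \<Rightarrow> real)"
  shows "integrable M f"
proof -
  have "compact (f ` {a..b})"
    using cont by (intro compact_continuous_image) (auto intro: continuous_on_subset)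
  then obtain B where "\<And>y. y \<in> f ` {a..b} \<Longrightarrow> norm y \<le> B"
    using compact_imp_bounded bounded_iff by metis
  hence "AE x in M. norm (f x) \<le> B" using assms(1) by auto
  moreover have "f \<in> borel_measurable M"
    using borel_measurable_continuous_onI[OF cont] by simp
  ultimately show ?thesis by (rule integrable_const_bound)
qed

text \<open>Polynomials are uniformly dense in the continuous functions on the interval.\<close>

lemma integral_eq_of_moments_eq:
  assumes M: "real_distribution M" "AE x in M. x \<in> {a..b}"
    and N: "real_distribution N" "AE x in N. x \<in> {a..b}"
    and moments: "\<And>k. (LINT x|M. x ^ k) = (LINT x|N. x ^ k)"
    and cont: "continuous_on UNIV (f :: real \<Rightarrow> real)"
  shows "(LINT x|M. f x) = (LINT x|N. f x)"
proof -
  interpret M: real_distribution M by fact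
  interpret N: real_distribution N by fact
  have "\<bar>(LINT x|M. f x) - (LINT x|N. f x)\<bar> \<le> 2 * e" if "e > 0" for e
  proof -
    obtain g where g: "real_polynomial_function g" "\<And>x. x \<in> {a..b} \<Longrightarrow> \<bar>f x - g x\<bar> < e"
      using Stone_Weierstrass_real_polynomial_function[OF compact_Icc continuous_on_subset[OF cont subset_UNIV] \<open>e > 0\<close>]
      by blast
    obtain c n where g_eq: "g = (\<lambda>x. \<Sum>i\<le>n. c i * x ^ i)"
      using g(1) by (auto simp: real_polynomial_function_iff_sum)
    have cont_g: "continuous_on UNIV g" unfolding g_eq by (intro continuous_intros)
    have close: "\<bar>(LINT x|D. f x) - (LINT x|D. g x)\<bar> \<le> e"
      if "real_distribution D" "AE x in D. x \<in> {a..b}" for D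
    proof -
      interpret D: real_distribution D by fact
      have int: "integrable D f" "integrable D g" "integrable D (\<lambda>x. \<bar>f x - g x\<bar>)"
        by (intro D.integrable_bounded_support[OF that(2)] cont cont_g continuous_intros)+
      have "\<bar>(LINT x|D. f x) - (LINT x|D. g x)\<bar> = \<bar>LINT x|D. f x - g x\<bar>"
        using int by simp
      also have "\<dots> \<le> (LINT x|D. \<bar>f x - g x\<bar>)" by (rule integral_abs_bound)
      also have "\<dots> \<le> (LINT x|D. e)"
        using int that(2) g(2) by (intro integral_mono_AE) (auto intro: less_imp_le)
      finally show ?thesis using D.prob_space by simp
    qed
    have "(LINT x|M. g x) = (LINT x|N. g x)"
    proof -
      have "(LINT x|D. g x) = (\<Sum>i\<le>n. c i * (LINT x|D. x ^ i))"
        if "real_distribution D" "AE x in D. x \<in> {a..b}" for D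
      proof -
        interpret D: real_distribution D by fact
        have "integrable D (\<lambda>x. x ^ i)" for i
          by (intro D.integrable_bounded_support[OF that(2)] continuous_intros)
        thus ?thesis unfolding g_eq by simp
      qed
      from this[OF M] this[OF N] show ?thesis by (simp add: moments)
    qed
    thus ?thesis using close[OF M] close[OF N] by linarith
  qed
  note le = this
  have "\<bar>(LINT x|M. f x) - (LINT x|N. f x)\<bar> \<le> 0"
  proof (rule field_le_epsilon)
    fix e :: real assume "e > 0"
    thus "\<bar>(LINT x|M. f x) - (LINT x|N. f x)\<bar> \<le> 0 + e" using le[of "e / 2"] by simp
  qed
  thus ?thesis by simp
qed

theorem compact_support_determined_by_moments:
  assumes M: "real_distribution M" "AE x in M. x \<in> {a..b}"
    and N: "real_distribution N" "AE x in N. x \<in> {a..b}"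
    and moments: "\<And>k. (LINT x|M. x ^ k) = (LINT x|N. x ^ k)"
  shows "M = N"
proof (rule Levy_uniqueness[OF M(1) N(1)])
  interpret M: real_distribution M by fact
  interpret N: real_distribution N by fact
  have eq: "(LINT x|M. f x) = (LINT x|N. f x)" if "continuous_on UNIV f" for f :: "real \<Rightarrow> real"
    using integral_eq_of_moments_eq[OF M N moments that] .
  show "char M = char N"
  proof
    fix t
    have parts: "Re (char D t) = (LINT x|D. cos (t * x))" "Im (char D t) = (LINT x|D. sin (t * x))"
      if "real_distribution D" for D
    proof -
      interpret D: real_distribution D by fact
      have "complex_integrable D (\<lambda>x. iexp (t * x))"
        by (intro D.integrable_iexp) auto
      from integral_Re[OF this] integral_Im[OF this]
      show "Re (char D t) = (LINT x|D. cos (t * x))" "Im (char D t) = (LINT x|D. sin (t * x))"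
        by (simp_all add: char_def Re_exp Im_exp)
    qed
    have "Re (char M t) = Re (char N t)"
      unfolding parts[OF M(1)] parts[OF N(1)] by (intro eq continuous_intros)
    moreover have "Im (char M t) = Im (char N t)"
      unfolding parts[OF M(1)] parts[OF N(1)] by (intro eq continuous_intros)
    ultimately show "char M t = char N t" by (rule complex_eqI)
  qed
qed

text \<open>
  A bounded continuous function vanishing exactly on the interval shows that no mass escapes.  Since
  all measures live on the interval, x^k may be replaced by its truncation, which is bounded and
  continuous.
\<close>

lemma weak_limit_bounded_support:
  assumes \<mu>: "\<And>n. real_distribution (\<mu> n)" "\<And>n. AE x in \<mu> n. x \<in> {a..b}"
    and M: "real_distribution M" "weak_conv_m \<mu> M" and "a \<le> b"
  shows "AE x in M. x \<in> {a..b}"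
    and "\<And>k. (\<lambda>n. LINT x|\<mu> n. x ^ k) \<longlonglongrightarrow> (LINT x|M. x ^ k)"
proof -
  interpret M: real_distribution M by fact
  have conv: "(\<lambda>n. LINT x|\<mu> n. f x) \<longlonglongrightarrow> (LINT x|M. f x)"
    if "continuous_on UNIV f" "\<And>x. \<bar>f x\<bar> \<le> B" for f :: "real \<Rightarrow> real" and B
    using that by (intro weak_conv_imp_integral_bdd_continuous_conv[OF \<mu>(1) M])
      (auto simp: continuous_on_eq_continuous_at)
  define h where "h = (\<lambda>x. min 1 (max 0 (max (a - x) (x - b))))"
  have h1: "continuous_on UNIV h" unfolding h_def by (intro continuous_intros)
  have h2: "\<bar>h x\<bar> \<le> 1" "0 \<le> h x" "h x = 0 \<longleftrightarrow> x \<in> {a..b}" for x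
    by (auto simp: h_def min_def max_def)
  note h = h1 h2
  have "(LINT x|\<mu> n. h x) = 0" for n
    using \<mu>(2)[of n] h(4) by (intro integral_eq_zero_AE) auto
  hence "(LINT x|M. h x) = 0" using conv[OF h(1,2)] by (simp add: LIMSEQ_const_iff)
  moreover have "integrable M h"
    using h borel_measurable_continuous_onI[OF h(1)] by (intro M.integrable_const_bound[of _ 1]) auto
  ultimately have "AE x in M. h x = 0"
    using integral_nonneg_eq_0_iff_AE[of M h] h(3) by auto
  thus AE: "AE x in M. x \<in> {a..b}" using h(4) by auto
  fix k
  define g where "g = (\<lambda>x. (max a (min b x)) ^ k)"
  have g: "continuous_on UNIV g" unfolding g_def by (intro continuous_intros)
  have "\<bar>g x\<bar> \<le> (\<bar>a\<bar> + \<bar>b\<bar>) ^ k" for x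
    unfolding g_def power_abs by (intro power_mono) (use \<open>a \<le> b\<close> in \<open>auto simp: max_def min_def\<close>)
  from conv[OF g this] have "(\<lambda>n. LINT x|\<mu> n. g x) \<longlonglongrightarrow> (LINT x|M. g x)" .
  moreover have "(LINT x|D. g x) = (LINT x|D. x ^ k)"
    if "real_distribution D" "AE x in D. x \<in> {a..b}" for D
  proof -
    interpret D: real_distribution D by fact
    have "g \<in> borel_measurable D" using borel_measurable_continuous_onI[OF g] by simp
    thus ?thesis using that(2) by (intro integral_cong_AE) (auto simp: g_def)
  qed
  ultimately show "(\<lambda>n. LINT x|\<mu> n. x ^ k) \<longlonglongrightarrow> (LINT x|M. x ^ k)"
    using \<mu> M(1) AE by simp
qed

text \<open>
  The sequence is tight, and all its weak limit points have the same moments and hence coincide.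
\<close>

theorem moment_convergence_imp_weak_convergence:
  assumes \<mu>: "\<And>n. real_distribution (\<mu> n)" "\<And>n. AE x in \<mu> n. x \<in> {a..b}" and "a \<le> b"
    and moments: "\<And>k. (\<lambda>n. LINT x|\<mu> n. x ^ k) \<longlonglongrightarrow> m k"
  shows "\<exists>M. real_distribution M \<and> weak_conv_m \<mu> M \<and> (AE x in M. x \<in> {a..b}) \<and>
           (\<forall>k. (LINT x|M. x ^ k) = m k)"
proof -
  have tight: "tight \<mu>"
    unfolding tight_def
  proof (intro conjI allI impI)
    show "real_distribution (\<mu> n)" for n by fact
    fix \<epsilon> :: real assume "\<epsilon> > 0"
    have "measure (\<mu> n) {a - 1<..b} > 1 - \<epsilon>" for n
    proof -
      interpret real_distribution "\<mu> n" by fact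
      have "measure (\<mu> n) {a - 1<..b} = 1"
        using \<mu>(2)[of n] by (subst prob_eq_1) auto
      thus ?thesis using \<open>\<epsilon> > 0\<close> by simp
    qed
    thus "\<exists>a b. a < b \<and> (\<forall>n. measure (\<mu> n) {a<..b} > 1 - \<epsilon>)"
      using \<open>a \<le> b\<close> by (intro exI[of _ "a - 1"] exI[of _ b]) auto
  qed
  have limit: "(AE x in M. x \<in> {a..b}) \<and> (\<forall>k. (LINT x|M. x ^ k) = m k)"
    if "strict_mono s" "real_distribution M" "weak_conv_m (\<mu> \<circ> s) M" for s M
  proof -
    note * = weak_limit_bounded_support[OF _ _ that(2,3) \<open>a \<le> b\<close>, unfolded comp_def, OF \<mu>]
    have "(LINT x|M. x ^ k) = m k" for k
      using LIMSEQ_unique[OF *(2)[of k] LIMSEQ_subseq_LIMSEQ[OF moments that(1), unfolded comp_def]] .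
    thus ?thesis using *(1) by blast
  qed
  obtain s M where M: "strict_mono (s :: nat \<Rightarrow> nat)" "real_distribution M" "weak_conv_m (\<mu> \<circ> id \<circ> s) M"
    using tight_imp_convergent_subsubsequence[OF tight strict_mono_id] by blast
  have M': "(AE x in M. x \<in> {a..b})" "\<And>k. (LINT x|M. x ^ k) = m k"
    using limit[OF M(1,2)] M(3) by simp_all
  have "weak_conv_m \<mu> M"
  proof (rule tight_subseq_weak_converge[OF \<mu>(1) M(2) tight])
    fix s' \<nu> assume *: "strict_mono s'" "real_distribution \<nu>" "weak_conv_m (\<mu> \<circ> s') \<nu>"
    have "\<nu> = M"
      by (rule compact_support_determined_by_moments[OF *(2) _ M(2), of a b])
         (use limit[OF *] M' in auto)
    thus "weak_conv_m (\<mu> \<circ> s') M" using *(3) by simp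
  qed
  hence "real_distribution M \<and> weak_conv_m \<mu> M \<and> (AE x in M. x \<in> {a..b}) \<and>
           (\<forall>k. (LINT x|M. x ^ k) = m k)"
    using M(2) M' by (intro conjI allI)
  thus ?thesis ..
qed


section \<open>S-transforms and uniqueness of the free multiplicative convolution\<close>

lemma closed_measure_support: "closed (measure_support \<mu>)"
proof -
  have "- measure_support \<mu> = \<Union>{U. open U \<and> emeasure \<mu> U = 0}"
    unfolding measure_support_def by (auto simp: zero_less_iff_neq_zero)
  hence "open (- measure_support \<mu>)" by auto
  thus ?thesis by (simp add: closed_def)
qed

lemma AE_measure_support:
  fixes \<mu> :: "'a :: second_countable_topology measure"
  assumes "sets \<mu> = sets borel"
  shows "AE x in \<mu>. x \<in> measure_support \<mu>"
proof -
  define F where "F = {U. open U \<and> emeasure \<mu> U = 0}"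
  obtain F' where F': "F' \<subseteq> F" "countable F'" "\<Union>F' = \<Union>F"
    by (rule Lindelof[of F]) (auto simp: F_def)
  have "(\<Union>U\<in>F'. U) \<in> null_sets \<mu>"
    using F'(1) by (intro null_sets_UN' F'(2)) (auto simp: F_def null_sets_def assms)
  moreover have "- measure_support \<mu> = \<Union>F"
    unfolding measure_support_def F_def by (auto simp: zero_less_iff_neq_zero)
  ultimately show ?thesis
    using F'(3) by (intro AE_I'[of "- measure_support \<mu>"]) auto
qed

lemma measure_support_subset:
  assumes "sets \<mu> = sets borel" "closed S" "AE x in \<mu>. x \<in> S"
  shows "measure_support \<mu> \<subseteq> S"
proof (rule ccontr)
  assume "\<not> measure_support \<mu> \<subseteq> S"
  then obtain x where x: "x \<in> measure_support \<mu>" "x \<in> - S" by blast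
  have "- S \<in> sets \<mu>" "open (- S)" using assms by auto
  have "emeasure \<mu> (- S) = 0"
    using assms(3) \<open>- S \<in> sets \<mu>\<close> sets.sets_into_space[OF \<open>- S \<in> sets \<mu>\<close>]
    by (subst (asm) AE_iff_measurable[of "- S"]) auto
  moreover have "emeasure \<mu> (- S) > 0"
    using x \<open>open (- S)\<close> unfolding measure_support_def by blast
  ultimately show False by simp
qed

text \<open>
  The mean is positive because a measure on the half line with mean 0 is the unit mass at 0.  This is
  what makes the moment series invertible for composition.
\<close>

lemma compact_prob_nonnegD:
  assumes "compact_prob_nonneg \<mu>"
  shows "real_distribution \<mu>" and "\<exists>C\<ge>0. AE x in \<mu>. x \<in> {0..C}" and "(LINT x|\<mu>. x) > 0"
proof -
  have \<mu>: "prob_space \<mu>" "sets \<mu> = sets borel" "compact (measure_support \<mu>)"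
    "measure_support \<mu> \<subseteq> {0..}" "\<mu> \<noteq> return borel 0"
    using assms by (auto simp: compact_prob_nonneg_def)
  interpret prob_space \<mu> by fact
  show rd: "real_distribution \<mu>" by unfold_locales (rule \<mu>)
  interpret real_distribution \<mu> by fact
  obtain C where C: "\<And>x. x \<in> measure_support \<mu> \<Longrightarrow> norm x \<le> C"
    using compact_imp_bounded[OF \<mu>(3)] unfolding bounded_iff by blast
  have supp: "AE x in \<mu>. x \<in> measure_support \<mu>" by (rule AE_measure_support) fact
  hence AE: "AE x in \<mu>. x \<in> {0..max C 0}"
  proof eventually_elim
    case (elim x)
    thus ?case using C[of x] \<mu>(4) by auto
  qed
  thus "\<exists>C\<ge>0. AE x in \<mu>. x \<in> {0..C}" by (intro exI[of _ "max C 0"]) auto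
  have int: "integrable \<mu> (\<lambda>x. x)" by (intro integrable_bounded_support[OF AE] continuous_intros)
  have nonneg: "AE x in \<mu>. 0 \<le> x" using AE by auto
  have "(LINT x|\<mu>. x) \<noteq> 0"
  proof
    assume "(LINT x|\<mu>. x) = 0"
    hence zero: "AE x in \<mu>. x = 0"
      using integral_nonneg_eq_0_iff_AE[OF int nonneg] by simp
    have "\<mu> = return borel 0"
    proof (rule measure_eqI)
      fix A assume A: "A \<in> sets \<mu>"
      have "emeasure \<mu> A = emeasure \<mu> (if 0 \<in> A then space \<mu> else {})"
        using zero A by (intro emeasure_eq_AE) auto
      also have "\<dots> = indicator A 0" by (simp add: emeasure_space_1 indicator_def del: space_eq_univ)
      finally show "emeasure \<mu> A = emeasure (return borel 0) A" using A by simp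
    qed simp
    thus False using \<mu>(5) by contradiction
  qed
  moreover have "(LINT x|\<mu>. x) \<ge> 0" by (rule integral_nonneg_AE) fact
  ultimately show "(LINT x|\<mu>. x) > 0" by simp
qed

lemma moment_series_nth_0 [simp]: "moment_series \<mu> $ 0 = 0"
  by (simp add: moment_series_def)

lemma moment_series_nth_1 [simp]: "moment_series \<mu> $ Suc 0 = (LINT x|\<mu>. x)"
  by (simp add: moment_series_def)

text \<open>The S-transform as a function of the moment series alone.\<close>

definition S_series :: "real fps \<Rightarrow> real fps" where
  "S_series A = (1 + fps_X) * fps_inv A / fps_X"

lemma S_transform_eq: "S_transform \<mu> = S_series (moment_series \<mu>)"
  by (simp add: S_transform_def S_series_def)

lemma fps_X_mult_S_series: "fps_X * S_series A = (1 + fps_X) * fps_inv A"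
proof -
  define F where "F = (1 + fps_X) * fps_inv A"
  have "F $ 0 = 0" by (simp add: F_def fps_inv_def)
  have "F = fps_X * fps_shift 1 F"
  proof (rule fps_ext)
    fix n show "F $ n = (fps_X * fps_shift 1 F) $ n"
      using \<open>F $ 0 = 0\<close> by (cases n) simp_all
  qed
  hence "fps_X dvd F" by (rule dvdI)
  thus ?thesis unfolding S_series_def F_def by (rule dvd_mult_div_cancel)
qed

lemma S_series_inject:
  fixes A B :: "real fps"
  assumes "A $ 0 = 0" "A $ 1 \<noteq> 0" "B $ 0 = 0" "B $ 1 \<noteq> 0" "S_series A = S_series B"
  shows "A = B"
proof -
  have "(1 + fps_X) * fps_inv A = (1 + fps_X) * fps_inv B"
    using assms(5) by (simp flip: fps_X_mult_S_series)
  moreover have "1 + fps_X \<noteq> (0 :: real fps)"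
    by (metis add.right_neutral fps_X_nth fps_add_nth fps_one_nth fps_zero_nth zero_neq_one)
  ultimately have "fps_inv A = fps_inv B" by simp
  hence "fps_inv (fps_inv A) = fps_inv (fps_inv B)" by simp
  thus ?thesis using assms by (simp add: fps_inv_idempotent)
qed

lemma compact_prob_nonneg_S_transform_inject:
  assumes \<mu>: "compact_prob_nonneg \<mu>" and \<nu>: "compact_prob_nonneg \<nu>"
    and "S_transform \<mu> = S_transform \<nu>"
  shows "\<mu> = \<nu>"
proof -
  note \<mu>' = compact_prob_nonnegD[OF \<mu>] and \<nu>' = compact_prob_nonnegD[OF \<nu>]
  have eq: "moment_series \<mu> = moment_series \<nu>"
  proof (rule S_series_inject)
    show "S_series (moment_series \<mu>) = S_series (moment_series \<nu>)"
      using assms(3) by (simp only: S_transform_eq)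
  qed (use \<mu>'(3) \<nu>'(3) in auto)
  have moments: "(LINT x|\<mu>. x ^ k) = (LINT x|\<nu>. x ^ k)" for k
  proof (cases "k = 0")
    case True
    interpret M: real_distribution \<mu> by (rule \<mu>')
    interpret N: real_distribution \<nu> by (rule \<nu>')
    show ?thesis using True M.prob_space N.prob_space by simp
  next
    case False
    have "moment_series \<mu> $ k = moment_series \<nu> $ k" by (simp add: eq)
    thus ?thesis using False by (simp add: moment_series_def)
  qed
  obtain C D where CD: "AE x in \<mu>. x \<in> {0..C}" "AE x in \<nu>. x \<in> {0..D}"
    using \<mu>'(2) \<nu>'(2) by blast
  have "AE x in \<mu>. x \<in> {0..max C D}" "AE x in \<nu>. x \<in> {0..max C D}"
    by (rule eventually_mono[OF CD(1)], force) (rule eventually_mono[OF CD(2)], force)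
  thus ?thesis
    using compact_support_determined_by_moments[OF \<mu>'(1) _ \<nu>'(1) _ moments] by blast
qed

text \<open>
  The S-transform determines the moment series and therefore the measure, so any compactly supported
  solution of the defining equation is the convolution.
\<close>

lemma free_mult_conv_eqI:
  assumes "compact_prob_nonneg \<nu>" "S_transform \<nu> = S_transform \<mu> * S_transform \<eta>"
  shows "\<mu> \<boxtimes> \<eta> = \<nu>"
  unfolding free_mult_conv_def
proof (rule the_equality)
  show "compact_prob_nonneg \<nu> \<and> S_transform \<nu> = S_transform \<mu> * S_transform \<eta>"
    using assms by blast
  fix \<nu>' assume "compact_prob_nonneg \<nu>' \<and> S_transform \<nu>' = S_transform \<mu> * S_transform \<eta>"
  thus "\<nu>' = \<nu>"
    using assms by (intro compact_prob_nonneg_S_transform_inject[of \<nu>' \<nu>]) auto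
qed

text \<open>
  Composing the equation for L with the inverse \<kappa> of L gives X = E o (\<kappa> (l + X)), that is, the inverse
  of E is \<kappa> (l + X).  Composing the equation for A with its inverse \<xi> gives \<xi> (l + X) (1 + X) = X, that
  is, the S-series of A is 1 / (l + X).  The product of the two S-series is thus (1 + X) \<kappa> / X.
\<close>

lemma S_series_subordination:
  fixes l :: real and A E L :: "real fps"
  assumes "l \<noteq> 0" "A $ 0 = 0" "A $ 1 \<noteq> 0" "E $ 0 = 0" "E $ 1 \<noteq> 0" "L $ 0 = 0" "L $ 1 \<noteq> 0"
    and A: "A = fps_X * (fps_const l + A) * (1 + A)"
    and L: "L = E oo (fps_X * (fps_const l + L))"
  shows "S_series L = S_series A * S_series E"
proof -
  define \<kappa> where "\<kappa> = fps_inv L"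
  define \<xi> where "\<xi> = fps_inv A"
  have \<kappa>0: "\<kappa> $ 0 = 0" and \<xi>0: "\<xi> $ 0 = 0" by (simp_all add: \<kappa>_def \<xi>_def fps_inv_def)
  have L\<kappa>: "L oo \<kappa> = fps_X" and A\<xi>: "A oo \<xi> = fps_X"
    unfolding \<kappa>_def \<xi>_def using assms by (simp_all add: fps_inv_right)
  have "fps_X = (E oo (fps_X * (fps_const l + L))) oo \<kappa>"
    using L\<kappa> L by simp
  also have "\<dots> = E oo ((fps_X * (fps_const l + L)) oo \<kappa>)"
    using \<kappa>0 by (intro fps_compose_assoc[symmetric]) auto
  also have "(fps_X * (fps_const l + L)) oo \<kappa> = \<kappa> * (fps_const l + fps_X)"
    by (simp add: fps_compose_mult_distrib[OF \<kappa>0] fps_compose_add_distrib L\<kappa> fps_X_fps_compose_startby0[OF \<kappa>0])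
  finally have E: "E oo (\<kappa> * (fps_const l + fps_X)) = fps_X" ..
  have "\<kappa> * (fps_const l + fps_X) = (fps_inv E oo E) oo (\<kappa> * (fps_const l + fps_X))"
    using assms \<kappa>0 by (simp add: fps_inv fps_X_fps_compose_startby0)
  also have "\<dots> = fps_inv E oo (E oo (\<kappa> * (fps_const l + fps_X)))"
    using assms \<kappa>0 by (intro fps_compose_assoc[symmetric]) auto
  finally have inv_E: "fps_inv E = \<kappa> * (fps_const l + fps_X)" by (simp add: E)
  have "fps_X = (fps_X * (fps_const l + A) * (1 + A)) oo \<xi>"
    using A\<xi> A by simp
  also have "\<dots> = \<xi> * (fps_const l + fps_X) * (1 + fps_X)"
    by (simp add: fps_compose_mult_distrib[OF \<xi>0] fps_compose_add_distrib A\<xi> fps_X_fps_compose_startby0[OF \<xi>0])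
  finally have \<xi>: "\<xi> * (fps_const l + fps_X) * (1 + fps_X) = fps_X" ..
  have "fps_X * (fps_X * (S_series A * S_series E)) = (fps_X * S_series A) * (fps_X * S_series E)"
    by (simp add: mult_ac)
  also have "\<dots> = ((1 + fps_X) * \<xi>) * ((1 + fps_X) * (\<kappa> * (fps_const l + fps_X)))"
    unfolding fps_X_mult_S_series inv_E \<xi>_def ..
  also have "\<dots> = (\<xi> * (fps_const l + fps_X) * (1 + fps_X)) * ((1 + fps_X) * \<kappa>)"
    by (simp only: mult_ac)
  also have "\<dots> = fps_X * (fps_X * S_series L)"
    unfolding \<xi> fps_X_mult_S_series \<kappa>_def ..
  finally show ?thesis by simp
qed

lemma moment_series_discrete_measure:
  assumes "\<And>i. i \<in> {1..r} \<Longrightarrow> q i \<ge> 0"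
  shows "moment_series (discrete_measure r q u) =
           (\<Sum>i\<in>{1..r}. fps_const (q i) * Abs_fps (\<lambda>k. if k = 0 then 0 else u i ^ k))"
proof (rule fps_ext)
  fix k
  have "(LINT x|discrete_measure r q u. x ^ k) = (LINT i|point_measure {1..r} (\<lambda>j. ennreal (q j)). u i ^ k)"
    unfolding discrete_measure_def by (subst integral_distr) (auto simp: measurable_point_measure_eq1)
  also have "\<dots> = (\<Sum>i\<in>{1..r}. q i * u i ^ k)"
    using assms by (subst lebesgue_integral_point_measure_finite) auto
  finally show "moment_series (discrete_measure r q u) $ k =
      (\<Sum>i\<in>{1..r}. fps_const (q i) * Abs_fps (\<lambda>k. if k = 0 then 0 else u i ^ k)) $ k"
    by (simp add: moment_series_def fps_sum_nth)
qed

lemma geometric_fps_compose: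
  fixes Y :: "real fps"
  assumes "Y $ 0 = 0"
  shows "Abs_fps (\<lambda>k. if k = 0 then 0 else u ^ k) oo Y =
           fps_const u * Y * inverse (1 - fps_const u * Y)"
proof -
  let ?g = "Abs_fps (\<lambda>k. if k = 0 then 0 else u ^ k)"
  have "((1 - fps_const u * fps_X) * ?g) oo Y = (fps_const u * fps_X) oo Y"
    by (simp only: geometric_fps)
  hence eq: "(1 - fps_const u * Y) * (?g oo Y) = fps_const u * Y"
    by (simp add: fps_compose_mult_distrib[OF assms] fps_compose_sub_distrib
          fps_X_fps_compose_startby0[OF assms])
  have "inverse (1 - fps_const u * Y) * (1 - fps_const u * Y) = 1"
    by (rule inverse_mult_eq_1) (simp add: assms)
  hence "?g oo Y = inverse (1 - fps_const u * Y) * (1 - fps_const u * Y) * (?g oo Y)"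
    by simp
  also have "\<dots> = inverse (1 - fps_const u * Y) * (fps_const u * Y)"
    unfolding mult.assoc eq ..
  finally show ?thesis by (simp only: mult.commute)
qed


section \<open>Moments of the Marchenko-Pastur distribution\<close>

text \<open>
  With \<rho> = 1 / l and l \<ge> 1 there is no atom, and the density is the square root of the quadratic below
  divided by 2 \<pi> x.  The moments of positive order are therefore integrals of a power of x times that
  square root.  Integration by parts yields a three-term recurrence, that is, a first order differential
  equation for the moment series, which the square root of a quadratic polynomial also solves.
\<close>

definition mp_quadratic :: "real \<Rightarrow> real \<Rightarrow> real" where
  "mp_quadratic l x = 2 * (l + 1) * x - x\<^sup>2 - (l - 1)\<^sup>2"

definition mp_integral :: "real \<Rightarrow> nat \<Rightarrow> real" where
  "mp_integral l k =
     integral {(sqrt l - 1)\<^sup>2..(sqrt l + 1)\<^sup>2} (\<lambda>x. x ^ k * sqrt (mp_quadratic l x))"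

lemma mp_quadratic_factor:
  assumes "l \<ge> 0"
  shows "mp_quadratic l x = ((sqrt l + 1)\<^sup>2 - x) * (x - (sqrt l - 1)\<^sup>2)"
proof -
  have "(sqrt l + 1)\<^sup>2 = l + 1 + 2 * sqrt l" "(sqrt l - 1)\<^sup>2 = l + 1 - 2 * sqrt l"
    using assms by (simp_all add: power2_sum power2_diff)
  moreover have "mp_quadratic l x = (l + 1 + 2 * sqrt l - x) * (x - (l + 1 - 2 * sqrt l))"
    using real_sqrt_mult_self[of l] assms
    by (simp add: mp_quadratic_def algebra_simps power2_eq_square)
  ultimately show ?thesis by simp
qed

lemma mp_quadratic_shifted:
  assumes "l \<ge> 0"
  shows "mp_quadratic l x = (2 * sqrt l)\<^sup>2 - (x - (l + 1))\<^sup>2"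
  using assms by (simp add: mp_quadratic_def power2_eq_square algebra_simps)

lemma continuous_on_mp_quadratic [continuous_intros]: "continuous_on A (mp_quadratic l)"
  unfolding mp_quadratic_def by (intro continuous_intros)

lemma mp_quadratic_deriv: "(mp_quadratic l has_real_derivative 2 * (l + 1) - 2 * x) (at x)"
  unfolding mp_quadratic_def by (auto intro!: derivative_eq_intros)

lemma mp_integrable: "(\<lambda>x. x ^ k * sqrt (mp_quadratic l x)) integrable_on {a..b}"
  by (intro integrable_continuous_interval continuous_intros)

lemma mp_edges:
  assumes "l > 0"
  shows "(1 - sqrt (1 / l))\<^sup>2 / (1 / l) = (sqrt l - 1)\<^sup>2"
    and "(1 + sqrt (1 / l))\<^sup>2 / (1 / l) = (sqrt l + 1)\<^sup>2"
    and "(sqrt l - 1)\<^sup>2 \<le> (sqrt l + 1)\<^sup>2"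
proof -
  have "(1 + c * sqrt (1 / l))\<^sup>2 / (1 / l) = ((1 + c * sqrt (1 / l)) * sqrt l)\<^sup>2" for c
    using assms by (simp add: power_mult_distrib)
  moreover have "(1 + c * sqrt (1 / l)) * sqrt l = sqrt l + c" for c
    using assms by (simp add: real_sqrt_divide field_simps)
  ultimately have "(1 + c * sqrt (1 / l))\<^sup>2 / (1 / l) = (sqrt l + c)\<^sup>2" for c by simp
  from this[of 1] this[of "-1"] show "(1 - sqrt (1 / l))\<^sup>2 / (1 / l) = (sqrt l - 1)\<^sup>2"
    "(1 + sqrt (1 / l))\<^sup>2 / (1 / l) = (sqrt l + 1)\<^sup>2" by simp_all
  show "(sqrt l - 1)\<^sup>2 \<le> (sqrt l + 1)\<^sup>2"
    using assms by (simp add: power2_eq_square algebra_simps)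
qed

lemma marchenko_pastur_moment:
  assumes "l \<ge> 1"
  shows "(LINT x|marchenko_pastur (1 / l). x ^ Suc k) = mp_integral l k / (2 * pi)"
proof -
  define lo hi where "lo = (sqrt l - 1)\<^sup>2" and "hi = (sqrt l + 1)\<^sup>2"
  have l: "l > 0" "l \<ge> 0" using assms by auto
  define d where "d = (\<lambda>x. 1 / (2 * pi * x) * sqrt ((hi - x) * (x - lo)) * indicator {lo..hi} x)"
  have "0 \<le> lo" by (simp add: lo_def)
  have Q: "mp_quadratic l x = (hi - x) * (x - lo)" for x
    using mp_quadratic_factor[OF l(2)] by (simp add: lo_def hi_def)
  have "marchenko_pastur (1 / l) = density lborel (\<lambda>x. ennreal (d x))"
    using assms unfolding marchenko_pastur_def Let_def mp_edges(1,2)[OF l(1)] density_def d_def lo_def hi_def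
    by simp
  moreover have "d \<in> borel_measurable lborel" unfolding d_def by measurable
  moreover have "AE x in lborel. 0 \<le> d x"
    using \<open>0 \<le> lo\<close> by (intro AE_I2) (auto simp: d_def indicator_def)
  ultimately have "(LINT x|marchenko_pastur (1 / l). x ^ Suc k) = (LINT x|lborel. d x * x ^ Suc k)"
    by (simp add: integral_real_density)
  also have "\<dots> = (LINT x|lborel. (1 / (2 * pi)) * (indicator {lo..hi} x *\<^sub>R (x ^ k * sqrt (mp_quadratic l x))))"
  proof (rule Bochner_Integration.integral_cong)
    fix x :: real
    show "d x * x ^ Suc k =
            (1 / (2 * pi)) * (indicator {lo..hi} x *\<^sub>R (x ^ k * sqrt (mp_quadratic l x)))"
    proof (cases "x = 0")
      case True
      \<comment> \<open>The point 0 lies in the support only if it is the left edge, where the quadratic vanishes.\<close>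
      hence "x \<in> {lo..hi} \<Longrightarrow> x = lo" using \<open>0 \<le> lo\<close> by auto
      thus ?thesis using True
        by (auto simp: d_def indicator_def Q)
    next
      case False
      thus ?thesis
        by (auto simp: d_def indicator_def Q)
    qed
  qed simp
  also have "\<dots> = (1 / (2 * pi)) * (LINT x:{lo..hi}|lborel. x ^ k * sqrt (mp_quadratic l x))"
    unfolding set_lebesgue_integral_def by (rule integral_mult_right_zero)
  also have "(LINT x:{lo..hi}|lborel. x ^ k * sqrt (mp_quadratic l x)) = mp_integral l k"
    unfolding mp_integral_def lo_def hi_def
    by (intro set_borel_integral_eq_integral borel_integrable_atLeastAtMost' continuous_intros)
  finally show ?thesis by simp
qed

text \<open>
  The area of a half disc of radius 2 sqrt l, from the primitive
  ((x - m) w + R^2 arcsin ((x - m) / R)) / 2 of w = sqrt (R^2 - (x - m)^2).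
\<close>

lemma mp_integral_0:
  assumes "l > 0"
  shows "mp_integral l 0 = 2 * pi * l"
proof -
  define lo hi where "lo = (sqrt l - 1)\<^sup>2" and "hi = (sqrt l + 1)\<^sup>2"
  define R where "R = 2 * sqrt l"
  define m where "m = l + 1"
  have R: "R > 0" "R\<^sup>2 = 4 * l" using assms by (simp_all add: R_def power_mult_distrib)
  have edges: "lo = m - R" "hi = m + R"
    using assms by (simp_all add: lo_def hi_def m_def R_def power2_sum power2_diff)
  have Q: "mp_quadratic l x = R\<^sup>2 - (x - m)\<^sup>2" for x
    using mp_quadratic_shifted[of l x] assms by (simp add: R_def m_def)
  define F where "F = (\<lambda>x. ((x - m) * sqrt (mp_quadratic l x) + R\<^sup>2 * arcsin ((x - m) / R)) / 2)"
  have "((\<lambda>x. sqrt (mp_quadratic l x)) has_integral (F hi - F lo)) {lo..hi}"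
  proof (rule fundamental_theorem_of_calculus_interior)
    show "lo \<le> hi" using R edges by simp
    show "continuous_on {lo..hi} F"
      unfolding F_def using R
      by (intro continuous_intros) (auto simp: edges field_simps)
    fix x assume x: "x \<in> {lo<..<hi}"
    define w where "w = sqrt (mp_quadratic l x)"
    have pos: "mp_quadratic l x > 0"
    proof -
      have "mp_quadratic l x = (hi - x) * (x - lo)" unfolding Q edges by (simp add: power2_eq_square algebra_simps)
      thus ?thesis using x by simp
    qed
    hence w: "w > 0" "w\<^sup>2 = R\<^sup>2 - (x - m)\<^sup>2" by (simp_all add: w_def Q)
    have "- 1 < (x - m) / R" "(x - m) / R < 1" using x R by (auto simp: edges field_simps)
    hence "((\<lambda>x. arcsin ((x - m) / R)) has_real_derivative
             (1 / R) * inverse (sqrt (1 - ((x - m) / R)\<^sup>2))) (at x)"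
      using R by (auto intro!: derivative_eq_intros)
    also have "sqrt (1 - ((x - m) / R)\<^sup>2) = w / R"
    proof -
      have "1 - ((x - m) / R)\<^sup>2 = mp_quadratic l x / R\<^sup>2"
        using R(1) unfolding Q by (simp add: power_divide divide_simps)
      thus ?thesis using R(1) by (simp add: w_def real_sqrt_divide)
    qed
    also have "(1 / R) * inverse (w / R) = 1 / w" using R w by (simp add: field_simps)
    finally have arc: "((\<lambda>x. arcsin ((x - m) / R)) has_real_derivative 1 / w) (at x)" .
    have "((\<lambda>x. sqrt (mp_quadratic l x)) has_real_derivative (inverse w / 2) * (2 * (l + 1) - 2 * x)) (at x)"
      unfolding w_def by (rule DERIV_chain2[OF DERIV_real_sqrt[OF pos] mp_quadratic_deriv])
    from DERIV_mult[OF DERIV_diff[OF DERIV_ident DERIV_const[of m]] this]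
    have "((\<lambda>x. (x - m) * sqrt (mp_quadratic l x)) has_real_derivative
              w + (x - m) * ((2 * (l + 1) - 2 * x) * (inverse w / 2))) (at x)"
      by (simp add: w_def mult_ac)
    from DERIV_cdivide[OF DERIV_add[OF this DERIV_cmult[OF arc, of "R\<^sup>2"]], of 2]
    have "(F has_real_derivative
       (w + (x - m) * ((2 * (l + 1) - 2 * x) * (inverse w / 2)) + R\<^sup>2 * (1 / w)) / 2) (at x)"
      by (simp add: F_def)
    also have "(w + (x - m) * ((2 * (l + 1) - 2 * x) * (inverse w / 2)) + R\<^sup>2 * (1 / w)) / 2 = w"
    proof -
      have "(w + (x - m) * ((2 * (l + 1) - 2 * x) * (inverse w / 2)) + R\<^sup>2 * (1 / w)) / 2 =
              (w\<^sup>2 + (R\<^sup>2 - (x - m)\<^sup>2)) / (2 * w)"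
        using w(1) by (simp add: m_def field_simps power2_eq_square)
      also have "\<dots> = w" using w(1) unfolding w(2)[symmetric] by (simp add: power2_eq_square)
      finally show ?thesis .
    qed
    finally show "(F has_vector_derivative sqrt (mp_quadratic l x)) (at x)"
      by (simp add: has_real_derivative_iff_has_vector_derivative w_def)
  qed
  moreover have "F hi - F lo = 2 * pi * l"
    using R by (simp add: F_def Q edges arcsin_minus)
  ultimately show ?thesis
    unfolding mp_integral_def lo_def[symmetric] hi_def[symmetric] by (simp add: integral_unique)
qed

text \<open>The function x^k Q(x)^(3/2) vanishes at both edges; integrate its derivative.\<close>

lemma mp_integral_recurrence:
  assumes "l > 0"
  shows "real (k + 3) * mp_integral l (Suc k) = real (2 * k + 3) * (l + 1) * mp_integral l k -
           real k * (l - 1)\<^sup>2 * mp_integral l (k - 1)"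
proof -
  define lo hi where "lo = (sqrt l - 1)\<^sup>2" and "hi = (sqrt l + 1)\<^sup>2"
  define Q where "Q = mp_quadratic l"
  have Q: "Q x = (hi - x) * (x - lo)" for x
    using mp_quadratic_factor[of l x] assms by (simp add: Q_def lo_def hi_def)
  define F where "F = (\<lambda>x. x ^ k * (Q x * sqrt (Q x)))"
  define f where "f = (\<lambda>x. real k * x ^ (k - 1) * (Q x * sqrt (Q x)) + x ^ k * (3 / 2 * (2 * (l + 1) - 2 * x) * sqrt (Q x)))"
  have "(f has_integral (F hi - F lo)) {lo..hi}"
  proof (rule fundamental_theorem_of_calculus_interior)
    show "lo \<le> hi" using mp_edges(3)[OF assms] by (simp add: lo_def hi_def)
    show "continuous_on {lo..hi} F" unfolding F_def Q_def by (intro continuous_intros)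
    fix x assume "x \<in> {lo<..<hi}"
    hence pos: "Q x > 0" unfolding Q by simp
    define w where "w = sqrt (Q x)"
    have w: "w > 0" "w * w = Q x" using pos by (simp_all add: w_def)
    have dQ: "(Q has_real_derivative 2 * (l + 1) - 2 * x) (at x)"
      unfolding Q_def by (rule mp_quadratic_deriv)
    have dw: "((\<lambda>x. sqrt (Q x)) has_real_derivative (inverse w / 2) * (2 * (l + 1) - 2 * x)) (at x)"
      unfolding w_def by (rule DERIV_chain2[OF DERIV_real_sqrt[OF pos] dQ])
    have "(F has_real_derivative real k * x ^ (k - 1) * (Q x * w) +
         ((2 * (l + 1) - 2 * x) * w + (inverse w / 2) * (2 * (l + 1) - 2 * x) * Q x) * x ^ k) (at x)"
      unfolding F_def w_def
      using DERIV_mult[OF DERIV_pow[of k x] DERIV_mult[OF dQ dw]] by (simp add: w_def)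
    also have "(inverse w / 2) * (2 * (l + 1) - 2 * x) * Q x = w / 2 * (2 * (l + 1) - 2 * x)"
      using w(1) unfolding w(2)[symmetric] by simp
    finally show "(F has_vector_derivative f x) (at x)"
      unfolding has_real_derivative_iff_has_vector_derivative[symmetric]
      by (rule back_subst[of "\<lambda>d. (F has_real_derivative d) (at x)"])
         (simp add: f_def w_def[symmetric] algebra_simps)
  qed
  moreover have "F hi = 0" "F lo = 0" by (simp_all add: F_def Q)
  ultimately have zero: "(f has_integral 0) {lo..hi}" by simp
  define g where "g = (\<lambda>j x. x ^ j * sqrt (Q x))"
  have g: "(g j has_integral mp_integral l j) {lo..hi}" for j
    unfolding g_def Q_def mp_integral_def lo_def hi_def by (intro integrable_integral mp_integrable)
  have "f = (\<lambda>x. - real (k + 3) * g (Suc k) x + real (2 * k + 3) * (l + 1) * g k x -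
           real k * (l - 1)\<^sup>2 * g (k - 1) x)"
  proof
    fix x
    have 1: "real k * x ^ (k - 1) * x = real k * x ^ k" by (cases k) auto
    have "f x = (real k * x ^ (k - 1) * Q x + x ^ k * (3 * (l + 1) - 3 * x)) * sqrt (Q x)"
      by (simp add: f_def algebra_simps)
    also have "real k * x ^ (k - 1) * Q x =
        (real k * x ^ (k - 1) * x) * (2 * (l + 1) - x) - real k * (l - 1)\<^sup>2 * x ^ (k - 1)"
      by (simp add: Q_def mp_quadratic_def power2_eq_square algebra_simps)
    finally show "f x = - real (k + 3) * g (Suc k) x + real (2 * k + 3) * (l + 1) * g k x -
           real k * (l - 1)\<^sup>2 * g (k - 1) x"
      unfolding 1 g_def by (simp add: algebra_simps)
  qed
  hence "(f has_integral (- real (k + 3) * mp_integral l (Suc k) +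
     real (2 * k + 3) * (l + 1) * mp_integral l k - real k * (l - 1)\<^sup>2 * mp_integral l (k - 1))) {lo..hi}"
    by (simp only:) (intro has_integral_diff has_integral_add has_integral_mult_right g)
  from has_integral_unique[OF this zero] show ?thesis by (simp add: algebra_simps)
qed

text \<open>
  Solving the quadratic equation for A leads one to expect F^2 = D for F = 1 - (l + 1) X - 2 X A and
  D = (1 - (l + 1) X)^2 - 4 l X^2.  The recurrence says 2 D F' = D' F, so F^2 / D has derivative 0, and its
  constant coefficient is 1.
\<close>

theorem marchenko_pastur_moment_series:
  assumes "l \<ge> 1"
  defines "A \<equiv> moment_series (marchenko_pastur (1 / l))"
  shows "A = fps_X * (fps_const l + A) * (1 + A)" and "(A :: real fps) $ 1 = l"
proof -
  have l: "l > 0" using assms by simp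
  define c where "c k = mp_integral l k / (2 * pi)" for k
  have A: "A $ 0 = 0" "A $ Suc k = c k" for k
    unfolding A_def c_def marchenko_pastur_moment[OF assms(1), symmetric] by (simp_all add: moment_series_def)
  have c0: "c 0 = l" using mp_integral_0[OF l] by (simp add: c_def)
  thus "A $ 1 = l" using A(2)[of 0] by simp
  have rec: "real (k + 3) * c (Suc k) = real (2 * k + 3) * (l + 1) * c k - real k * (l - 1)\<^sup>2 * c (k - 1)" for k
  proof -
    have "real (k + 3) * c (Suc k) = (real (k + 3) * mp_integral l (Suc k)) / (2 * pi)"
      by (simp add: c_def)
    thus ?thesis unfolding mp_integral_recurrence[OF l] by (simp add: c_def diff_divide_distrib)
  qed
  define B where "B = 1 - fps_const (l + 1) * fps_X"
  define F where "F = B - 2 * fps_X * A"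
  define D where "D = 1 - fps_const (2 * (l + 1)) * fps_X + fps_const ((l - 1)\<^sup>2) * fps_X\<^sup>2"
  have F_nth: "F $ 0 = 1" "F $ Suc 0 = - (l + 1)" "F $ Suc (Suc k) = - 2 * c k" for k
    by (simp_all add: F_def B_def A mult.assoc numeral_fps_const)
  have ode: "2 * (D * fps_deriv F) = fps_deriv D * F"
  proof (rule fps_ext)
    fix n
    have "(2 * (D * fps_deriv F)) $ n = 2 * ((real n + 1) * F $ Suc n - 2 * (l + 1) * (fps_X * fps_deriv F) $ n
            + (l - 1)\<^sup>2 * (fps_X * (fps_X * fps_deriv F)) $ n)"
      by (simp add: D_def numeral_fps_const power2_eq_square algebra_simps)
    also have "\<dots> = 2 * ((real n + 1) * F $ Suc n - 2 * (l + 1) * (real n * F $ n)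
            + (l - 1)\<^sup>2 * (if n = 0 then 0 else (real n - 1) * F $ (n - 1)))"
    proof (cases n)
      case (Suc m)
      thus ?thesis by (cases m) simp_all
    qed simp
    also have "\<dots> = - 2 * (l + 1) * F $ n + 2 * (l - 1)\<^sup>2 * (if n = 0 then 0 else F $ (n - 1))"
    proof -
      consider "n = 0" | "n = 1" | "n = 2" | k where "n = Suc (Suc (Suc k))"
        by (metis One_nat_def Suc_1 not0_implies_Suc)
      thus ?thesis
      proof cases
        case 1 thus ?thesis by (simp add: F_nth)
      next
        case 2 thus ?thesis by (simp add: F_nth c0 power2_eq_square algebra_simps)
      next
        case 3 thus ?thesis using rec[of 0] by (simp add: F_nth eval_nat_numeral algebra_simps)
      next
        case 4 thus ?thesis using rec[of "Suc k"] by (simp add: F_nth algebra_simps)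
      qed
    qed
    also have "\<dots> = (fps_deriv D * F) $ n"
    proof -
      have "fps_deriv D * F = - (fps_const (2 * (l + 1)) * F) + fps_const (2 * (l - 1)\<^sup>2) * (fps_X * F)"
        by (simp add: D_def fps_deriv_power power2_eq_square algebra_simps flip: fps_const_mult numeral_fps_const)
      thus ?thesis by (simp only: fps_add_nth fps_neg_nth fps_mult_left_const_nth) (simp add: algebra_simps)
    qed
    finally show "(2 * (D * fps_deriv F)) $ n = (fps_deriv D * F) $ n" .
  qed
  have "D $ 0 = 1" by (simp add: D_def power2_eq_square)
  define K where "K = inverse D"
  have DK: "D * K = 1" unfolding K_def using \<open>D $ 0 = 1\<close> by (intro inverse_mult_eq_1') simp
  hence "fps_deriv (D * K) = 0" by simp
  hence dK: "D * fps_deriv K = - (fps_deriv D * K)" by (simp add: eq_neg_iff_add_eq_0 add.commute)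
  have "D * fps_deriv (F\<^sup>2 * K) = (2 * (D * fps_deriv F)) * F * K + F\<^sup>2 * (D * fps_deriv K)"
    by (simp add: power2_eq_square algebra_simps)
  also have "\<dots> = 0" unfolding ode dK by (simp add: power2_eq_square algebra_simps)
  finally have "fps_deriv (F\<^sup>2 * K) = 0" using \<open>D $ 0 = 1\<close> by auto
  hence "F\<^sup>2 * K = fps_const ((F\<^sup>2 * K) $ 0)" by (simp only: fps_deriv_eq_0_iff)
  also have "(F\<^sup>2 * K) $ 0 = 1" using \<open>D $ 0 = 1\<close> by (simp add: K_def F_nth power2_eq_square)
  finally have "D * K * F\<^sup>2 = D" by (simp add: mult_ac)
  hence FD: "F\<^sup>2 = D" by (simp add: DK)
  have DB: "D = B\<^sup>2 - 4 * fps_const l * fps_X\<^sup>2"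
    by (rule fps_ext) (auto simp: D_def B_def power2_eq_square numeral_fps_const algebra_simps)
  have "(4 * fps_X) * (A * B - fps_X * A\<^sup>2) = B\<^sup>2 - F\<^sup>2"
    by (simp add: F_def power2_eq_square algebra_simps)
  also have "\<dots> = (4 * fps_X) * (fps_const l * fps_X)"
    unfolding FD DB by (simp add: power2_eq_square algebra_simps)
  finally have "A * B - fps_X * A\<^sup>2 = fps_const l * fps_X" by simp
  hence "A = fps_X * (fps_const l + (fps_const (l + 1)) * A + A\<^sup>2)"
    by (simp add: B_def algebra_simps)
  also have "fps_const (l + 1) = fps_const l + (1 :: real fps)" by (simp flip: fps_const_add)
  finally show "A = fps_X * (fps_const l + A) * (1 + A)"
    by (simp add: power2_eq_square algebra_simps)
qed


section \<open>Zeros of the rescaled multiple Laguerre polynomials\<close>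

definition empirical_measure :: "'a multiset \<Rightarrow> 'a :: topological_space measure" where
  "empirical_measure A = distr (measure_pmf (pmf_of_multiset A)) borel (\<lambda>x. x)"

lemma sum_mset_image_count:
  "(\<Sum>x\<in>#A. f x :: real) = (\<Sum>x\<in>set_mset A. f x * real (count A x))"
proof (induction A)
  case (add y A)
  show ?case
  proof (cases "y \<in># A")
    case True
    have "(\<Sum>x\<in>set_mset (add_mset y A). f x * real (count (add_mset y A) x)) =
            (\<Sum>x\<in>set_mset A. f x * real (count A x) + (if x = y then f y else 0))"
      using True by (intro sum.cong) (auto simp: algebra_simps)
    also have "\<dots> = (\<Sum>x\<in>#A. f x) + f y"
      using True by (simp add: sum.distrib add.IH)
    finally show ?thesis by simp
  next
    case False
    hence "(\<Sum>x\<in>set_mset A. f x * real (count (add_mset y A) x)) = (\<Sum>x\<in>set_mset A. f x * real (count A x))"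
      by (intro sum.cong) auto
    thus ?thesis using False by (simp add: add.IH not_in_iff)
  qed
qed simp

lemma integral_empirical_measure:
  assumes "A \<noteq> {#}" "f \<in> borel_measurable borel"
  shows "(LINT x|empirical_measure A. f x :: real) = (\<Sum>x\<in>#A. f x) / real (size A)"
proof -
  have "(LINT x|empirical_measure A. f x) = (LINT x|measure_pmf (pmf_of_multiset A). f x)"
    unfolding empirical_measure_def using assms(2) by (subst integral_distr) auto
  also have "\<dots> = (\<Sum>x\<in>set_mset A. f x * pmf (pmf_of_multiset A) x)"
    using assms(1) by (intro integral_measure_pmf_real) auto
  finally show ?thesis
    using assms(1) by (simp add: sum_mset_image_count sum_divide_distrib)
qed

lemma real_distribution_empirical_measure:
  fixes A :: "real multiset"
  shows "real_distribution (empirical_measure A)"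
  unfolding empirical_measure_def
  by (intro real_distribution.intro prob_space.prob_space_distr real_distribution_axioms.intro
        prob_space_measure_pmf) auto

lemma AE_empirical_measure:
  assumes "A \<noteq> {#}" "\<And>x. x \<in># A \<Longrightarrow> P x" "{x. P x} \<in> sets borel"
  shows "AE x in empirical_measure A. P x"
  unfolding empirical_measure_def using assms
  by (subst AE_distr_iff) (auto simp: AE_measure_pmf_iff)

lemma proots_linear_factors: "proots (\<Prod>y\<in>#R. [:- y, 1:] :: 'a :: idom poly) = R"
proof (induction R)
  case (add y R)
  have "(\<Prod>y\<in>#R. [:- y, 1:] :: 'a poly) \<noteq> 0" using linear_factors_monic[of R] by auto
  thus ?case using add by (simp add: proots_mult del: mult_pCons_left)
qed simp

lemma zero_distribution_linear_factors:
  "zero_distribution (\<Prod>y\<in>#R. [:- y, 1:]) = empirical_measure (image_mset complex_of_real R)"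
proof -
  have "map_poly complex_of_real (\<Prod>y\<in>#R. [:- y, 1:]) =
          (\<Prod>z\<in>#image_mset complex_of_real R. [:- z, 1:])"
    unfolding map_poly_linear_factors by (simp add: multiset.map_comp comp_def)
  thus ?thesis unfolding zero_distribution_def empirical_measure_def
    by (simp only: proots_linear_factors)
qed

lemma prod_mset_sum_replicate:
  assumes "finite I"
  shows "(\<Prod>c\<in>#(\<Sum>i\<in>I. replicate_mset (m i) (c i)). f c) = (\<Prod>i\<in>I. f (c i) ^ m i)"
  using assms by (induction I rule: finite_induct) (auto simp: image_replicate_mset)

text \<open>
  With \<theta> = N a0 / 2 the condition 2 \<theta> c \<le> 1 holds for all c = 1 / (N a_i), and the bound on the zeros is
  (N (1 + \<alpha>) + N) / \<theta>, in which N cancels.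
\<close>

theorem multiple_laguerre2_rescaled:
  fixes a :: "nat \<Rightarrow> real" and N r :: nat and K :: real
  assumes "N > 0" "\<alpha> \<ge> 0" "\<And>i. i \<in> {1..r} \<Longrightarrow> a i \<ge> a0" "a0 > 0" "inj_on a {1..r}"
    and m: "(\<Sum>i\<in>{1..r}. m i) = N"
  defines "P \<equiv> falling_fps (real N * (1 + \<alpha>)) (linear_power_fps {1..r} (\<lambda>i. (1 / a i) / real N) m)"
  shows "\<exists>R. multiple_laguerre2 r (real N * \<alpha>) (\<lambda>j. real N * a j) m = (\<Prod>y\<in>#R. [:- y, 1:]) \<and>
           size R = N \<and> (\<forall>y\<in>#R. y \<in> {0..2 * (2 + \<alpha>) / a0}) \<and>
           - fps_X * fps_deriv P = P * power_sum_fps R"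
proof -
  define s where "s = real N * (1 + \<alpha>)"
  define c where "c = (\<lambda>i. (1 / a i) / real N)"
  define C where "C = (\<Sum>i\<in>{1..r}. replicate_mset (m i) (c i))"
  define A where "A = (\<Prod>i\<in>{1..r}. [:- c i, 1:] ^ m i)"
  have pos: "a i > 0" if "i \<in> {1..r}" for i using assms(3)[OF that] assms(4) by simp
  have "inj_on (\<lambda>j. real N * a j) {1..r}"
  proof (rule inj_onI)
    fix i j assume ij: "i \<in> {1..r}" "j \<in> {1..r}" and "real N * a i = real N * a j"
    hence "a i = a j" using assms(1) by simp
    thus "i = j" using inj_onD[OF assms(5)] ij by blast
  qed
  hence "multiple_laguerre2 r (real N * \<alpha>) (\<lambda>j. real N * a j) m =
      laguerre_transform (real N * \<alpha> + real (\<Sum>j\<in>{1..r}. m j)) (\<Prod>j\<in>{1..r}. [:- (1 / (real N * a j)), 1:] ^ m j)"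
    using assms(1,2) pos by (intro multiple_laguerre2_eq) auto
  hence eq: "multiple_laguerre2 r (real N * \<alpha>) (\<lambda>j. real N * a j) m = laguerre_transform s A"
    unfolding m s_def A_def c_def by (simp add: algebra_simps)
  have A_eq: "A = (\<Prod>c\<in>#C. [:- c, 1:])"
    unfolding A_def C_def by (rule prod_mset_sum_replicate[symmetric]) simp
  have sizeC: "size C = N" unfolding C_def using m by simp
  define \<theta> where "\<theta> = real N * a0 / 2"
  have "\<exists>R. laguerre_transform s (\<Prod>c\<in>#C. [:- c, 1:]) = (\<Prod>y\<in>#R. [:- y, 1:]) \<and>
           (\<forall>y\<in>#R. 0 \<le> y \<and> y < (s + real (size C)) / \<theta>) \<and>
           (s - real (size C)) / ((s + real (size C)) / \<theta>) +
             (\<Sum>y\<in>#R. 1 / ((s + real (size C)) / \<theta> - y)) \<le> \<theta>"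
  proof (rule laguerre_transform_roots)
    show "\<theta> > 0" using assms by (simp add: \<theta>_def)
    show "s > 0" unfolding s_def using assms(1,2) by (intro mult_pos_pos) auto
    show "real (size C) \<le> s" using assms(2) by (simp add: s_def sizeC algebra_simps)
    fix x assume "x \<in># C"
    then obtain i where i: "i \<in> {1..r}" "x = c i" by (auto simp: C_def set_mset_sum split: if_splits)
    have "a0 \<le> a i" using assms(3)[OF i(1)] .
    thus "0 < x \<and> 2 * \<theta> * x \<le> 1" using assms(1) pos[OF i(1)] by (simp add: i \<theta>_def c_def)
  qed
  then obtain R where R: "laguerre_transform s A = (\<Prod>y\<in>#R. [:- y, 1:])"
    "\<And>y. y \<in># R \<Longrightarrow> 0 \<le> y \<and> y < (s + real N) / \<theta>"
    unfolding A_eq sizeC by blast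
  have "(s + real N) / \<theta> = 2 * (2 + \<alpha>) / a0"
    using assms(1,4) by (simp add: s_def \<theta>_def field_simps)
  hence bound: "\<forall>y\<in>#R. y \<in> {0..2 * (2 + \<alpha>) / a0}" using R(2) by fastforce
  have "size R = degree (laguerre_transform s A)"
    unfolding R(1) using linear_factors_monic[of R] by simp
  also have "\<dots> = N"
    unfolding degree_laguerre_transform A_def
    using linear_powers_monic[of "{1..r}" c m] m by simp
  finally have "size R = N" .
  have "P = falling_fps s (fps_of_poly (reflect_poly A))"
    unfolding P_def s_def A_def linear_power_fps_def c_def
    by (simp only: reflect_poly_prod reflect_poly_power fps_of_poly_prod fps_of_poly_power
          fps_reflect_linear_factor)
  also have "\<dots> = (\<Prod>y\<in>#R. 1 - fps_const y * fps_X)"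
    unfolding fps_reflect_laguerre_transform[symmetric] R(1) fps_reflect_linear_factors ..
  finally have "- fps_X * fps_deriv P = P * power_sum_fps R" by (simp only: newton_identity)
  thus ?thesis using R(1) \<open>size R = N\<close> bound unfolding eq by (intro exI[of _ R] conjI)
qed

lemma path_like_eventually_pos:
  assumes "path_like r n q"
  obtains N0 where "\<And>N i. N \<ge> N0 \<Longrightarrow> i \<in> {1..r} \<Longrightarrow> n N i > 0"
proof -
  obtain R where R: "\<And>N i. i \<in> {1..r} \<Longrightarrow> n (N + R) i \<ge> n N i + 1"
    using assms unfolding path_like_def by blast
  have "n N i > 0" if "N \<ge> R" "i \<in> {1..r}" for N i
    using R[OF that(2), of "N - R"] that(1) by simp
  thus ?thesis using that by blast
qed

lemma path_like_sum_proportions: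
  assumes "path_like r n q"
  shows "(\<Sum>i\<in>{1..r}. q i) = 1"
proof -
  have "(\<lambda>N. \<Sum>i\<in>{1..r}. real (n N i) / real N) \<longlonglongrightarrow> (\<Sum>i\<in>{1..r}. q i)"
    using assms unfolding path_like_def by (intro tendsto_sum) blast
  moreover have "eventually (\<lambda>N. (\<Sum>i\<in>{1..r}. real (n N i) / real N) = 1) sequentially"
    using eventually_gt_at_top[of 0]
  proof eventually_elim
    case (elim N)
    have "(\<Sum>i\<in>{1..r}. n N i) = N" using assms unfolding path_like_def by blast
    hence "(\<Sum>i\<in>{1..r}. real (n N i)) = real N" by (simp flip: of_nat_sum)
    thus ?case using elim by (simp flip: sum_divide_distrib)
  qed
  hence "(\<lambda>N. \<Sum>i\<in>{1..r}. real (n N i) / real N) \<longlonglongrightarrow> 1"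
    by (simp add: tendsto_eventually)
  ultimately show ?thesis by (rule LIMSEQ_unique)
qed

text \<open>
  The limit of the moment series is identified before the limit measure is constructed: the moments of
  the zeros are the coefficients of M_N, the bound on the zeros is uniform in N, and so the convergence
  of moments provides the measure.
\<close>

theorem rescaled_laguerre_zeros_converge:
  fixes r :: nat and a q :: "nat \<Rightarrow> real" and \<alpha> :: real and n :: "nat \<Rightarrow> nat \<Rightarrow> nat"
  assumes "r \<ge> 1" "\<And>i. i \<in> {1..r} \<Longrightarrow> a i > 0" "inj_on a {1..r}" "\<alpha> \<ge> 0" "path_like r n q"
  shows "\<exists>M K. real_distribution M \<and> (AE x in M. x \<in> {0..K}) \<and>
           moment_series M = (\<Sum>i\<in>{1..r}. fps_const (q i) *
             (fps_const (1 / a i) * fps_X * (fps_const (1 + \<alpha>) + moment_series M) *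
               inverse (1 - fps_const (1 / a i) * fps_X * (fps_const (1 + \<alpha>) + moment_series M)))) \<and>
           weakly_converges_to
             (\<lambda>N. zero_distribution
                (multiple_laguerre2 r (real N * \<alpha>) (\<lambda>j. real N * a j) (n N)))
             (distr M borel complex_of_real)"
proof -
  define l where "l = 1 + \<alpha>"
  define a0 where "a0 = Min (a ` {1..r})"
  have a0: "a0 > 0" "\<And>i. i \<in> {1..r} \<Longrightarrow> a i \<ge> a0"
    using assms(1,2) by (auto simp: a0_def)
  define K where "K = 2 * (2 + \<alpha>) / a0"
  have "K \<ge> 0" using a0 assms(4) by (simp add: K_def)
  define p where "p = (\<lambda>N. multiple_laguerre2 r (real N * \<alpha>) (\<lambda>j. real N * a j) (n N))"
  define P where "P = (\<lambda>N. falling_fps (real N * l) (linear_power_fps {1..r} (\<lambda>i. (1 / a i) / real N) (n N)))"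
  have "\<forall>N. \<exists>R. N > 0 \<longrightarrow> p N = (\<Prod>y\<in>#R. [:- y, 1:]) \<and> size R = N \<and> (\<forall>y\<in>#R. y \<in> {0..K}) \<and>
           - fps_X * fps_deriv (P N) = P N * power_sum_fps R"
  proof
    fix N
    have "(\<Sum>i\<in>{1..r}. n N i) = N" using assms(5) unfolding path_like_def by blast
    with multiple_laguerre2_rescaled[OF _ assms(4) a0(2,1) assms(3) this]
    show "\<exists>R. N > 0 \<longrightarrow> p N = (\<Prod>y\<in>#R. [:- y, 1:]) \<and> size R = N \<and> (\<forall>y\<in>#R. y \<in> {0..K}) \<and>
           - fps_X * fps_deriv (P N) = P N * power_sum_fps R"
      unfolding p_def P_def K_def l_def by blast
  qed
  from choice[OF this] obtain R where R: "\<And>N. N > 0 \<Longrightarrow> p N = (\<Prod>y\<in>#R N. [:- y, 1:])"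
    "\<And>N. N > 0 \<Longrightarrow> size (R N) = N" "\<And>N y. N > 0 \<Longrightarrow> y \<in># R N \<Longrightarrow> y \<in> {0..K}"
    "\<And>N. N > 0 \<Longrightarrow> - fps_X * fps_deriv (P N) = P N * power_sum_fps (R N)"
    by blast
  obtain N0 where N0: "\<And>N i. N \<ge> N0 \<Longrightarrow> i \<in> {1..r} \<Longrightarrow> n N i > 0"
    using path_like_eventually_pos[OF assms(5)] by blast
  \<comment> \<open>Beyond this shift every multiplicity is positive, so that a factor of each index can be split off.\<close>
  define s where "s = (\<lambda>N. N + Suc N0)"
  have s: "s N > 0" "s N \<ge> N0" for N by (auto simp: s_def)
  have sR: "size (R (s N)) = s N" "R (s N) \<noteq> {#}" for N
    using R(2)[OF s(1)[of N]] s(1)[of N] by auto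
  define M where "M = (\<lambda>N. fps_const (1 / real (s N)) * power_sum_fps (R (s N)))"
  have "\<forall>N. \<exists>Q. M N = fps_const l * fps_X * (\<Sum>i\<in>{1..r}. fps_const (real (n (s N) i) / real (s N) * (1 / a i)) * Q i) \<and>
     (\<forall>i\<in>{1..r}. fps_const l + M N = fps_const l * (Q i - fps_const (1 / a i) * fps_X *
         ((fps_const (l - 1 / real (s N)) + M N) * Q i - fps_const (1 / real (s N)) * (fps_X * fps_deriv (Q i)))))"
  proof
    fix N
    have "power_sum_fps (R (s N)) = fps_const (real (s N)) * M N"
      using s(1)[of N] unfolding M_def mult.assoc[symmetric] by simp
    hence "- fps_X * fps_deriv (P (s N)) = P (s N) * (fps_const (real (s N)) * M N)"
      using R(4)[OF s(1)[of N]] by metis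
    hence system: "- fps_X * fps_deriv (falling_fps (real (s N) * l)
             (linear_power_fps {1..r} (\<lambda>i. (1 / a i) / real (s N)) (n (s N)))) =
           falling_fps (real (s N) * l)
             (linear_power_fps {1..r} (\<lambda>i. (1 / a i) / real (s N)) (n (s N))) *
           (fps_const (real (s N)) * M N)"
      unfolding P_def .
    show "\<exists>Q. M N = fps_const l * fps_X * (\<Sum>i\<in>{1..r}. fps_const (real (n (s N) i) / real (s N) * (1 / a i)) * Q i) \<and>
     (\<forall>i\<in>{1..r}. fps_const l + M N = fps_const l * (Q i - fps_const (1 / a i) * fps_X *
         ((fps_const (l - 1 / real (s N)) + M N) * Q i - fps_const (1 / real (s N)) * (fps_X * fps_deriv (Q i)))))"
      by (rule laguerre_moment_system[where I = "{1..r}" and N = "s N" and n = "n (s N)" and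
              u = "\<lambda>i. 1 / a i" and lam = l and M = "M N", OF _ s(1) N0[OF s(2)] system]; blast)
  qed
  from choice[OF this] obtain Q where
    Q1: "\<And>N. M N = fps_const l * fps_X * (\<Sum>i\<in>{1..r}. fps_const (real (n (s N) i) / real (s N) * (1 / a i)) * Q N i)" and
    Q2: "\<And>N i. i \<in> {1..r} \<Longrightarrow> fps_const l + M N = fps_const l * (Q N i - fps_const (1 / a i) * fps_X *
         ((fps_const (l - 1 / real (s N)) + M N) * Q N i - fps_const (1 / real (s N)) * (fps_X * fps_deriv (Q N i))))"
    by blast
  have "l > 0" using assms(4) by (simp add: l_def)
  moreover have "(\<lambda>N. real (n (s N) i) / real (s N)) \<longlonglongrightarrow> q i" if "i \<in> {1..r}" for i
  proof -
    have "(\<lambda>N. real (n N i) / real N) \<longlonglongrightarrow> q i" using assms(5) that unfolding path_like_def by blast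
    thus ?thesis unfolding s_def by (rule LIMSEQ_ignore_initial_segment)
  qed
  moreover have "(\<lambda>N. 1 / real (s N)) \<longlonglongrightarrow> 0"
    unfolding s_def by (rule LIMSEQ_ignore_initial_segment[OF lim_1_over_n])
  ultimately have "\<exists>L. coeffwise_tendsto M L \<and> L = (\<Sum>i\<in>{1..r}. fps_const (q i) *
           (fps_const (1 / a i) * fps_X * (fps_const l + L) *
              inverse (1 - fps_const (1 / a i) * fps_X * (fps_const l + L))))"
    by (rule laguerre_system_converges[where Q = "\<lambda>i N. Q N i" and M = M and lam = l and q = q
          and I = "{1..r}" and u = "\<lambda>i. 1 / a i" and d = "\<lambda>N. 1 / real (s N)"
          and p = "\<lambda>i N. real (n (s N) i) / real (s N)", OF _ _ _ Q1 Q2])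
  then obtain L where limM: "coeffwise_tendsto M L" and L: "L = (\<Sum>i\<in>{1..r}. fps_const (q i) *
           (fps_const (1 / a i) * fps_X * (fps_const l + L) *
              inverse (1 - fps_const (1 / a i) * fps_X * (fps_const l + L))))"
    by blast
  define \<mu> where "\<mu> = (\<lambda>N. empirical_measure (R (s N)))"
  have \<mu>: "real_distribution (\<mu> N)" "AE x in \<mu> N. x \<in> {0..K}" for N
    unfolding \<mu>_def
    by (rule real_distribution_empirical_measure)
       (intro AE_empirical_measure sR R(3)[OF s(1)[of N]]; simp)
  have moments: "(\<lambda>N. LINT x|\<mu> N. x ^ k) \<longlonglongrightarrow> (if k = 0 then 1 else L $ k)" for k
  proof -
    have "(LINT x|\<mu> N. x ^ k) = (if k = 0 then 1 else M N $ k)" for N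
    proof -
      have "(LINT x|\<mu> N. x ^ k) = (\<Sum>x\<in>#R (s N). x ^ k) / real (s N)"
        unfolding \<mu>_def using sR by (subst integral_empirical_measure) auto
      thus ?thesis using sR(1)[of N] s(1)[of N] by (simp add: M_def power_sum_fps_def)
    qed
    thus ?thesis using limM unfolding coeffwise_tendsto_def by (cases "k = 0") simp_all
  qed
  from moment_convergence_imp_weak_convergence[OF \<mu> \<open>K \<ge> 0\<close> moments]
  obtain \<nu> where \<nu>: "real_distribution \<nu>" "weak_conv_m \<mu> \<nu>" "AE x in \<nu>. x \<in> {0..K}"
    "\<And>k. (LINT x|\<nu>. x ^ k) = (if k = 0 then 1 else L $ k)"
    by blast
  have "L $ 0 = 0" by (subst L) (simp add: fps_sum_nth)
  hence series: "moment_series \<nu> = L"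
    by (intro fps_ext) (simp add: moment_series_def \<nu>(4))
  have "weakly_converges_to (\<lambda>N. zero_distribution (p N)) (distr \<nu> borel complex_of_real)"
    unfolding weakly_converges_to_def
  proof (intro allI impI, elim conjE)
    fix f :: "complex \<Rightarrow> real"
    assume f: "continuous_on UNIV f" "bounded (range f)"
    then obtain B where B: "\<And>z. norm (f z) \<le> B" unfolding bounded_iff by auto
    have meas: "f \<in> borel_measurable borel" by (rule borel_measurable_continuous_onI) fact
    interpret \<nu>: real_distribution \<nu> by fact
    have "continuous_on UNIV (\<lambda>x. f (complex_of_real x))"
      by (intro continuous_on_compose2[OF f(1)] continuous_intros) auto
    hence cont: "isCont (\<lambda>x. f (complex_of_real x)) x" for x
      by (simp add: continuous_on_eq_continuous_at)
    have "(\<lambda>N. LINT x|\<mu> N. f (complex_of_real x)) \<longlonglongrightarrow> (LINT x|\<nu>. f (complex_of_real x))"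
      by (rule weak_conv_imp_integral_bdd_continuous_conv[OF \<mu>(1) \<nu>(1,2) cont B])
    also have "(\<lambda>N. LINT x|\<mu> N. f (complex_of_real x)) = (\<lambda>N. LINT z|zero_distribution (p (s N)). f z)"
    proof
      fix N
      have "(LINT z|zero_distribution (p (s N)). f z) =
              (\<Sum>z\<in>#image_mset complex_of_real (R (s N)). f z) / real (size (R (s N)))"
        unfolding R(1)[OF s(1)] zero_distribution_linear_factors
        using sR(2)[of N] meas by (subst integral_empirical_measure) auto
      also have "\<dots> = (LINT x|\<mu> N. f (complex_of_real x))"
        unfolding \<mu>_def using sR(2)[of N] meas
        by (subst integral_empirical_measure) (auto simp: multiset.map_comp comp_def)
      finally show "(LINT x|\<mu> N. f (complex_of_real x)) = (LINT z|zero_distribution (p (s N)). f z)" ..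
    qed
    also have "(LINT x|\<nu>. f (complex_of_real x)) = (LINT z|distr \<nu> borel complex_of_real. f z)"
      using meas by (subst integral_distr) auto
    finally have "(\<lambda>N. LINT z|zero_distribution (p (s N)). f z) \<longlonglongrightarrow> (LINT z|distr \<nu> borel complex_of_real. f z)" .
    thus "(\<lambda>N. LINT z|zero_distribution (p N). f z) \<longlonglongrightarrow> (LINT z|distr \<nu> borel complex_of_real. f z)"
      unfolding s_def by (rule LIMSEQ_offset)
  qed
  thus ?thesis
    using \<nu>(1,3) L unfolding p_def l_def series[symmetric] by blast
qed


section \<open>The Cauchy-Stieltjes transform of the limit\<close>

text \<open>
  The complement is the union, over the real points x outside K, of both open half planes joined
  at x; all these connected sets contain the imaginary unit.
\<close>

lemma open_connected_complement_of_real_compact: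
  assumes "compact (K :: real set)"
  shows "open (- complex_of_real ` K)" and "connected (- complex_of_real ` K)"
proof -
  have "compact (complex_of_real ` K)"
    using assms by (intro compact_continuous_image continuous_intros)
  thus "open (- complex_of_real ` K)" by (simp add: compact_imp_closed open_Compl)
  define T where "T x = ({z. Im z > 0} \<union> {complex_of_real x}) \<union> ({z. Im z < 0} \<union> {complex_of_real x})" for x
  have conn: "connected (T x)" for x
  proof -
    have up: "connected ({z. Im z > 0} \<union> {complex_of_real x})"
    proof (rule connected_intermediate_closure)
      show "connected {z. Im z > 0}" by (intro convex_connected convex_halfspace_Im_gt)
      have "\<exists>y\<in>{z. Im z > 0}. dist y (of_real x) < e" if "e > 0" for e
        using that by (intro bexI[of _ "Complex x (e / 2)"]) (auto simp: dist_norm cmod_def)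
      hence "complex_of_real x \<in> closure {z. Im z > 0}" unfolding closure_approachable by blast
      thus "{z. Im z > 0} \<union> {complex_of_real x} \<subseteq> closure {z. Im z > 0}"
        using closure_subset[of "{z. Im z > 0}"] by blast
    qed auto
    have down: "connected ({z. Im z < 0} \<union> {complex_of_real x})"
    proof (rule connected_intermediate_closure)
      show "connected {z. Im z < 0}" by (intro convex_connected convex_halfspace_Im_lt)
      have "\<exists>y\<in>{z. Im z < 0}. dist y (of_real x) < e" if "e > 0" for e
        using that by (intro bexI[of _ "Complex x (- e / 2)"]) (auto simp: dist_norm cmod_def)
      hence "complex_of_real x \<in> closure {z. Im z < 0}" unfolding closure_approachable by blast
      thus "{z. Im z < 0} \<union> {complex_of_real x} \<subseteq> closure {z. Im z < 0}"
        using closure_subset[of "{z. Im z < 0}"] by blast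
    qed auto
    show ?thesis unfolding T_def by (rule connected_Un[OF up down]) auto
  qed
  have "K \<noteq> UNIV" using assms compact_imp_bounded not_bounded_UNIV by auto
  then obtain x0 where x0: "x0 \<notin> K" by blast
  have "connected (\<Union>(T ` (- K)))"
  proof (rule connected_Union)
    show "\<Inter>(T ` (- K)) \<noteq> {}"
    proof -
      have "\<i> \<in> \<Inter>(T ` (- K))" by (auto simp: T_def)
      thus ?thesis by blast
    qed
  qed (use conn in auto)
  also have "\<Union>(T ` (- K)) = - complex_of_real ` K"
  proof (intro equalityI subsetI)
    fix z assume "z \<in> \<Union>(T ` (- K))"
    thus "z \<in> - complex_of_real ` K" by (auto simp: T_def)
  next
    fix z assume z: "z \<in> - complex_of_real ` K"
    show "z \<in> \<Union>(T ` (- K))"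
    proof (cases "Im z = 0")
      case True
      hence "z = of_real (Re z)" by (simp add: complex_eq_iff)
      moreover from this have "Re z \<notin> K" using z by auto
      ultimately have "z \<in> T (Re z)" "Re z \<in> - K" by (auto simp: T_def)
      thus ?thesis by blast
    next
      case False
      hence "z \<in> T x0" by (auto simp: T_def)
      thus ?thesis using x0 by blast
    qed
  qed
  finally show "connected (- complex_of_real ` K)" .
qed

text \<open>
  Differentiation under the integral.  The difference quotient of 1 / (z - x) at z0 differs from
  - 1 / (z0 - x)^2 by (z - z0) / ((z - x) (z0 - x)^2), which is bounded uniformly in x by a multiple of
  the distance of z to z0 as long as both stay away from the support.
\<close>

lemma cauchy_stieltjes_holomorphic:
  assumes "real_distribution \<mu>"
  shows "cauchy_stieltjes \<mu> holomorphic_on - complex_of_real ` measure_support \<mu>"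
proof -
  interpret real_distribution \<mu> by fact
  define S where "S = - complex_of_real ` measure_support \<mu>"
  have supp: "AE x in \<mu>. x \<in> measure_support \<mu>" by (rule AE_measure_support) simp
  have "closed (complex_of_real ` measure_support \<mu>)"
    by (intro closed_injective_linear_image[OF closed_measure_support])
       (auto simp: linear_of_real inj_on_def)
  hence "open S" by (simp add: S_def open_Compl)
  have "\<exists>D. (cauchy_stieltjes \<mu> has_field_derivative D) (at z0)" if z0: "z0 \<in> S" for z0
  proof -
    obtain e where e: "e > 0" "ball z0 e \<subseteq> S"
      using \<open>open S\<close> z0 open_contains_ball by blast
    define d where "d = e / 2"
    have d: "d > 0" using e by (simp add: d_def)
    have far: "d \<le> norm (z - of_real x)" if "x \<in> measure_support \<mu>" "z \<in> ball z0 d" for x z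
    proof (rule ccontr)
      assume "\<not> d \<le> norm (z - of_real x)"
      hence "dist z0 (of_real x) < d + d"
        using that(2) dist_triangle[of z0 "of_real x" z] by (simp add: dist_norm norm_minus_commute)
      hence "complex_of_real x \<in> S" using e by (auto simp: d_def)
      thus False using that(1) by (simp add: S_def)
    qed
    have z0_ball: "z0 \<in> ball z0 d" using d by simp
    have int1: "integrable \<mu> (\<lambda>x. 1 / (z - of_real x))" if "z \<in> ball z0 d" for z
    proof (rule integrable_const_bound)
      show "AE x in \<mu>. norm (1 / (z - of_real x)) \<le> 1 / d"
        using supp
      proof eventually_elim
        case (elim x)
        thus ?case using far[OF elim that] d by (simp add: norm_divide frac_le)
      qed
    qed measurable
    have int2: "integrable \<mu> (\<lambda>x. 1 / (z0 - of_real x)\<^sup>2)"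
    proof (rule integrable_const_bound)
      show "AE x in \<mu>. norm (1 / (z0 - of_real x)\<^sup>2) \<le> 1 / d\<^sup>2"
        using supp
      proof eventually_elim
        case (elim x)
        thus ?case using far[OF elim z0_ball] d
          by (simp add: norm_divide norm_power frac_le power_mono)
      qed
    qed measurable
    define D where "D = - (CLINT x|\<mu>. 1 / (z0 - of_real x)\<^sup>2)"
    define G where "G = cauchy_stieltjes \<mu>"
    have bound: "norm ((G z - G z0) / (z - z0) - D) \<le> norm (z - z0) / d ^ 3"
      if z: "z \<in> ball z0 d" "z \<noteq> z0" for z
    proof -
      have diff1: "integrable \<mu> (\<lambda>x. 1 / (z - of_real x) - 1 / (z0 - of_real x))"
        by (rule Bochner_Integration.integrable_diff[OF int1[OF z(1)] int1[OF z0_ball]])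
      have diff2: "integrable \<mu> (\<lambda>x. (1 / (z - of_real x) - 1 / (z0 - of_real x)) / (z - z0))"
        by (rule integrable_divide_zero) (rule diff1)
      have diff3: "integrable \<mu> (\<lambda>x. (1 / (z - of_real x) - 1 / (z0 - of_real x)) / (z - z0) + 1 / (z0 - of_real x)\<^sup>2)"
        by (rule Bochner_Integration.integrable_add[OF diff2 int2])
      have eq: "(G z - G z0) / (z - z0) - D =
              (CLINT x|\<mu>. (1 / (z - of_real x) - 1 / (z0 - of_real x)) / (z - z0) + 1 / (z0 - of_real x)\<^sup>2)"
        unfolding G_def cauchy_stieltjes_def D_def
        using int1[OF z(1)] int1[OF z0_ball] int2 by simp
      have "norm ((G z - G z0) / (z - z0) - D) \<le> (LINT x|\<mu>. norm ((1 / (z - of_real x) - 1 / (z0 - of_real x)) / (z - z0) + 1 / (z0 - of_real x)\<^sup>2))"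
        unfolding eq by (rule integral_norm_bound)
      also have "\<dots> \<le> (LINT x|\<mu>. norm (z - z0) / d ^ 3)"
      proof (rule integral_mono_AE)
        show "integrable \<mu> (\<lambda>x. norm ((1 / (z - of_real x) - 1 / (z0 - of_real x)) / (z - z0) + 1 / (z0 - of_real x)\<^sup>2))"
          by (rule integrable_norm[OF diff3])
        show "AE x in \<mu>. norm ((1 / (z - of_real x) - 1 / (z0 - of_real x)) / (z - z0) + 1 / (z0 - of_real x)\<^sup>2)
                \<le> norm (z - z0) / d ^ 3"
          using supp
        proof eventually_elim
          case (elim x)
          define A B where "A = z - complex_of_real x" and "B = z0 - complex_of_real x"
          have AB: "d \<le> norm A" "d \<le> norm B"
            using far[OF elim z(1)] far[OF elim z0_ball] by (simp_all add: A_def B_def)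
          hence nz: "A \<noteq> 0" "B \<noteq> 0" "A - B \<noteq> 0" and zz: "z - z0 = A - B"
            using d z(2) by (auto simp: A_def B_def)
          have "(1 / A - 1 / B) / (A - B) + 1 / B\<^sup>2 = (A - B) / (A * B\<^sup>2)"
            using nz by (simp add: divide_simps power2_eq_square) (simp add: algebra_simps)
          moreover have "d ^ 3 \<le> norm A * (norm B)\<^sup>2"
            using AB d by (simp add: power3_eq_cube power2_eq_square mult_mono mult.assoc)
          ultimately show ?case unfolding zz A_def[symmetric] B_def[symmetric]
            using d by (simp add: norm_divide norm_mult norm_power frac_le)
        qed
      qed simp
      also have "\<dots> = norm (z - z0) / d ^ 3" using prob_space by simp
      finally show ?thesis .
    qed
    have "((\<lambda>z. (G z - G z0) / (z - z0) - D) \<longlongrightarrow> 0) (at z0)"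
    proof (rule Lim_null_comparison)
      show "eventually (\<lambda>z. norm ((G z - G z0) / (z - z0) - D) \<le> norm (z - z0) / d ^ 3) (at z0)"
        unfolding eventually_at using d bound
        by (intro exI[of _ d]) (auto simp: dist_commute)
      have "((\<lambda>z. norm (z - z0) / d ^ 3) \<longlongrightarrow> norm (z0 - z0) / d ^ 3) (at z0)"
        using d by (intro tendsto_intros) auto
      thus "((\<lambda>z. norm (z - z0) / d ^ 3) \<longlongrightarrow> 0) (at z0)" by simp
    qed
    hence "((\<lambda>z. (G z - G z0) / (z - z0)) \<longlongrightarrow> D) (at z0)" by (rule LIM_zero_cancel)
    thus ?thesis unfolding G_def has_field_derivative_iff by blast
  qed
  thus ?thesis unfolding S_def[symmetric] by (meson \<open>open S\<close> holomorphic_on_open)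
qed

text \<open>
  The function is z G(z) at z = 1 / t.  For \<bar>t\<bar> B \<le> 1 / 2 the geometric series converges uniformly on the
  support and may be integrated term by term.
\<close>

lemma moment_generating_expansion:
  assumes "real_distribution \<mu>" "AE x in \<mu>. x \<in> {0..C}"
  shows "(\<lambda>t. LINT x|\<mu>. 1 / (1 - t * x)) has_fps_expansion (1 + moment_series \<mu>)"
proof (rule has_fps_expansionI)
  interpret real_distribution \<mu> by fact
  define B where "B = max C 1"
  have B: "B > 0" and AE: "AE x in \<mu>. x \<in> {0..B}" using assms(2) by (auto simp: B_def)
  have nth: "(1 + moment_series \<mu>) $ k = (LINT x|\<mu>. x ^ k)" for k
    using prob_space by (simp add: moment_series_def)
  have int: "integrable \<mu> (\<lambda>x. x ^ k)" for k
    by (intro integrable_bounded_support[OF AE] continuous_intros)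
  have "eventually (\<lambda>t. \<bar>t\<bar> < 1 / (2 * B)) (nhds (0::real))"
    using B by (intro eventually_nhds_metric[THEN iffD2] exI[of _ "1 / (2 * B)"]) (auto simp: dist_norm)
  thus "eventually (\<lambda>t. (\<lambda>k. (1 + moment_series \<mu>) $ k * t ^ k) sums (LINT x|\<mu>. 1 / (1 - t * x))) (nhds 0)"
  proof eventually_elim
    case (elim t)
    define h where "h = (LINT x|\<mu>. 1 / (1 - t * x))"
    have half: "AE x in \<mu>. \<bar>t * x\<bar> \<le> 1 / 2"
      using AE
    proof eventually_elim
      case (elim x)
      have "\<bar>t * x\<bar> \<le> (1 / (2 * B)) * B"
        unfolding abs_mult using elim \<open>\<bar>t\<bar> < 1 / (2 * B)\<close> by (intro mult_mono) auto
      thus ?case using B by simp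
    qed
    have int_h: "integrable \<mu> (\<lambda>x. 1 / (1 - t * x))"
    proof (rule integrable_const_bound)
      show "AE x in \<mu>. norm (1 / (1 - t * x)) \<le> 2"
        using half by eventually_elim (auto simp: divide_simps abs_if split: if_splits)
    qed measurable
    have err: "\<bar>(\<Sum>k<n. (1 + moment_series \<mu>) $ k * t ^ k) - h\<bar> \<le> 2 * (1 / 2) ^ n" for n
    proof -
      have "(\<Sum>k<n. (1 + moment_series \<mu>) $ k * t ^ k) = (LINT x|\<mu>. (\<Sum>k<n. (t * x) ^ k))"
        unfolding nth using int by (simp add: power_mult_distrib mult.commute)
      hence "\<bar>(\<Sum>k<n. (1 + moment_series \<mu>) $ k * t ^ k) - h\<bar> = \<bar>LINT x|\<mu>. (\<Sum>k<n. (t * x) ^ k) - 1 / (1 - t * x)\<bar>"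
        using int int_h by (simp add: h_def power_mult_distrib)
      also have "\<dots> \<le> (LINT x|\<mu>. \<bar>(\<Sum>k<n. (t * x) ^ k) - 1 / (1 - t * x)\<bar>)"
        by (rule integral_abs_bound)
      also have "\<dots> \<le> (LINT x|\<mu>. 2 * (1 / 2) ^ n)"
      proof (rule integral_mono_AE)
        show "integrable \<mu> (\<lambda>x. \<bar>(\<Sum>k<n. (t * x) ^ k) - 1 / (1 - t * x)\<bar>)"
          using int int_h by (simp add: power_mult_distrib)
        show "AE x in \<mu>. \<bar>(\<Sum>k<n. (t * x) ^ k) - 1 / (1 - t * x)\<bar> \<le> 2 * (1 / 2) ^ n"
          using half
        proof eventually_elim
          case (elim x)
          define y where "y = t * x"
          have y: "\<bar>y\<bar> \<le> 1 / 2" "1 - y \<ge> 1 / 2" "y \<noteq> 1" using elim by (auto simp: y_def)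
          have "(\<Sum>k<n. y ^ k) - 1 / (1 - y) = - (y ^ n / (1 - y))"
            using y by (simp add: sum_gp_strict diff_divide_distrib)
          hence "\<bar>(\<Sum>k<n. y ^ k) - 1 / (1 - y)\<bar> = \<bar>y\<bar> ^ n * (1 / (1 - y))"
            using y by (simp add: abs_mult power_abs)
          also have "\<dots> \<le> (1 / 2) ^ n * 2"
            using y by (intro mult_mono power_mono) (auto simp: divide_simps)
          finally show ?case by (simp add: y_def mult.commute)
        qed
      qed simp
      finally show ?thesis using prob_space by simp
    qed
    have "(\<lambda>n. (\<Sum>k<n. (1 + moment_series \<mu>) $ k * t ^ k) - h) \<longlonglongrightarrow> 0"
    proof (rule Lim_null_comparison)
      show "\<forall>\<^sub>F n in sequentially. norm ((\<Sum>k<n. (1 + moment_series \<mu>) $ k * t ^ k) - h) \<le> 2 * (1 / 2) ^ n"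
        using err by (intro always_eventually) auto
      show "(\<lambda>n. 2 * (1 / 2) ^ n :: real) \<longlonglongrightarrow> 0"
        by (intro tendsto_mult_right_zero LIMSEQ_realpow_zero) auto
    qed
    thus ?case unfolding sums_def h_def by (rule LIM_zero_cancel)
  qed
qed

text \<open>
  Since the q_i add up to 1, adding 1 turns each Y / (1 - Y) into 1 / (1 - Y); then multiply by all
  denominators.
\<close>

lemma subordination_cleared:
  fixes u q :: "'i \<Rightarrow> real" and L :: "real fps" and l :: real
  assumes "finite I" "(\<Sum>i\<in>I. q i) = 1"
    and L: "L = (\<Sum>i\<in>I. fps_const (q i) * (fps_const (u i) * fps_X * (fps_const l + L) *
              inverse (1 - fps_const (u i) * fps_X * (fps_const l + L))))"
  shows "(1 + L) * (\<Prod>i\<in>I. 1 - fps_const (u i) * fps_X * (fps_const l + L)) =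
           (\<Sum>i\<in>I. fps_const (q i) * (\<Prod>j\<in>I - {i}. 1 - fps_const (u j) * fps_X * (fps_const l + L)))"
proof -
  define Y where "Y = (\<lambda>i. fps_const (u i) * fps_X * (fps_const l + L))"
  have inv: "(1 - Y i) * inverse (1 - Y i) = 1" for i
    by (rule inverse_mult_eq_1') (simp add: Y_def)
  have "1 + L = (\<Sum>i\<in>I. fps_const (q i)) + (\<Sum>i\<in>I. fps_const (q i) * (Y i * inverse (1 - Y i)))"
  proof -
    have "(\<Sum>i\<in>I. fps_const (q i)) = fps_const (\<Sum>i\<in>I. q i)"
      using assms(1) by (induction I rule: finite_induct) simp_all
    hence "(\<Sum>i\<in>I. fps_const (q i)) = 1" using assms(2) by simp
    thus ?thesis using L by (simp add: Y_def)
  qed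
  also have "\<dots> = (\<Sum>i\<in>I. fps_const (q i) * (1 + Y i * inverse (1 - Y i)))"
    by (simp add: sum.distrib distrib_left)
  also have "\<dots> = (\<Sum>i\<in>I. fps_const (q i) * inverse (1 - Y i))"
  proof (rule sum.cong)
    fix i
    have "1 + Y i * inverse (1 - Y i) = (1 - Y i) * inverse (1 - Y i) + Y i * inverse (1 - Y i)"
      unfolding inv ..
    also have "\<dots> = inverse (1 - Y i)" by (simp add: algebra_simps)
    finally show "fps_const (q i) * (1 + Y i * inverse (1 - Y i)) = fps_const (q i) * inverse (1 - Y i)"
      by simp
  qed simp
  finally have "(1 + L) * (\<Prod>i\<in>I. 1 - Y i) =
      (\<Sum>i\<in>I. fps_const (q i) * inverse (1 - Y i) * (\<Prod>j\<in>I. 1 - Y j))"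
    by (simp add: sum_distrib_right)
  also have "\<dots> = (\<Sum>i\<in>I. fps_const (q i) * (\<Prod>j\<in>I - {i}. 1 - Y j))"
  proof (rule sum.cong)
    fix i assume "i \<in> I"
    have "fps_const (q i) * inverse (1 - Y i) * (\<Prod>j\<in>I. 1 - Y j) =
            fps_const (q i) * ((1 - Y i) * inverse (1 - Y i)) * (\<Prod>j\<in>I - {i}. 1 - Y j)"
      using assms(1) \<open>i \<in> I\<close> by (subst prod.remove[of I i]) (simp_all only: mult_ac)
    thus "fps_const (q i) * inverse (1 - Y i) * (\<Prod>j\<in>I. 1 - Y j) =
            fps_const (q i) * (\<Prod>j\<in>I - {i}. 1 - Y j)"
      unfolding inv by simp
  qed simp
  finally show ?thesis by (simp only: Y_def)
qed

text \<open>
  With t = 1 / x and h(t) = x G(x), every factor x - x G / a_i - \<alpha> / a_i of the curve equals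
  x (1 - t (\<alpha> + h(t)) / a_i).  After dividing by x^(r - 1) the curve becomes the cleared equation for
  formal power series, read as an identity of functions near t = 0.
\<close>

lemma laguerre_curve_at_infinity:
  fixes a q :: "nat \<Rightarrow> real" and \<alpha> :: real
  assumes \<nu>: "real_distribution \<nu>" "AE x in \<nu>. x \<in> {0..C}"
    and "r \<ge> 1" "(\<Sum>i\<in>{1..r}. q i) = 1"
    and L: "moment_series \<nu> = (\<Sum>i\<in>{1..r}. fps_const (q i) *
             (fps_const (1 / a i) * fps_X * (fps_const (1 + \<alpha>) + moment_series \<nu>) *
               inverse (1 - fps_const (1 / a i) * fps_X * (fps_const (1 + \<alpha>) + moment_series \<nu>))))"
  shows "eventually (\<lambda>x. laguerre_curve r a q \<alpha> (of_real x) (cauchy_stieltjes \<nu> (of_real x)) = 0) at_top"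
proof -
  interpret real_distribution \<nu> by fact
  define h where "h = (\<lambda>t. LINT x|\<nu>. 1 / (1 - t * x))"
  define F where "F = (\<lambda>i t. 1 - (1 / a i) * t * ((1 + \<alpha>) + (h t - 1)))"
  define FF where "FF = (\<lambda>i. 1 - fps_const (1 / a i) * fps_X * (fps_const (1 + \<alpha>) + ((1 + moment_series \<nu>) - 1)))"
  have h: "h has_fps_expansion (1 + moment_series \<nu>)"
    unfolding h_def by (rule moment_generating_expansion[OF \<nu>])
  have FF: "F i has_fps_expansion FF i" for i
    unfolding F_def FF_def by (intro fps_expansion_intros h)
  have "(\<lambda>t. h t * (\<Prod>i\<in>{1..r}. F i t) - (\<Sum>i\<in>{1..r}. q i * (\<Prod>j\<in>{1..r} - {i}. F j t)))
      has_fps_expansion ((1 + moment_series \<nu>) * (\<Prod>i\<in>{1..r}. FF i) -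
         (\<Sum>i\<in>{1..r}. fps_const (q i) * (\<Prod>j\<in>{1..r} - {i}. FF j)))"
    by (intro fps_expansion_intros h FF)
  also have "(1 + moment_series \<nu>) * (\<Prod>i\<in>{1..r}. FF i) -
         (\<Sum>i\<in>{1..r}. fps_const (q i) * (\<Prod>j\<in>{1..r} - {i}. FF j)) = 0"
    using subordination_cleared[OF finite_atLeastAtMost assms(4) L] by (simp add: FF_def)
  finally have "eventually (\<lambda>t. h t * (\<Prod>i\<in>{1..r}. F i t) -
      (\<Sum>i\<in>{1..r}. q i * (\<Prod>j\<in>{1..r} - {i}. F j t)) = 0) (nhds 0)"
    unfolding has_fps_expansion_def by (auto elim: eventually_mono)
  moreover have "((\<lambda>x. inverse x) \<longlongrightarrow> (0::real)) at_top"
    by (intro tendsto_inverse_0_at_top filterlim_ident)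
  ultimately have "eventually (\<lambda>x. h (inverse x) * (\<Prod>i\<in>{1..r}. F i (inverse x)) -
      (\<Sum>i\<in>{1..r}. q i * (\<Prod>j\<in>{1..r} - {i}. F j (inverse x))) = 0) at_top"
    by (rule eventually_compose_filterlim)
  thus ?thesis using eventually_gt_at_top[of "0::real"]
  proof eventually_elim
    case (elim x)
    define t where "t = inverse x"
    define G where "G = (LINT y|\<nu>. 1 / (x - y))"
    have t: "t * x = 1" "x * t = 1" using elim(2) by (simp_all add: t_def)
    have "1 / (x - y) = t * (1 / (1 - t * y))" for y
      using elim(2) by (cases "x = y") (simp_all add: t_def divide_simps)
    hence Gh: "G = t * h t" unfolding G_def h_def by (simp only: integral_mult_right_zero)
    have "cauchy_stieltjes \<nu> (of_real x) = (CLINT y|\<nu>. complex_of_real (1 / (x - y)))"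
      unfolding cauchy_stieltjes_def by simp
    also have "\<dots> = of_real G" unfolding G_def by (rule integral_complex_of_real)
    finally have cs: "cauchy_stieltjes \<nu> (of_real x) = of_real G" .
    have factor: "complex_of_real x - of_real x * of_real G / of_real (a i) - of_real (\<alpha> / a i) =
                    of_real x * of_real (F i t)" for i
    proof -
      have "x - x * G / a i - \<alpha> / a i = x - (x * t) * (h t / a i) - (x * t) * (\<alpha> / a i)"
        unfolding t by (simp add: Gh flip: mult.assoc) (simp add: t)
      also have "\<dots> = x * F i t"
        by (simp add: F_def algebra_simps add_divide_distrib diff_divide_distrib)
      finally have "complex_of_real (x - x * G / a i - \<alpha> / a i) = of_real (x * F i t)" by simp
      thus ?thesis by simp
    qed
    have x_pow: "x ^ r = x * x ^ (r - 1)" using assms(3) by (cases r) auto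
    have "laguerre_curve r a q \<alpha> (of_real x) (cauchy_stieltjes \<nu> (of_real x)) =
        of_real (G * (x ^ r * (\<Prod>i\<in>{1..r}. F i t)) -
          (\<Sum>i\<in>{1..r}. q i * (x ^ (r - 1) * (\<Prod>j\<in>{1..r} - {i}. F j t))))"
      unfolding laguerre_curve_def cs factor by (simp add: prod.distrib)
    also have "G * (x ^ r * (\<Prod>i\<in>{1..r}. F i t)) -
          (\<Sum>i\<in>{1..r}. q i * (x ^ (r - 1) * (\<Prod>j\<in>{1..r} - {i}. F j t))) =
        x ^ (r - 1) * ((x * t) * h t * (\<Prod>i\<in>{1..r}. F i t) -
          (\<Sum>i\<in>{1..r}. q i * (\<Prod>j\<in>{1..r} - {i}. F j t)))"
      unfolding x_pow Gh by (simp add: sum_distrib_left right_diff_distrib mult_ac)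
    also have "\<dots> = 0" using elim(1) unfolding t by (simp add: t_def)
    finally show ?case by simp
  qed
qed

text \<open>
  The left side is holomorphic off the support and vanishes on a real half line, which has
  accumulation points in the connected complement of the support.
\<close>

theorem laguerre_curve_vanishes:
  fixes a q :: "nat \<Rightarrow> real" and \<alpha> :: real
  assumes \<nu>: "real_distribution \<nu>" "AE x in \<nu>. x \<in> {0..C}"
    and "r \<ge> 1" "(\<Sum>i\<in>{1..r}. q i) = 1"
    and L: "moment_series \<nu> = (\<Sum>i\<in>{1..r}. fps_const (q i) *
             (fps_const (1 / a i) * fps_X * (fps_const (1 + \<alpha>) + moment_series \<nu>) *
               inverse (1 - fps_const (1 / a i) * fps_X * (fps_const (1 + \<alpha>) + moment_series \<nu>))))"
    and "\<And>i. i \<in> {1..r} \<Longrightarrow> a i \<noteq> 0" "z \<notin> complex_of_real ` measure_support \<nu>"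
  shows "laguerre_curve r a q \<alpha> z (cauchy_stieltjes \<nu> z) = 0"
proof -
  interpret real_distribution \<nu> by fact
  define S where "S = - complex_of_real ` measure_support \<nu>"
  have sub: "measure_support \<nu> \<subseteq> {0..C}"
    by (rule measure_support_subset) (use \<nu> in auto)
  hence compact: "compact (measure_support \<nu>)"
    by (meson bounded_closed_interval bounded_subset closed_measure_support compact_eq_bounded_closed)
  obtain X where X: "\<And>x. x \<ge> X \<Longrightarrow> laguerre_curve r a q \<alpha> (of_real x) (cauchy_stieltjes \<nu> (of_real x)) = 0"
    using laguerre_curve_at_infinity[OF \<nu> assms(3,4) L] unfolding eventually_at_top_linorder by blast
  define B where "B = max X (max C 0 + 1)"
  have B: "complex_of_real x \<in> S" if "x \<ge> B" for x
    using that sub by (auto simp: S_def B_def)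
  define U where "U = complex_of_real ` {B<..}"
  have islimpt: "complex_of_real B islimpt U"
    unfolding islimpt_approachable
  proof (intro allI impI)
    fix e :: real assume "e > 0"
    thus "\<exists>w\<in>U. w \<noteq> of_real B \<and> dist w (of_real B) < e"
      unfolding U_def by (intro bexI[of _ "complex_of_real (B + e / 2)"] imageI) (auto simp: dist_norm)
  qed
  have hol: "(\<lambda>z. laguerre_curve r a q \<alpha> z (cauchy_stieltjes \<nu> z)) holomorphic_on S"
    unfolding laguerre_curve_def S_def using assms(6)
    by (intro holomorphic_intros cauchy_stieltjes_holomorphic[OF \<nu>(1)]) auto
  have zero: "laguerre_curve r a q \<alpha> w (cauchy_stieltjes \<nu> w) = 0" if "w \<in> U" for w
    using that X by (auto simp: U_def B_def)
  have "open S" "connected S"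
    unfolding S_def by (rule open_connected_complement_of_real_compact[OF compact])+
  moreover have "U \<subseteq> S" "complex_of_real B \<in> S" using B by (auto simp: U_def)
  moreover have "z \<in> S" using assms(7) by (simp add: S_def)
  ultimately show ?thesis
    using analytic_continuation[OF hol _ _ _ _ islimpt zero] by blast
qed

text \<open>
  The equation for the moment series of \<nu> is M = E o (X (1 + \<alpha> + M)) written out, as u Y / (1 - u Y) is
  the composition of the moment series of the unit mass at u with Y.
\<close>

lemma limit_is_free_mult_conv:
  fixes a q :: "nat \<Rightarrow> real" and \<alpha> :: real
  assumes \<nu>: "real_distribution \<nu>" "AE x in \<nu>. x \<in> {0..C}"
    and "\<alpha> \<ge> 0" "r \<ge> 1" "\<And>i. i \<in> {1..r} \<Longrightarrow> a i > 0" "\<And>i. i \<in> {1..r} \<Longrightarrow> q i > 0"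
    and L: "moment_series \<nu> = (\<Sum>i\<in>{1..r}. fps_const (q i) *
             (fps_const (1 / a i) * fps_X * (fps_const (1 + \<alpha>) + moment_series \<nu>) *
               inverse (1 - fps_const (1 / a i) * fps_X * (fps_const (1 + \<alpha>) + moment_series \<nu>))))"
  shows "marchenko_pastur (1 / (1 + \<alpha>)) \<boxtimes> discrete_measure r q (\<lambda>j. 1 / a j) = \<nu>"
proof (rule free_mult_conv_eqI)
  interpret real_distribution \<nu> by fact
  define l where "l = 1 + \<alpha>"
  have l: "l \<ge> 1" using assms(3) by (simp add: l_def)
  define A where "A = moment_series (marchenko_pastur (1 / l))"
  define E where "E = moment_series (discrete_measure r q (\<lambda>j. 1 / a j))"
  define K where "K = moment_series \<nu>"
  have E: "E = (\<Sum>i\<in>{1..r}. fps_const (q i) * Abs_fps (\<lambda>k. if k = 0 then 0 else (1 / a i) ^ k))"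
    unfolding E_def using assms(6) by (intro moment_series_discrete_measure) (auto intro: less_imp_le)
  have E1: "E $ 1 = (\<Sum>i\<in>{1..r}. q i / a i)"
    unfolding E by (simp add: fps_sum_nth)
  have pos: "(\<Sum>i\<in>{1..r}. q i / a i) > 0"
    using assms(4,5,6) by (intro sum_pos) auto
  have KE: "K = E oo (fps_X * (fps_const l + K))"
  proof -
    have "E oo (fps_X * (fps_const l + K)) = (\<Sum>i\<in>{1..r}. fps_const (q i) *
       (fps_const (1 / a i) * (fps_X * (fps_const l + K)) * inverse (1 - fps_const (1 / a i) * (fps_X * (fps_const l + K)))))"
      unfolding E fps_compose_sum_distrib
    proof (rule sum.cong)
      fix i
      let ?Y = "fps_X * (fps_const l + K)"
      have Y: "?Y $ 0 = 0" by simp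
      show "(fps_const (q i) * Abs_fps (\<lambda>k. if k = 0 then 0 else (1 / a i) ^ k)) oo ?Y =
         fps_const (q i) * (fps_const (1 / a i) * ?Y * inverse (1 - fps_const (1 / a i) * ?Y))"
        unfolding fps_compose_mult_distrib[OF Y] geometric_fps_compose[OF Y] by simp
    qed simp
    also have "\<dots> = K"
      using L unfolding K_def l_def by (simp only: mult.assoc)
    finally show ?thesis ..
  qed
  have K1: "K $ 1 = (\<Sum>i\<in>{1..r}. q i / a i) * l"
    unfolding K_def l_def by (subst L) (simp add: fps_sum_nth mult.assoc sum_distrib_right)
  have mean: "(LINT x|\<nu>. x) > 0"
    using K1 pos l by (simp add: K_def)
  have sub: "measure_support \<nu> \<subseteq> {0..C}"
    by (rule measure_support_subset) (use \<nu> in auto)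
  show "compact_prob_nonneg \<nu>"
    unfolding compact_prob_nonneg_def
  proof (intro conjI)
    show "prob_space \<nu>" by unfold_locales
    show "compact (measure_support \<nu>)"
      using sub by (meson bounded_closed_interval bounded_subset closed_measure_support compact_eq_bounded_closed)
    show "measure_support \<nu> \<subseteq> {0..}" using sub by auto
    show "\<nu> \<noteq> return borel 0" using mean by (auto simp: integral_return)
  qed simp
  note mp = marchenko_pastur_moment_series[OF l]
  have "S_series K = S_series A * S_series E"
  proof (rule S_series_subordination[OF _ _ _ _ _ _ _ _ KE])
    show "A = fps_X * (fps_const l + A) * (1 + A)" unfolding A_def by (rule mp(1))
    show "A $ 1 \<noteq> 0" unfolding A_def mp(2) using l by simp
    show "E $ 1 \<noteq> 0" "K $ 1 \<noteq> 0" unfolding E1 K1 using pos l by auto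
  qed (use l in \<open>auto simp: A_def E_def K_def\<close>)
  thus "S_transform \<nu> = S_transform (marchenko_pastur (1 / (1 + \<alpha>))) *
          S_transform (discrete_measure r q (\<lambda>j. 1 / a j))"
    unfolding S_transform_eq A_def E_def K_def l_def .
qed

theorem corollary3p8:
  fixes r :: nat and a q :: "nat \<Rightarrow> real" and \<alpha> :: real
    and n :: "nat \<Rightarrow> nat \<Rightarrow> nat" and \<nu> :: "real measure"
  assumes "r \<ge> 2"
    and "\<And>i. i \<in> {1..r} \<Longrightarrow> a i > 0"
    and "inj_on a {1..r}"
    and "\<alpha> \<ge> 0"
    and "path_like r n q"
    and "\<nu> = marchenko_pastur (1 / (1 + \<alpha>)) \<boxtimes> discrete_measure r q (\<lambda>j. 1 / a j)"
  shows "weakly_converges_to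
           (\<lambda>N. zero_distribution
                  (multiple_laguerre2 r (real N * \<alpha>) (\<lambda>j. real N * a j) (n N)))
           (distr \<nu> borel complex_of_real)
       \<and> (\<forall>z. z \<notin> complex_of_real ` measure_support \<nu> \<longrightarrow>
               laguerre_curve r a q \<alpha> z (cauchy_stieltjes \<nu> z) = 0)"
proof -
  have r: "r \<ge> 1" using assms(1) by simp
  obtain M C where M: "real_distribution M" "AE x in M. x \<in> {0..C}"
    and L: "moment_series M = (\<Sum>i\<in>{1..r}. fps_const (q i) *
             (fps_const (1 / a i) * fps_X * (fps_const (1 + \<alpha>) + moment_series M) *
               inverse (1 - fps_const (1 / a i) * fps_X * (fps_const (1 + \<alpha>) + moment_series M))))"
    and conv: "weakly_converges_to
             (\<lambda>N. zero_distribution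
                (multiple_laguerre2 r (real N * \<alpha>) (\<lambda>j. real N * a j) (n N)))
             (distr M borel complex_of_real)"
    using rescaled_laguerre_zeros_converge[OF r assms(2-5)] by blast
  have q: "q i > 0" if "i \<in> {1..r}" for i
    using assms(5) that unfolding path_like_def by auto
  have "\<nu> = M"
    unfolding assms(6) using limit_is_free_mult_conv[OF M assms(4) r assms(2) q L] by simp
  moreover have "laguerre_curve r a q \<alpha> z (cauchy_stieltjes M z) = 0"
    if "z \<notin> complex_of_real ` measure_support M" for z
    using laguerre_curve_vanishes[OF M r path_like_sum_proportions[OF assms(5)] L _ that] assms(2)
    by force
  ultimately show ?thesis using conv by blast
qed


end
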